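(* Let $(M,E)$ be a dense pair of models of a geometric theory $T$ of topological rings in a language $\mathcal L$, such that $T$ is tame for pairs, i.e. every $\mathcal L^P$-definably closed set is special. Then every open subset of $M^n$ which is $\mathcal L^P$-definable over a special set $A$ is $\mathcal L_A$-definable. In particular, the topological closure $\mathrm{cl}_M(X)$ of a subset $X\subseteq M^n$ which is $\mathcal L^P$-definable over a special set $A$ is $\mathcal L_A$-definable.
   Context: A complete $\mathcal L$-theory $T$, with $\mathcal L$ containing the ring language, is a geometric theory of topological rings if: (i) $T$ eliminates $\exists^\infty$; (ii) in every model, $\mathrm{acl}$ satisfies exchange; (iii) $T$ has definable Skolem functions; (iv) there is an $\mathcal L$-formula $\theta(x,\bar y)$, $x$ a single variable, such that in every model $M$ the sets $\theta(M,\bar a)$ form a basis of a $T_1$ topology without isolated points (products carry the product topology), and $M$ has cell decomposition: for every $A\subseteq M$ the domain of every $A$-definable function $F$ can be partitioned into finitely many $A$-definable cells on each of which $F$ is continuous, a cell being a definable $C\subseteq M^n$ such that for some coordinate projection $\pi$, $\pi(C)$ is open and $\pi|_C$ is a homeomorphism onto $\pi(C)$; (v) every definable subset of $M$ is finite or has non-empty interior; (vi) $M$ is an integral domain with continuous ring operations; (vii) for every $\bar a$ and $b\in\theta(M,\bar a)$ there are an open neighbourhood $V$ of $\bar a$ and $\bar c$ with $b\in\theta(M,\bar c)\subseteq\theta(M,\bar d)$ for all $\bar d\in V$, and the set of $\bar a'$ with $b\in\theta(M,\bar a')\subseteq\theta(M,\bar a)$ has non-empty interior. $\dim(a/B)$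 is the $\mathrm{acl}$-dimension. A dense pair of models of $T$ is $(M,E)$ with $M\models T$, $E\preceq M$ proper and dense in $M$, as an $\mathcal L^P=\mathcal L\cup\{P\}$-structure with $P$ naming $E$. A set $A\subseteq M$ is special if $\dim(a/E)=\dim(a/E\cap A)$ for all finite tuples $a$ from $A$. $T$ is tame for pairs if in every dense pair of models of $T$ every $\mathcal L^P$-definably closed subset is special. "$\mathcal L_A$-definable" means $\mathcal L$-definable with parameters from $A$. *)

theory Defs
  imports "HOL-Analysis.Analysis" "HOL-Algebra.Ring"
begin

section \<open>First-order logic\<close>

text \<open>A language is given by sets of symbols rather than by whole types, so that it may have
  no relation symbols or no function symbols.  Constants are nullary function symbols.\<close>

record ('f, 'r) lang =
  funs :: "'f set"
  rels :: "'r set"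
  fun_arity :: "'f \<Rightarrow> nat"
  rel_arity :: "'r \<Rightarrow> nat"

datatype 'f tm = Var nat | Fn 'f "'f tm list"

datatype ('f, 'r) fm =
    Equal "'f tm" "'f tm"
  | Rel 'r "'f tm list"
  | Neg "('f, 'r) fm"
  | Conj "('f, 'r) fm" "('f, 'r) fm"
  | Exists nat "('f, 'r) fm"

fun wf_tm :: "('f, 'r) lang \<Rightarrow> 'f tm \<Rightarrow> bool" where
  "wf_tm L (Var i) \<longleftrightarrow> True"
| "wf_tm L (Fn f ts) \<longleftrightarrow> f \<in> funs L \<and> length ts = fun_arity L f \<and> (\<forall>t\<in>set ts. wf_tm L t)"

fun wf_fm :: "('f, 'r) lang \<Rightarrow> ('f, 'r) fm \<Rightarrow> bool" where
  "wf_fm L (Equal s t) \<longleftrightarrow> wf_tm L s \<and> wf_tm L t"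
| "wf_fm L (Rel r ts) \<longleftrightarrow> r \<in> rels L \<and> length ts = rel_arity L r \<and> (\<forall>t\<in>set ts. wf_tm L t)"
| "wf_fm L (Neg \<phi>) \<longleftrightarrow> wf_fm L \<phi>"
| "wf_fm L (Conj \<phi> \<psi>) \<longleftrightarrow> wf_fm L \<phi> \<and> wf_fm L \<psi>"
| "wf_fm L (Exists i \<phi>) \<longleftrightarrow> wf_fm L \<phi>"

fun fv_tm :: "'f tm \<Rightarrow> nat set" where
  "fv_tm (Var i) = {i}"
| "fv_tm (Fn f ts) = (\<Union>t\<in>set ts. fv_tm t)"

fun fv :: "('f, 'r) fm \<Rightarrow> nat set" where
  "fv (Equal s t) = fv_tm s \<union> fv_tm t"
| "fv (Rel r ts) = (\<Union>t\<in>set ts. fv_tm t)"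
| "fv (Neg \<phi>) = fv \<phi>"
| "fv (Conj \<phi> \<psi>) = fv \<phi> \<union> fv \<psi>"
| "fv (Exists i \<phi>) = fv \<phi> - {i}"

definition sentence :: "('f, 'r) lang \<Rightarrow> ('f, 'r) fm \<Rightarrow> bool" where
  "sentence L \<phi> \<longleftrightarrow> wf_fm L \<phi> \<and> fv \<phi> = {}"

record ('f, 'r, 'a) struct =
  universe :: "'a set"
  fun_of :: "'f \<Rightarrow> 'a list \<Rightarrow> 'a"
  rel_of :: "'r \<Rightarrow> 'a list \<Rightarrow> bool"

definition is_struct :: "('f, 'r) lang \<Rightarrow> ('f, 'r, 'a) struct \<Rightarrow> bool" where
  "is_struct L M \<longleftrightarrow> universe M \<noteq> {} \<and>
     (\<forall>f\<in>funs L. \<forall>xs. length xs = fun_arity L f \<and> set xs \<subseteq> universe M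
        \<longrightarrow> fun_of M f xs \<in> universe M)"

fun val :: "('f, 'r, 'a) struct \<Rightarrow> (nat \<Rightarrow> 'a) \<Rightarrow> 'f tm \<Rightarrow> 'a" where
  "val M v (Var i) = v i"
| "val M v (Fn f ts) = fun_of M f (map (val M v) ts)"

fun sat :: "('f, 'r, 'a) struct \<Rightarrow> (nat \<Rightarrow> 'a) \<Rightarrow> ('f, 'r) fm \<Rightarrow> bool" where
  "sat M v (Equal s t) \<longleftrightarrow> val M v s = val M v t"
| "sat M v (Rel r ts) \<longleftrightarrow> rel_of M r (map (val M v) ts)"
| "sat M v (Neg \<phi>) \<longleftrightarrow> \<not> sat M v \<phi>"
| "sat M v (Conj \<phi> \<psi>) \<longleftrightarrow> sat M v \<phi> \<and> sat M v \<psi>"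
| "sat M v (Exists i \<phi>) \<longleftrightarrow> (\<exists>x\<in>universe M. sat M (v(i := x)) \<phi>)"

definition satisfies :: "('f, 'r, 'a) struct \<Rightarrow> ('f, 'r) fm \<Rightarrow> bool" where
  "satisfies M \<phi> \<longleftrightarrow> (\<forall>v. range v \<subseteq> universe M \<longrightarrow> sat M v \<phi>)"

definition models :: "('f, 'r) lang \<Rightarrow> ('f, 'r, 'a) struct \<Rightarrow> ('f, 'r) fm set \<Rightarrow> bool" where
  "models L M T \<longleftrightarrow> is_struct L M \<and> (\<forall>\<phi>\<in>T. satisfies M \<phi>)"

definition elementary_sub :: "('f, 'r) lang \<Rightarrow> ('f, 'r, 'a) struct \<Rightarrow> 'a set \<Rightarrow> bool" where
  "elementary_sub L M E \<longleftrightarrow> E \<subseteq> universe M \<and> is_struct L (M\<lparr>universe := E\<rparr>) \<and>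
     (\<forall>\<phi> v. wf_fm L \<phi> \<and> range v \<subseteq> E \<longrightarrow> sat (M\<lparr>universe := E\<rparr>) v \<phi> = sat M v \<phi>)"

section \<open>Definable sets, algebraic and definable closure\<close>

text \<open>An n-tuple is an element of \<open>{..<n} \<rightarrow>\<^sub>E universe M\<close>, which is also the underlying set of
  the library's product topology.  \<open>append_tuple n x y\<close> is x followed by y, where x has length n.\<close>

definition tuples :: "'a set \<Rightarrow> nat \<Rightarrow> (nat \<Rightarrow> 'a) set" where
  "tuples S n = ({..<n} \<rightarrow>\<^sub>E S)"

definition append_tuple :: "nat \<Rightarrow> (nat \<Rightarrow> 'a) \<Rightarrow> (nat \<Rightarrow> 'a) \<Rightarrow> nat \<Rightarrow> 'a" where
  "append_tuple n x y = (\<lambda>i. if i < n then x i else y (i - n))"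

definition definable_set ::
    "('f, 'r) lang \<Rightarrow> ('f, 'r, 'a) struct \<Rightarrow> 'a set \<Rightarrow> nat \<Rightarrow> (nat \<Rightarrow> 'a) set \<Rightarrow> bool" where
  "definable_set L M A n X \<longleftrightarrow>
     (\<exists>\<phi> k. \<exists>b\<in>tuples A k. wf_fm L \<phi> \<and> fv \<phi> \<subseteq> {..<n + k} \<and>
        X = {x \<in> tuples (universe M) n. sat M (append_tuple n x b) \<phi>})"

text \<open>Here M and its first power are distinguished.  In \<open>fiber M \<phi> b\<close>, the set \<open>\<phi>(M, b)\<close>, variable 0 is
  the distinguished variable x, and variable i + 1 stands for the i-th entry of b.\<close>

definition fiber :: "('f, 'r, 'a) struct \<Rightarrow> ('f, 'r) fm \<Rightarrow> (nat \<Rightarrow> 'a) \<Rightarrow> 'a set" where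
  "fiber M \<phi> b = {x \<in> universe M. sat M (case_nat x b) \<phi>}"

definition definable_subset ::
    "('f, 'r) lang \<Rightarrow> ('f, 'r, 'a) struct \<Rightarrow> 'a set \<Rightarrow> 'a set \<Rightarrow> bool" where
  "definable_subset L M A X \<longleftrightarrow>
     (\<exists>\<phi> k. \<exists>b\<in>tuples A k. wf_fm L \<phi> \<and> fv \<phi> \<subseteq> {..k} \<and> X = fiber M \<phi> b)"

text \<open>F is only relevant on its domain X, and is definable if its graph is.\<close>

definition definable_map ::
    "('f, 'r) lang \<Rightarrow> ('f, 'r, 'a) struct \<Rightarrow> 'a set \<Rightarrow> nat \<Rightarrow> nat
      \<Rightarrow> (nat \<Rightarrow> 'a) set \<Rightarrow> ((nat \<Rightarrow> 'a) \<Rightarrow> nat \<Rightarrow> 'a) \<Rightarrow> bool" where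
  "definable_map L M A n m X F \<longleftrightarrow>
     X \<subseteq> tuples (universe M) n \<and> F \<in> X \<rightarrow> tuples (universe M) m \<and>
     definable_set L M A (n + m) ((\<lambda>x. append_tuple n x (F x)) ` X)"

definition acl :: "('f, 'r) lang \<Rightarrow> ('f, 'r, 'a) struct \<Rightarrow> 'a set \<Rightarrow> 'a set" where
  "acl L M A = {a. \<exists>X. definable_subset L M A X \<and> finite X \<and> a \<in> X}"

definition dcl :: "('f, 'r) lang \<Rightarrow> ('f, 'r, 'a) struct \<Rightarrow> 'a set \<Rightarrow> 'a set" where
  "dcl L M A = {a. definable_subset L M A {a}}"

definition acl_exchange :: "('f, 'r) lang \<Rightarrow> ('f, 'r, 'a) struct \<Rightarrow> bool" where
  "acl_exchange L M \<longleftrightarrow>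
     (\<forall>A a b. A \<subseteq> universe M \<and> a \<in> universe M \<and> b \<in> universe M \<and>
        a \<in> acl L M (insert b A) \<and> a \<notin> acl L M A \<longrightarrow> b \<in> acl L M (insert a A))"

definition acl_basis ::
    "('f, 'r) lang \<Rightarrow> ('f, 'r, 'a) struct \<Rightarrow> 'a set \<Rightarrow> 'a set \<Rightarrow> 'a set \<Rightarrow> bool" where
  "acl_basis L M S B I \<longleftrightarrow> I \<subseteq> S \<and> (\<forall>a\<in>I. a \<notin> acl L M (B \<union> (I - {a}))) \<and> S \<subseteq> acl L M (B \<union> I)"

text \<open>\<open>acl_dim L M as B\<close> is dim(as/B).  Under exchange all bases have the same cardinality; LEAST
  only serves to have a total function.\<close>

definition acl_dim :: "('f, 'r) lang \<Rightarrow> ('f, 'r, 'a) struct \<Rightarrow> 'a list \<Rightarrow> 'a set \<Rightarrow> nat" where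
  "acl_dim L M as B = (LEAST d. \<exists>I. acl_basis L M (set as) B I \<and> card I = d)"

section \<open>The definable topology\<close>

definition basic_sets ::
    "('f, 'r, 'a) struct \<Rightarrow> ('f, 'r) fm \<Rightarrow> nat \<Rightarrow> 'a set set" where
  "basic_sets M \<theta> p = fiber M \<theta> ` tuples (universe M) p"

definition def_top ::
    "('f, 'r, 'a) struct \<Rightarrow> ('f, 'r) fm \<Rightarrow> nat \<Rightarrow> 'a topology" where
  "def_top M \<theta> p = topology (arbitrary union_of (\<lambda>U. U \<in> basic_sets M \<theta> p))"

text \<open>The \<open>istopology\<close> clause says that the basic sets form a basis; only then does \<open>def_top\<close> have
  the unions of basic sets as its open sets.\<close>

definition good_topology ::
    "('f, 'r, 'a) struct \<Rightarrow> ('f, 'r) fm \<Rightarrow> nat \<Rightarrow> bool" where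
  "good_topology M \<theta> p \<longleftrightarrow>
     istopology (arbitrary union_of (\<lambda>U. U \<in> basic_sets M \<theta> p)) \<and>
     topspace (def_top M \<theta> p) = universe M \<and>
     t1_space (def_top M \<theta> p) \<and>
     (\<forall>x\<in>universe M. \<not> openin (def_top M \<theta> p) {x})"

definition power_top :: "'a topology \<Rightarrow> nat set \<Rightarrow> (nat \<Rightarrow> 'a) topology" where
  "power_top X J = product_topology (\<lambda>_. X) J"

text \<open>The coordinate projection to the coordinates in J is \<open>\<lambda>x. restrict x J\<close>, with target the power
  of M indexed by J.\<close>

definition cell_shaped :: "'a topology \<Rightarrow> nat \<Rightarrow> (nat \<Rightarrow> 'a) set \<Rightarrow> bool" where
  "cell_shaped X n C \<longleftrightarrow>
     (\<exists>J\<subseteq>{..<n}. let \<pi> = (\<lambda>x. restrict x J) in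
        openin (power_top X J) (\<pi> ` C) \<and>
        homeomorphic_map (subtopology (power_top X {..<n}) C)
                         (subtopology (power_top X J) (\<pi> ` C)) \<pi>)"

definition cell_decomposition ::
    "('f, 'r) lang \<Rightarrow> ('f, 'r, 'a) struct \<Rightarrow> 'a topology \<Rightarrow> bool" where
  "cell_decomposition L M X \<longleftrightarrow>
     (\<forall>A n m D F. A \<subseteq> universe M \<and> definable_map L M A n m D F \<longrightarrow>
        (\<exists>\<C>. finite \<C> \<and> partition_on D \<C> \<and>
           (\<forall>C\<in>\<C>. definable_set L M A n C \<and> cell_shaped X n C \<and>
              continuous_map (subtopology (power_top X {..<n}) C) (power_top X {..<m}) F)))"

record 'f ring_symbols =
  zero_sym :: 'f
  one_sym :: 'f
  add_sym :: 'f
  minus_sym :: 'f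
  mult_sym :: 'f

text \<open>The ring language is 0, 1, +, unary minus, multiplication.\<close>

definition contains_ring_language :: "('f, 'r) lang \<Rightarrow> 'f ring_symbols \<Rightarrow> bool" where
  "contains_ring_language L R \<longleftrightarrow>
     distinct [zero_sym R, one_sym R, add_sym R, minus_sym R, mult_sym R] \<and>
     {zero_sym R, one_sym R, add_sym R, minus_sym R, mult_sym R} \<subseteq> funs L \<and>
     fun_arity L (zero_sym R) = 0 \<and> fun_arity L (one_sym R) = 0 \<and>
     fun_arity L (add_sym R) = 2 \<and> fun_arity L (minus_sym R) = 1 \<and>
     fun_arity L (mult_sym R) = 2"

definition ring_of :: "'f ring_symbols \<Rightarrow> ('f, 'r, 'a) struct \<Rightarrow> 'a ring" where
  "ring_of R M =
     \<lparr>carrier = universe M,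
      monoid.mult = (\<lambda>x y. fun_of M (mult_sym R) [x, y]),
      one = fun_of M (one_sym R) [],
      zero = fun_of M (zero_sym R) [],
      add = (\<lambda>x y. fun_of M (add_sym R) [x, y])\<rparr>"

definition topological_domain ::
    "'f ring_symbols \<Rightarrow> ('f, 'r, 'a) struct \<Rightarrow> 'a topology \<Rightarrow> bool" where
  "topological_domain R M X \<longleftrightarrow>
     domain (ring_of R M) \<and>
     (\<forall>x\<in>universe M. fun_of M (minus_sym R) [x] = a_inv (ring_of R M) x) \<and>
     continuous_map (prod_topology X X) X (\<lambda>(x, y). fun_of M (add_sym R) [x, y]) \<and>
     continuous_map X X (\<lambda>x. fun_of M (minus_sym R) [x]) \<and>
     continuous_map (prod_topology X X) X (\<lambda>(x, y). fun_of M (mult_sym R) [x, y])"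

definition uniform_basis :: "('f, 'r, 'a) struct \<Rightarrow> ('f, 'r) fm \<Rightarrow> nat \<Rightarrow> bool" where
  "uniform_basis M \<theta> p \<longleftrightarrow>
     (let Mp = tuples (universe M) p; \<tau> = power_top (def_top M \<theta> p) {..<p} in
      \<forall>a\<in>Mp. \<forall>b\<in>fiber M \<theta> a.
        (\<exists>V. openin \<tau> V \<and> a \<in> V \<and>
           (\<exists>c\<in>Mp. b \<in> fiber M \<theta> c \<and> (\<forall>d\<in>V. fiber M \<theta> c \<subseteq> fiber M \<theta> d))) \<and>
        \<tau> interior_of {a'\<in>Mp. b \<in> fiber M \<theta> a' \<and> fiber M \<theta> a' \<subseteq> fiber M \<theta> a} \<noteq> {})"

section \<open>Geometric theories of topological rings\<close>

text \<open>HOL cannot quantify over types inside a formula, so ``every model'' has to range over the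
  models with universe in a fixed type.  From here on that type is the one from which the symbols
  of the language are drawn as well; it plays the role of the set-theoretic universe and is
  otherwise arbitrary (any language and any model can be coded in a common type, with as much
  additional room as desired).  As the language has at most as many symbols as this type has
  elements, and models of the theories considered are infinite, the Loewenheim-Skolem theorem
  shows that each condition below on all models in the type is equivalent to the same condition
  on all models.\<close>

type_synonym 'u ulang = "('u, 'u) lang"
type_synonym 'u ufm = "('u, 'u) fm"
type_synonym 'u ustruct = "('u, 'u, 'u) struct"

definition complete_theory :: "'u ulang \<Rightarrow> 'u ufm set \<Rightarrow> bool" where
  "complete_theory L T \<longleftrightarrow>
     (\<forall>\<phi>\<in>T. sentence L \<phi>) \<and>
     (\<exists>M :: 'u ustruct. models L M T) \<and>
     (\<forall>\<phi>. sentence L \<phi> \<longrightarrow>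
        (\<forall>M :: 'u ustruct. models L M T \<longrightarrow> satisfies M \<phi>) \<or>
        (\<forall>M :: 'u ustruct. models L M T \<longrightarrow> satisfies M (Neg \<phi>)))"

text \<open>In the next two definitions k is the length of the tuple of parameter variables of \<open>\<phi>\<close>.
  The formula \<open>\<psi>\<close> is evaluated at a dummy value of variable 0, which is not free in it.\<close>

definition eliminates_ex_infinity :: "'u ulang \<Rightarrow> 'u ufm set \<Rightarrow> bool" where
  "eliminates_ex_infinity L T \<longleftrightarrow>
     (\<forall>\<phi> k. wf_fm L \<phi> \<and> fv \<phi> \<subseteq> {..k} \<longrightarrow>
        (\<exists>\<psi>. wf_fm L \<psi> \<and> fv \<psi> \<subseteq> {1..k} \<and>
           (\<forall>M :: 'u ustruct. models L M T \<longrightarrow>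
              (\<forall>b\<in>tuples (universe M) k.
                 sat M (case_nat undefined b) \<psi> \<longleftrightarrow> infinite (fiber M \<phi> b)))))"

definition definable_skolem_functions :: "'u ulang \<Rightarrow> 'u ufm set \<Rightarrow> bool" where
  "definable_skolem_functions L T \<longleftrightarrow>
     (\<forall>\<phi> k. wf_fm L \<phi> \<and> fv \<phi> \<subseteq> {..k} \<longrightarrow>
        (\<exists>\<psi>. wf_fm L \<psi> \<and> fv \<psi> \<subseteq> {..k} \<and>
           (\<forall>M :: 'u ustruct. models L M T \<longrightarrow>
              (\<forall>b\<in>tuples (universe M) k.
                 fiber M \<phi> b \<noteq> {} \<longrightarrow> (\<exists>c\<in>fiber M \<phi> b. fiber M \<psi> b = {c})))))"

text \<open>The formula \<open>\<theta>\<close>, with p parameter variables, is part of the data, since density and openness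
  refer to the topology that it defines.\<close>

definition geometric_theory ::
    "'u ulang \<Rightarrow> 'u ring_symbols \<Rightarrow> 'u ufm set \<Rightarrow> 'u ufm \<Rightarrow> nat \<Rightarrow> bool" where
  "geometric_theory L R T \<theta> p \<longleftrightarrow>
     contains_ring_language L R \<and>
     complete_theory L T \<and>
     eliminates_ex_infinity L T \<and>
     definable_skolem_functions L T \<and>
     wf_fm L \<theta> \<and> fv \<theta> \<subseteq> {..p} \<and>
     (\<forall>M :: 'u ustruct. models L M T \<longrightarrow>
        acl_exchange L M \<and>
        good_topology M \<theta> p \<and>
        cell_decomposition L M (def_top M \<theta> p) \<and>
        (\<forall>X. definable_subset L M (universe M) X \<longrightarrow>
           finite X \<or> def_top M \<theta> p interior_of X \<noteq> {}) \<and>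
        topological_domain R M (def_top M \<theta> p) \<and>
        uniform_basis M \<theta> p)"

section \<open>Dense pairs\<close>

text \<open>The predicate symbol P is \<open>None\<close>; being unary, it is only ever applied to singleton lists.\<close>

definition pair_lang :: "('f, 'r) lang \<Rightarrow> ('f, 'r option) lang" where
  "pair_lang L =
     \<lparr>funs = funs L, rels = insert None (Some ` rels L),
      fun_arity = fun_arity L, rel_arity = case_option 1 (rel_arity L)\<rparr>"

definition pair_struct :: "('f, 'r, 'a) struct \<Rightarrow> 'a set \<Rightarrow> ('f, 'r option, 'a) struct" where
  "pair_struct M E =
     \<lparr>universe = universe M, fun_of = fun_of M,
      rel_of = case_option (\<lambda>xs. set xs \<subseteq> E) (rel_of M)\<rparr>"

definition dense_pair ::
    "('f, 'r) lang \<Rightarrow> ('f, 'r) fm set \<Rightarrow> ('f, 'r) fm \<Rightarrow> nat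
      \<Rightarrow> ('f, 'r, 'a) struct \<Rightarrow> 'a set \<Rightarrow> bool" where
  "dense_pair L T \<theta> p M E \<longleftrightarrow>
     models L M T \<and> elementary_sub L M E \<and> E \<noteq> universe M \<and>
     def_top M \<theta> p closure_of E = universe M"

definition special ::
    "('f, 'r) lang \<Rightarrow> ('f, 'r, 'a) struct \<Rightarrow> 'a set \<Rightarrow> 'a set \<Rightarrow> bool" where
  "special L M E A \<longleftrightarrow> A \<subseteq> universe M \<and>
     (\<forall>as. set as \<subseteq> A \<longrightarrow> acl_dim L M as E = acl_dim L M as (E \<inter> A))"

definition tame_for_pairs ::
    "'u ulang \<Rightarrow> 'u ufm set \<Rightarrow> 'u ufm \<Rightarrow> nat \<Rightarrow> bool" where
  "tame_for_pairs L T \<theta> p \<longleftrightarrow>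
     (\<forall>(M :: 'u ustruct) E A.
        dense_pair L T \<theta> p M E \<and> A \<subseteq> universe M \<and>
        dcl (pair_lang L) (pair_struct M E) A = A \<longrightarrow> special L M E A)"

end

theory Submission
  imports Defs
begin

text \<open>The closure of X is the complement of the interior of the complement of X, so open sets suffice.
  Call a finite tuple good if each entry is a generator (an element of E, or an element not algebraic
  over E and the preceding entries) or algebraic over the preceding entries.  In a special set, every
  finite tuple can be extended to a good one.

  E is small: no nonempty open set is covered by finitely many families of algebraic formulas with
  parameters in E.  For otherwise, with t outside E and enough independent elements \<open>x\<^sub>i\<close> of E,
  the element \<open>\<Sum>x\<^sub>i t\<^sup>i\<close>, which determines the \<open>x\<^sub>i\<close>, would be algebraic over too few
  elements.  Hence generators of either kind, independent of all given elements, can be found in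
  every nonempty open set of a suitable extension, and a back-and-forth argument shows that the
  \<open>L\<close>-type of a good tuple determines its \<open>L\<^sup>P\<close>-type.

  Let U be open and \<open>L\<^sup>P\<close>-definable over a good tuple s.  Whether y lies in U depends only on the
  \<open>L\<close>-type of (s, y): by cell decomposition y is a continuous function of independent elements,
  which can be moved slightly, without leaving U, so as to become generators.  By compactness, U is
  \<open>L\<close>-definable over s.\<close>

section \<open>Formulas and definability\<close>

text \<open>Definable Skolem functions make algebraic and definable closure coincide: an algebraic
  element is the value of a formula with at most one solution in every structure. So types carry
  along the dependent entries of a tuple, and only generators have to be placed by hand. Two kinds
  of generators are needed because an element of \<open>E\<close> that is algebraic over a good
  tuple is already algebraic over its generators inside \<open>E\<close>; hence the
  \<open>L\<close>-type decides which terms take values in \<open>E\<close>. In a special set, a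
  basis of a finite tuple over \<open>E \<inter> A\<close> stays independent over \<open>E\<close>,
  which provides the second kind. Saturated models need not exist in the fixed type, so each step
  passes to a new pair: an ultrapower is cut down to a Skolem hull small enough to be copied into
  that type. The new pair keeps the type of a finite tuple but need not contain the old pair, so
  facts about the old pair are recovered through that type.\<close>

lemma finite_fv_tm [simp]: "finite (fv_tm t)"
  by (induction t) auto

lemma finite_fv [simp]: "finite (fv \<phi>)"
  by (induction \<phi>) auto

lemma val_cong: "(\<And>i. i \<in> fv_tm t \<Longrightarrow> v i = w i) \<Longrightarrow> val M v t = val M w t"
proof (induction t)
  case (Fn f ts)
  then have "map (val M v) ts = map (val M w) ts" by auto
  then show ?case by (metis val.simps(2))
qed auto

lemma sat_cong: "(\<And>i. i \<in> fv \<phi> \<Longrightarrow> v i = w i) \<Longrightarrow> sat M v \<phi> = sat M w \<phi>"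
proof (induction \<phi> arbitrary: v w)
  case (Equal s t)
  have "val M v s = val M w s" "val M v t = val M w t"
    using Equal by (auto intro!: val_cong)
  then show ?case by simp
next
  case (Rel r ts)
  then have "map (val M v) ts = map (val M w) ts" by (auto intro!: val_cong)
  then show ?case by (metis sat.simps(2))
next
  case (Exists i \<phi>)
  have "sat M (v(i := x)) \<phi> = sat M (w(i := x)) \<phi>" for x
    by (rule Exists.IH) (use Exists.prems in auto)
  then show ?case by simp
next
  case (Conj \<phi> \<psi>)
  have "sat M v \<phi> = sat M w \<phi>" "sat M v \<psi> = sat M w \<psi>"
    using Conj.prems by (auto intro!: Conj.IH)
  then show ?case by simp
next
  case (Neg \<phi>)
  have "sat M v \<phi> = sat M w \<phi>" using Neg.prems by (auto intro!: Neg.IH)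
  then show ?case by simp
qed

lemma val_closed:
  assumes "is_struct L M" "wf_tm L t" "\<And>i. i \<in> fv_tm t \<Longrightarrow> v i \<in> universe M"
  shows "val M v t \<in> universe M"
  using assms(2,3)
proof (induction t)
  case (Fn f ts)
  then have "set (map (val M v) ts) \<subseteq> universe M" by auto
  then show ?case using Fn.prems assms(1) by (auto simp: is_struct_def)
qed auto

section \<open>Substitution of variables for variables\<close>

fun rename_tm :: "(nat \<Rightarrow> nat) \<Rightarrow> 'f tm \<Rightarrow> 'f tm" where
  "rename_tm r (Var i) = Var (r i)"
| "rename_tm r (Fn f ts) = Fn f (map (rename_tm r) ts)"

definition fresh :: "nat set \<Rightarrow> nat" where
  "fresh V = Suc (Max (insert 0 V))"

lemma fresh: "finite V \<Longrightarrow> i \<in> V \<Longrightarrow> i \<noteq> fresh V"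
  unfolding fresh_def by (metis Max_ge finite_insert insertCI not_less_eq_eq order_refl)

text \<open>Bound variables are replaced by fresh ones, so that any map \<open>r\<close>, even one
  that identifies variables, acts on the free variables without capture.\<close>

fun rename :: "(nat \<Rightarrow> nat) \<Rightarrow> ('f, 'r) fm \<Rightarrow> ('f, 'r) fm" where
  "rename r (Equal s t) = Equal (rename_tm r s) (rename_tm r t)"
| "rename r (Rel p ts) = Rel p (map (rename_tm r) ts)"
| "rename r (Neg \<phi>) = Neg (rename r \<phi>)"
| "rename r (Conj \<phi> \<psi>) = Conj (rename r \<phi>) (rename r \<psi>)"
| "rename r (Exists i \<phi>) = (let j = fresh (r ` fv \<phi>) in Exists j (rename (r(i := j)) \<phi>))"

lemma wf_rename_tm [simp]: "wf_tm L (rename_tm r t) = wf_tm L t"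
  by (induction t) auto

lemma wf_rename [simp]: "wf_fm L (rename r \<phi>) = wf_fm L \<phi>"
  by (induction \<phi> arbitrary: r) (auto simp: Let_def)

lemma fv_rename_tm [simp]: "fv_tm (rename_tm r t) = r ` fv_tm t"
  by (induction t) auto

lemma fv_rename: "fv (rename r \<phi>) \<subseteq> r ` fv \<phi>"
proof (induction \<phi> arbitrary: r)
  case (Exists i \<phi>)
  have "fv (rename (r(i := fresh (r ` fv \<phi>))) \<phi>) \<subseteq> (r(i := fresh (r ` fv \<phi>))) ` fv \<phi>"
    by (rule Exists.IH)
  then show ?case by (fastforce simp: Let_def)
qed fastforce+

lemma val_rename [simp]: "val M v (rename_tm r t) = val M (\<lambda>i. v (r i)) t"
proof (induction t)
  case (Fn f ts)
  then have "map (val M v) (map (rename_tm r) ts) = map (val M (\<lambda>i. v (r i))) ts" by auto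
  then show ?case by (metis rename_tm.simps(2) val.simps(2))
qed auto

lemma sat_rename [simp]: "sat M v (rename r \<phi>) = sat M (\<lambda>i. v (r i)) \<phi>"
proof (induction \<phi> arbitrary: r v)
  case (Rel p ts)
  have "map (val M v) (map (rename_tm r) ts) = map (val M (\<lambda>i. v (r i))) ts" by simp
  then show ?case by (metis rename.simps(2) sat.simps(2))
next
  case (Exists i \<phi>)
  let ?j = "fresh (r ` fv \<phi>)"
  have "sat M (\<lambda>k. (v(?j := x)) ((r(i := ?j)) k)) \<phi> = sat M ((\<lambda>k. v (r k))(i := x)) \<phi>" for x
    by (rule sat_cong) (use fresh[of "r ` fv \<phi>"] in auto)
  then show ?case by (simp add: Let_def Exists.IH)
qed auto

text \<open>Predicates of a structure and an assignment that one formula expresses uniformly in all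
  structures. The closure lemmas below assemble such formulas implicitly: the semantics is written
  down directly, and the formula never has to be displayed.\<close>

definition expr :: "('f, 'r) lang \<Rightarrow> nat set \<Rightarrow> (('f, 'r, 'a) struct \<Rightarrow> (nat \<Rightarrow> 'a) \<Rightarrow> bool) \<Rightarrow> bool" where
  "expr L V Q \<longleftrightarrow> (\<exists>\<phi>. wf_fm L \<phi> \<and> fv \<phi> \<subseteq> V \<and> (\<forall>M v. sat M v \<phi> = Q M v))"

lemma expr_cong:
  assumes "expr L V Q" "\<And>i. i \<in> V \<Longrightarrow> v i = w i"
  shows "Q M v = Q M w"
proof -
  obtain \<phi> where \<phi>: "fv \<phi> \<subseteq> V" "\<And>M v. sat M v \<phi> = Q M v" using assms(1) by (auto simp: expr_def)
  have "sat M v \<phi> = sat M w \<phi>" by (rule sat_cong) (use \<phi>(1) assms(2) in auto)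
  then show ?thesis using \<phi>(2) by simp
qed

lemma expr_mono: "expr L V Q \<Longrightarrow> V \<subseteq> W \<Longrightarrow> expr L W Q"
  unfolding expr_def by blast

lemma expr_sat: "wf_fm L \<phi> \<Longrightarrow> fv \<phi> \<subseteq> V \<Longrightarrow> expr L V (\<lambda>M v. sat M v \<phi>)"
  unfolding expr_def by blast

lemma expr_rename:
  assumes "expr L V Q" "r ` V \<subseteq> W"
  shows "expr L W (\<lambda>M v. Q M (\<lambda>i. v (r i)))"
proof -
  obtain \<phi> where \<phi>: "wf_fm L \<phi>" "fv \<phi> \<subseteq> V" "\<And>M v. sat M v \<phi> = Q M v"
    using assms(1) by (auto simp: expr_def)
  have "fv (rename r \<phi>) \<subseteq> W"
    using fv_rename[of r \<phi>] \<phi>(2) assms(2) by blast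
  then show ?thesis
    unfolding expr_def using \<phi> by (intro exI[of _ "rename r \<phi>"]) simp
qed

lemma expr_rename_sat:
  "wf_fm L \<phi> \<Longrightarrow> r ` fv \<phi> \<subseteq> W \<Longrightarrow> expr L W (\<lambda>M v. sat M (\<lambda>i. v (r i)) \<phi>)"
  by (rule expr_rename[OF expr_sat]) auto

lemma expr_subst:
  assumes "expr L V Q" "\<And>i. i \<in> V \<Longrightarrow> r i \<in> W" "\<And>M v i. i \<in> V \<Longrightarrow> f M v i = v (r i)"
  shows "expr L W (\<lambda>M v. Q M (f M v))"
proof -
  have "Q M (f M v) = Q M (\<lambda>i. v (r i))" for M v
    by (rule expr_cong[OF assms(1)]) (use assms in auto)
  moreover have "expr L W (\<lambda>M v. Q M (\<lambda>i. v (r i)))"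
    using assms by (auto intro: expr_rename[OF assms(1)])
  ultimately show ?thesis by presburger
qed

lemma expr_neg: "expr L V Q \<Longrightarrow> expr L V (\<lambda>M v. \<not> Q M v)"
  unfolding expr_def
proof (elim exE conjE)
  fix \<phi> assume "wf_fm L \<phi>" "fv \<phi> \<subseteq> V" "\<forall>M v. sat M v \<phi> = Q M v"
  then show "\<exists>\<phi>. wf_fm L \<phi> \<and> fv \<phi> \<subseteq> V \<and> (\<forall>M v. sat M v \<phi> = (\<not> Q M v))"
    by (intro exI[of _ "Neg \<phi>"]) auto
qed

lemma expr_conj: "expr L V Q \<Longrightarrow> expr L V R \<Longrightarrow> expr L V (\<lambda>M v. Q M v \<and> R M v)"
  unfolding expr_def
proof (elim exE conjE)
  fix \<phi> \<psi> assume "wf_fm L \<phi>" "fv \<phi> \<subseteq> V" "\<forall>M v. sat M v \<phi> = Q M v"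
    "wf_fm L \<psi>" "fv \<psi> \<subseteq> V" "\<forall>M v. sat M v \<psi> = R M v"
  then show "\<exists>\<phi>. wf_fm L \<phi> \<and> fv \<phi> \<subseteq> V \<and> (\<forall>M v. sat M v \<phi> = (Q M v \<and> R M v))"
    by (intro exI[of _ "Conj \<phi> \<psi>"]) auto
qed

lemma expr_disj: "expr L V Q \<Longrightarrow> expr L V R \<Longrightarrow> expr L V (\<lambda>M v. Q M v \<or> R M v)"
  using expr_neg[OF expr_conj[OF expr_neg expr_neg], of L V Q R] by simp

lemma expr_imp: "expr L V Q \<Longrightarrow> expr L V R \<Longrightarrow> expr L V (\<lambda>M v. Q M v \<longrightarrow> R M v)"
  unfolding imp_conv_disj by (intro expr_disj expr_neg)

lemma expr_eq: "i \<in> V \<Longrightarrow> j \<in> V \<Longrightarrow> expr L V (\<lambda>M v. v i = v j)"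
  using expr_sat[of L "Equal (Var i) (Var j)" V] by simp

lemma expr_ex: "expr L V Q \<Longrightarrow> expr L (V - {i}) (\<lambda>M v. \<exists>x\<in>universe M. Q M (v(i := x)))"
  unfolding expr_def
proof (elim exE conjE)
  fix \<phi> assume "wf_fm L \<phi>" "fv \<phi> \<subseteq> V" "\<forall>M v. sat M v \<phi> = Q M v"
  then show "\<exists>\<phi>. wf_fm L \<phi> \<and> fv \<phi> \<subseteq> V - {i} \<and>
      (\<forall>M v. sat M v \<phi> = (\<exists>x\<in>universe M. Q M (v(i := x))))"
    by (intro exI[of _ "Exists i \<phi>"]) auto
qed

lemma expr_ex_last:
  "expr L {..<Suc n} Q \<Longrightarrow> expr L {..<n} (\<lambda>M v. \<exists>x\<in>universe M. Q M (v(n := x)))"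
  by (rule expr_mono[OF expr_ex]) auto

lemma expr_all_last:
  "expr L {..<Suc n} Q \<Longrightarrow> expr L {..<n} (\<lambda>M v. \<forall>x\<in>universe M. Q M (v(n := x)))"
  using expr_neg[OF expr_ex_last[OF expr_neg], of L n Q] by simp

lemma expr_True: "expr L V (\<lambda>M v. True)"
  unfolding expr_def
  \<comment> \<open>A formula without free variables is required, since \<open>V\<close> may be
    empty.\<close>
  by (rule exI[of _ "Neg (Exists 0 (Neg (Equal (Var 0) (Var 0))))"]) simp

lemma expr_ball:
  "finite I \<Longrightarrow> (\<And>i. i \<in> I \<Longrightarrow> expr L V (Q i)) \<Longrightarrow> expr L V (\<lambda>M v. \<forall>i\<in>I. Q i M v)"
proof (induction I rule: finite_induct)
  case empty
  then show ?case using expr_True by simp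
next
  case (insert i I)
  then have "expr L V (\<lambda>M v. Q i M v \<and> (\<forall>i\<in>I. Q i M v))" by (intro expr_conj) auto
  then show ?case by simp
qed

lemma expr_bex:
  assumes "finite I" "\<And>i. i \<in> I \<Longrightarrow> expr L V (Q i)"
  shows "expr L V (\<lambda>M v. \<exists>i\<in>I. Q i M v)"
proof -
  have "expr L V (\<lambda>M v. \<not> (\<forall>i\<in>I. \<not> Q i M v))"
    by (rule expr_neg, rule expr_ball[OF assms(1)]) (intro expr_neg assms(2))
  then show ?thesis by simp
qed

lemma ex_tuples_Suc:
  "(\<exists>b\<in>tuples S (Suc k). P b) \<longleftrightarrow> (\<exists>x\<in>S. \<exists>b\<in>tuples S k. P (b(k := x)))"
  (is "?l \<longleftrightarrow> ?r")
proof
  assume ?l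
  then obtain b where b: "b \<in> {..<Suc k} \<rightarrow>\<^sub>E S" "P b" by (auto simp: tuples_def)
  have "(restrict b {..<k})(k := b k) = b"
  proof
    fix i show "((restrict b {..<k})(k := b k)) i = b i"
      using PiE_arb[OF b(1), of i] by (cases "i < k"; cases "i = k") simp_all
  qed
  moreover have "restrict b {..<k} \<in> tuples S k" "b k \<in> S"
    using PiE_mem[OF b(1)] by (simp_all add: tuples_def)
  ultimately show ?r using b(2)
    by (intro bexI[of _ "b k"] bexI[of _ "restrict b {..<k}"]) simp_all
next
  assume ?r
  then obtain x b where "x \<in> S" "b \<in> {..<k} \<rightarrow>\<^sub>E S" "P (b(k := x))" by (auto simp: tuples_def)
  moreover from this have "b(k := x) \<in> {..<Suc k} \<rightarrow>\<^sub>E S"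
    by (auto simp: PiE_def extensional_def Pi_def)
  ultimately show ?l by (auto simp: tuples_def)
qed

lemma tuples_0 [simp]: "tuples S 0 = {\<lambda>_. undefined}"
  by (simp add: tuples_def)

text \<open>Lets a formula quantify over a whole tuple of witnesses, such as the parameters of a
  basic open set, stored in the \<open>k\<close> variables from \<open>n\<close> on.\<close>

lemma expr_ex_block:
  assumes "expr L {..<n + k} Q"
  shows "expr L {..<n} (\<lambda>M v. \<exists>b\<in>tuples (universe M) k. Q M (append_tuple n v b))"
  using assms
proof (induction k arbitrary: Q)
  case 0
  have "Q M (append_tuple n v (\<lambda>_. undefined)) = Q M v" for M v
    by (rule expr_cong[OF 0]) (auto simp: append_tuple_def)
  then show ?case using 0 by simp
next
  case (Suc k)
  have "expr L {..<n} (\<lambda>M v. \<exists>b\<in>tuples (universe M) k.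
      \<exists>x\<in>universe M. Q M ((append_tuple n v b)(n + k := x)))"
    using Suc.prems by (intro Suc.IH expr_ex_last) simp
  moreover have "Q M ((append_tuple n v b)(n + k := x)) = Q M (append_tuple n v (b(k := x)))"
    for M v b x
    by (rule expr_cong[OF Suc.prems]) (auto simp: append_tuple_def)
  ultimately have 1: "expr L {..<n} (\<lambda>M v. \<exists>b\<in>tuples (universe M) k.
      \<exists>x\<in>universe M. Q M (append_tuple n v (b(k := x))))"
    by (simp only:)
  have "(\<exists>b\<in>tuples (universe M) k. \<exists>x\<in>universe M. Q M (append_tuple n v (b(k := x)))) \<longleftrightarrow>
      (\<exists>x\<in>universe M. \<exists>b\<in>tuples (universe M) k. Q M (append_tuple n v (b(k := x))))" for M v
    by blast
  with 1 show ?case unfolding ex_tuples_Suc by (simp only:)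
qed

lemma expr_all_block:
  assumes "expr L {..<n + k} Q"
  shows "expr L {..<n} (\<lambda>M v. \<forall>b\<in>tuples (universe M) k. Q M (append_tuple n v b))"
  using expr_neg[OF expr_ex_block[OF expr_neg[OF assms]]] by simp

text \<open>Equality of complete types of the first \<open>m\<close> entries. Sentences are
  included, so the two structures are elementarily equivalent even for \<open>m = 0\<close>.\<close>

definition eqtp :: "('f, 'r) lang \<Rightarrow> ('f, 'r, 'a) struct \<Rightarrow> (nat \<Rightarrow> 'a)
    \<Rightarrow> ('f, 'r, 'a) struct \<Rightarrow> (nat \<Rightarrow> 'a) \<Rightarrow> nat \<Rightarrow> bool" where
  "eqtp L M s N t m \<longleftrightarrow> (\<forall>\<phi>. wf_fm L \<phi> \<and> fv \<phi> \<subseteq> {..<m} \<longrightarrow> sat M s \<phi> = sat N t \<phi>)"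

lemma eqtp_expr: "eqtp L M s N t m \<Longrightarrow> expr L {..<m} Q \<Longrightarrow> Q M s = Q N t"
  unfolding eqtp_def expr_def by metis

text \<open>Complete types are closed under negation, so an inclusion between them is an
  equality.\<close>

lemma eqtpI:
  assumes "\<And>Q. expr L {..<m} Q \<Longrightarrow> Q M s \<Longrightarrow> Q N t"
  shows "eqtp L M s N t m"
  unfolding eqtp_def
proof (intro allI impI)
  fix \<phi> assume "wf_fm L \<phi> \<and> fv \<phi> \<subseteq> {..<m}"
  then have e: "expr L {..<m} (\<lambda>M v. sat M v \<phi>)" by (intro expr_sat) auto
  show "sat M s \<phi> = sat N t \<phi>"
    using assms[OF e] assms[OF expr_neg[OF e]] by blast
qed

lemma eqtp_sym: "eqtp L M s N t m \<Longrightarrow> eqtp L N t M s m"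
  by (auto simp: eqtp_def)

lemma eqtp_trans: "eqtp L M s N t m \<Longrightarrow> eqtp L N t K u m \<Longrightarrow> eqtp L M s K u m"
  by (auto simp: eqtp_def)

lemma eqtp_mono: "eqtp L M s N t m \<Longrightarrow> n \<le> m \<Longrightarrow> eqtp L M s N t n"
  by (force simp: eqtp_def)

lemma eqtp_cong:
  "eqtp L M s N t m \<Longrightarrow> (\<And>i. i < m \<Longrightarrow> s' i = s i) \<Longrightarrow> (\<And>i. i < m \<Longrightarrow> t' i = t i) \<Longrightarrow>
    eqtp L M s' N t' m"
  unfolding eqtp_def using sat_cong[of _ s' s] sat_cong[of _ t' t] by (metis lessThan_iff subsetD)

lemma eqtp_rename:
  assumes "eqtp L M s N t m" "\<And>i. i < n \<Longrightarrow> r i < m" "\<And>i. i < n \<Longrightarrow> s' i = s (r i)"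
    "\<And>i. i < n \<Longrightarrow> t' i = t (r i)"
  shows "eqtp L M s' N t' n"
proof (rule eqtpI)
  fix Q assume Q: "expr L {..<n} Q" "Q M s'"
  have "expr L {..<m} (\<lambda>M v. Q M (\<lambda>i. v (r i)))" using assms(2) by (auto intro: expr_rename[OF Q(1)])
  from eqtp_expr[OF assms(1) this] have "Q M (\<lambda>i. s (r i)) = Q N (\<lambda>i. t (r i))" .
  moreover have "Q M s' = Q M (\<lambda>i. s (r i))" "Q N t' = Q N (\<lambda>i. t (r i))"
    using assms by (auto intro!: expr_cong[OF Q(1)])
  ultimately show "Q N t'" using Q(2) by simp
qed

section \<open>Compactness without leaving the type of the universe\<close>

text \<open>Ultrafilters are the minimal proper filters, so Zorn's lemma is applied to the reversed
  order. The infimum of a nonempty chain is proper, because what holds eventually for it holds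
  eventually for a member of the chain.\<close>

lemma ultrafilter_exists:
  fixes F :: "'i filter"
  assumes "F \<noteq> bot"
  obtains G where "G \<le> F" "G \<noteq> bot" "\<And>P. eventually P G \<or> eventually (\<lambda>x. \<not> P x) G"
proof -
  let ?A = "{G. G \<le> F \<and> G \<noteq> bot}" and ?P = "\<lambda>G H :: 'i filter. H \<le> G"
  have "\<exists>m\<in>?A. \<forall>a\<in>?A. a \<le> m \<longrightarrow> a = m"
  proof (rule predicate_Zorn)
    show "partial_order_on ?A (relation_of ?P ?A)"
      by (rule partial_order_on_relation_ofI) auto
    fix C assume C: "C \<in> Chains (relation_of ?P ?A)"
    show "\<exists>u\<in>?A. \<forall>a\<in>C. u \<le> a"
    proof (cases "C = {}")
      case True
      then show ?thesis using assms by auto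
    next
      case False
      have sub: "C \<subseteq> ?A" using C by (auto simp: Chains_def relation_of_def)
      have "\<exists>x\<in>C. x \<le> inf G H" if "G \<in> C" "H \<in> C" for G H
        using C that by (auto simp: Chains_def relation_of_def)
      then have "eventually P (Inf C) \<longleftrightarrow> (\<exists>b\<in>C. eventually P b)" for P
        using False by (intro eventually_Inf_base) auto
      then have "Inf C \<noteq> bot" using sub by (auto simp: trivial_limit_def)
      moreover have "Inf C \<le> F" using sub False by (auto intro: Inf_lower2)
      ultimately show ?thesis by (auto intro: Inf_lower)
    qed
  qed
  then obtain G where G: "G \<le> F" "G \<noteq> bot" "\<And>H. H \<le> G \<Longrightarrow> H \<noteq> bot \<Longrightarrow> H = G"
    by (auto intro: order_trans)
  have "eventually P G" if "\<not> eventually (\<lambda>x. \<not> P x) G" for P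
  proof -
    \<comment> \<open>If \<open>G\<close> does not force the negation of \<open>P\<close>, then
      adding \<open>P\<close> keeps the filter proper, and by minimality nothing was added.\<close>
    have "inf G (principal {x. P x}) \<noteq> bot"
      using that by (simp add: trivial_limit_def eventually_inf_principal)
    then have eq: "inf G (principal {x. P x}) = G" by (intro G) auto
    have "eventually P (inf G (principal {x. P x}))" by (simp add: eventually_inf_principal)
    then show ?thesis by (simp only: eq)
  qed
  then show thesis using that G by blast
qed

text \<open>The classes of the ultrapower are represented by chosen elements, so that its universe
  consists of functions.\<close>

definition ultra_rep :: "'i filter \<Rightarrow> 'a set \<Rightarrow> ('i \<Rightarrow> 'a) \<Rightarrow> 'i \<Rightarrow> 'a" where
  "ultra_rep F S f = (SOME g. range g \<subseteq> S \<and> (\<forall>\<^sub>F i in F. f i = g i))"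

definition ultrapower :: "'i filter \<Rightarrow> ('f, 'r, 'a) struct \<Rightarrow> ('f, 'r, 'i \<Rightarrow> 'a) struct" where
  "ultrapower F M =
     \<lparr>universe = ultra_rep F (universe M) ` {f. range f \<subseteq> universe M},
      fun_of = (\<lambda>h fs. ultra_rep F (universe M) (\<lambda>i. fun_of M h (map (\<lambda>f. f i) fs))),
      rel_of = (\<lambda>r fs. \<forall>\<^sub>F i in F. rel_of M r (map (\<lambda>f. f i) fs))\<rparr>"

section \<open>Ultrapowers and the theorem of Los\<close>

lemma ultra_rep:
  assumes "range f \<subseteq> S"
  shows "range (ultra_rep F S f) \<subseteq> S" "\<forall>\<^sub>F i in F. f i = ultra_rep F S f i"
  unfolding atomize_conj ultra_rep_def by (rule someI[of _ f]) (use assms in auto)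

text \<open>The description from which the representative is chosen depends only on the class, so
  equivalent functions receive literally the same one.\<close>

lemma ultra_rep_cong:
  assumes "\<forall>\<^sub>F i in F. f i = g i"
  shows "ultra_rep F S f = ultra_rep F S g"
proof -
  have "(\<forall>\<^sub>F i in F. f i = h i) \<longleftrightarrow> (\<forall>\<^sub>F i in F. g i = h i)" for h
    using assms by (auto elim: eventually_elim2)
  then show ?thesis by (simp add: ultra_rep_def)
qed

lemma ultrapower_range:
  assumes "x \<in> universe (ultrapower F M)"
  shows "x i \<in> universe M"
proof -
  obtain f where "range f \<subseteq> universe M" "x = ultra_rep F (universe M) f"
    using assms by (auto simp: ultrapower_def)
  then show ?thesis using ultra_rep(1)[of f "universe M" F] by (simp add: image_subset_iff)
qed

lemma ultrapower_eq:
  assumes "x \<in> universe (ultrapower F M)" "y \<in> universe (ultrapower F M)"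
    and "\<forall>\<^sub>F i in F. x i = y i"
  shows "x = y"
proof -
  obtain f g where f: "range f \<subseteq> universe M" "x = ultra_rep F (universe M) f"
    and g: "range g \<subseteq> universe M" "y = ultra_rep F (universe M) g"
    using assms(1,2) by (auto simp: ultrapower_def)
  have "\<forall>\<^sub>F i in F. f i = g i"
    using ultra_rep(2)[OF f(1), of F] ultra_rep(2)[OF g(1), of F] assms(3)
    unfolding f(2) g(2) by eventually_elim simp
  then show ?thesis unfolding f(2) g(2) by (rule ultra_rep_cong)
qed

lemma val_ultrapower:
  assumes "is_struct L M" "\<And>n. v n \<in> universe (ultrapower F M)" "wf_tm L t"
  shows "val (ultrapower F M) v t \<in> universe (ultrapower F M) \<and>
    (\<forall>\<^sub>F i in F. val (ultrapower F M) v t i = val M (\<lambda>n. v n i) t)"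
  using assms(3)
proof (induction t)
  case (Var n)
  then show ?case using assms(2) by simp
next
  case (Fn f ts)
  let ?U = "ultrapower F M"
  let ?h = "\<lambda>i. fun_of M f (map (\<lambda>g. g i) (map (val ?U v) ts))"
  have val: "val ?U v (Fn f ts) = ultra_rep F (universe M) ?h" by (simp add: ultrapower_def)
  have IH: "val ?U v t \<in> universe ?U" "\<forall>\<^sub>F i in F. val ?U v t i = val M (\<lambda>n. v n i) t"
    if "t \<in> set ts" for t
    using Fn that by auto
  have h: "range ?h \<subseteq> universe M"
  proof (intro subsetI, elim rangeE)
    fix x i assume "x = ?h i"
    moreover have "set (map (\<lambda>g. g i) (map (val ?U v) ts)) \<subseteq> universe M"
      using IH(1) ultrapower_range by fastforce
    ultimately show "x \<in> universe M"
      using assms(1) Fn.prems by (simp add: is_struct_def)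
  qed
  have "\<forall>\<^sub>F i in F. \<forall>t\<in>set ts. val ?U v t i = val M (\<lambda>n. v n i) t"
    using IH(2) by (intro eventually_ball_finite) auto
  then have "\<forall>\<^sub>F i in F. val ?U v (Fn f ts) i = val M (\<lambda>n. v n i) (Fn f ts)"
    using ultra_rep(2)[OF h, of F]
  proof eventually_elim
    case (elim i)
    have "val ?U v (Fn f ts) i = ?h i" using elim(2) val by simp
    also have "map (\<lambda>g. g i) (map (val ?U v) ts) = map (val M (\<lambda>n. v n i)) ts" using elim(1) by simp
    finally show ?case by simp
  qed
  moreover have "val ?U v (Fn f ts) \<in> universe ?U"
    unfolding val using h by (auto simp: ultrapower_def)
  ultimately show ?case by blast
qed

lemma ultrapower_struct:
  assumes "is_struct L M"
  shows "is_struct L (ultrapower F M)"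
  unfolding is_struct_def
proof (intro conjI ballI allI impI)
  obtain d where "d \<in> universe M" using assms by (auto simp: is_struct_def)
  then have "ultra_rep F (universe M) (\<lambda>_. d) \<in> universe (ultrapower F M)"
    by (auto simp: ultrapower_def)
  then show "universe (ultrapower F M) \<noteq> {}" by blast
next
  fix f xs assume f: "f \<in> funs L"
    and xs: "length xs = fun_arity L f \<and> set xs \<subseteq> universe (ultrapower F M)"
  have "fun_of M f (map (\<lambda>g. g i) xs) \<in> universe M" for i
  proof -
    have "set (map (\<lambda>g. g i) xs) \<subseteq> universe M" using xs by (auto intro: ultrapower_range)
    then show ?thesis using f xs assms by (simp add: is_struct_def)
  qed
  then show "fun_of (ultrapower F M) f xs \<in> universe (ultrapower F M)"
    by (auto simp: ultrapower_def)
qed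

lemma los:
  assumes ultra: "F \<noteq> bot" "\<And>P. eventually P F \<or> eventually (\<lambda>x. \<not> P x) F"
    and M: "is_struct L M" and "\<And>n. v n \<in> universe (ultrapower F M)" "wf_fm L \<phi>"
  shows "sat (ultrapower F M) v \<phi> \<longleftrightarrow> (\<forall>\<^sub>F i in F. sat M (\<lambda>n. v n i) \<phi>)"
  using assms(4,5)
proof (induction \<phi> arbitrary: v)
  case (Equal s t)
  let ?U = "ultrapower F M"
  have s: "val ?U v s \<in> universe ?U" "\<forall>\<^sub>F i in F. val ?U v s i = val M (\<lambda>n. v n i) s"
    and t: "val ?U v t \<in> universe ?U" "\<forall>\<^sub>F i in F. val ?U v t i = val M (\<lambda>n. v n i) t"
    using val_ultrapower[OF M, of v F] Equal.prems by auto
  show ?case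
  proof
    assume "sat ?U v (Equal s t)"
    then have "val ?U v s = val ?U v t" by simp
    with s(2) t(2) show "\<forall>\<^sub>F i in F. sat M (\<lambda>n. v n i) (Equal s t)"
      by (auto elim: eventually_elim2)
  next
    assume "\<forall>\<^sub>F i in F. sat M (\<lambda>n. v n i) (Equal s t)"
    with s(2) t(2) have "\<forall>\<^sub>F i in F. val ?U v s i = val ?U v t i"
      by eventually_elim simp
    then show "sat ?U v (Equal s t)" using ultrapower_eq[OF s(1) t(1)] by simp
  qed
next
  case (Rel r ts)
  let ?U = "ultrapower F M"
  have "\<forall>\<^sub>F i in F. \<forall>t\<in>set ts. val ?U v t i = val M (\<lambda>n. v n i) t"
    using val_ultrapower[OF M, of v F] Rel.prems by (intro eventually_ball_finite) auto
  then have "\<forall>\<^sub>F i in F. map (\<lambda>f. f i) (map (val ?U v) ts) = map (val M (\<lambda>n. v n i)) ts"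
    by eventually_elim simp
  then have "(\<forall>\<^sub>F i in F. rel_of M r (map (\<lambda>f. f i) (map (val ?U v) ts))) \<longleftrightarrow>
      (\<forall>\<^sub>F i in F. rel_of M r (map (val M (\<lambda>n. v n i)) ts))"
    by (intro eventually_subst) (auto elim!: eventually_mono simp del: map_map)
  then show ?case by (simp add: ultrapower_def)
next
  case (Neg \<phi>)
  \<comment> \<open>Properness excludes that both a formula and its negation hold eventually; that
    one of them does is the ultrafilter property.\<close>
  have "\<not> (eventually P F \<and> eventually (\<lambda>x. \<not> P x) F)" for P
    using ultra(1) eventually_conj[of P F "\<lambda>x. \<not> P x"] by (auto simp: trivial_limit_def)
  then show ?case using Neg ultra(2)[of "\<lambda>i. sat M (\<lambda>n. v n i) \<phi>"] by auto
next
  case (Conj \<phi> \<psi>)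
  then show ?case by (simp add: eventually_conj_iff)
next
  case (Exists k \<phi>)
  let ?U = "ultrapower F M"
  have upd: "(\<lambda>n. (v(k := x)) n i) = (\<lambda>n. v n i)(k := x i)" for x i by auto
  have IH: "sat ?U (v(k := x)) \<phi> \<longleftrightarrow> (\<forall>\<^sub>F i in F. sat M ((\<lambda>n. v n i)(k := x i)) \<phi>)"
    if "x \<in> universe ?U" for x
    unfolding upd[symmetric] by (rule Exists.IH) (use Exists.prems that in auto)
  show ?case
  proof
    assume "sat ?U v (Exists k \<phi>)"
    then obtain x where x: "x \<in> universe ?U" "sat ?U (v(k := x)) \<phi>" by auto
    then have "\<forall>\<^sub>F i in F. sat M ((\<lambda>n. v n i)(k := x i)) \<phi>" using IH by simp
    then show "\<forall>\<^sub>F i in F. sat M (\<lambda>n. v n i) (Exists k \<phi>)"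
      by eventually_elim (use ultrapower_range[OF x(1)] in auto)
  next
    assume ev: "\<forall>\<^sub>F i in F. sat M (\<lambda>n. v n i) (Exists k \<phi>)"
    obtain d where d: "d \<in> universe M" using M by (auto simp: is_struct_def)
    \<comment> \<open>A witness is picked at every index that has one; the default \<open>d\<close>
      elsewhere keeps \<open>f\<close> inside the universe.\<close>
    define f where "f i = (if sat M (\<lambda>n. v n i) (Exists k \<phi>)
      then SOME x. x \<in> universe M \<and> sat M ((\<lambda>n. v n i)(k := x)) \<phi> else d)" for i
    have f: "f i \<in> universe M \<and> sat M ((\<lambda>n. v n i)(k := f i)) \<phi>"
      if "sat M (\<lambda>n. v n i) (Exists k \<phi>)" for i
      unfolding f_def if_P[OF that] by (rule someI_ex) (use that in auto)
    have rf: "range f \<subseteq> universe M" using f d by (auto simp: f_def)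
    let ?x = "ultra_rep F (universe M) f"
    have x: "?x \<in> universe ?U" using rf by (auto simp: ultrapower_def)
    have "\<forall>\<^sub>F i in F. sat M ((\<lambda>n. v n i)(k := ?x i)) \<phi>"
      using ev ultra_rep(2)[OF rf, of F] by eventually_elim (metis f)
    then have "sat ?U (v(k := ?x)) \<phi>" using IH x by simp
    then show "sat ?U v (Exists k \<phi>)" using x by auto
  qed
qed

section \<open>Elementary substructures and copies of structures\<close>

lemma range_upd: "range v \<subseteq> S \<Longrightarrow> x \<in> S \<Longrightarrow> range (v(i := x)) \<subseteq> S"
  by auto

lemma val_universe_update [simp]: "val (M\<lparr>universe := H\<rparr>) v t = val M v t"
  by (induction t) (auto cong: map_cong)

lemma tarski_vaught:
  fixes M :: "('f, 'r, 'a) struct"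
  assumes M: "is_struct L M" and H: "H \<subseteq> universe M" "H \<noteq> {}"
    and step: "\<And>\<phi> i v. wf_fm L \<phi> \<Longrightarrow> range v \<subseteq> H \<Longrightarrow> \<exists>x\<in>universe M. sat M (v(i := x)) \<phi> \<Longrightarrow>
      \<exists>x\<in>H. sat M (v(i := x)) \<phi>"
  shows "elementary_sub L M H"
  unfolding elementary_sub_def
proof (intro conjI allI impI)
  show "is_struct L (M\<lparr>universe := H\<rparr>)"
    unfolding is_struct_def
  proof (intro conjI ballI allI impI)
    fix f xs assume f: "f \<in> funs L"
      and xs: "length xs = fun_arity L f \<and> set xs \<subseteq> universe (M\<lparr>universe := H\<rparr>)"
    obtain d where d: "d \<in> H" using H by auto
    \<comment> \<open>Closure under \<open>f\<close> is the criterion applied to the formula stating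
      that variable 0 is the value of \<open>f\<close> at the variables from 1 on; hence the shift
      by one.\<close>
    define v where "v k = (if k = 0 \<or> k > length xs then d else xs ! (k - 1))" for k
    let ?\<phi> = "Equal (Var 0) (Fn f (map Var [1..<Suc (length xs)]))"
    have v: "range v \<subseteq> H" using xs d by (force simp: v_def)
    have args: "map (val M (v(0 := x))) (map Var [1..<Suc (length xs)]) = xs" for x
      by (rule nth_equalityI) (auto simp: v_def simp del: upt_Suc)
    have "fun_of M f xs \<in> universe M" using f xs H M by (auto simp: is_struct_def)
    moreover have eq: "sat M (v(0 := x)) ?\<phi> \<longleftrightarrow> x = fun_of M f xs" for x
      using args by simp
    ultimately have "\<exists>x\<in>universe M. sat M (v(0 := x)) ?\<phi>" by blast
    moreover have "wf_fm L ?\<phi>" using f xs by auto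
    ultimately have "\<exists>x\<in>H. sat M (v(0 := x)) ?\<phi>" using step v by blast
    then show "fun_of (M\<lparr>universe := H\<rparr>) f xs \<in> universe (M\<lparr>universe := H\<rparr>)"
      unfolding eq by auto
  qed (use H in auto)
  fix \<phi> and v :: "nat \<Rightarrow> 'a" assume "wf_fm L \<phi> \<and> range v \<subseteq> H"
  then show "sat (M\<lparr>universe := H\<rparr>) v \<phi> = sat M v \<phi>"
  proof (induction \<phi> arbitrary: v)
    case (Exists i \<phi>)
    have "sat (M\<lparr>universe := H\<rparr>) (v(i := x)) \<phi> = sat M (v(i := x)) \<phi>" if "x \<in> H" for x
      by (rule Exists.IH) (use Exists.prems that range_upd in auto)
    moreover have "\<exists>x\<in>universe M. sat M (v(i := x)) \<phi> \<Longrightarrow> \<exists>x\<in>H. sat M (v(i := x)) \<phi>"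
      using step[of \<phi> v i] Exists.prems by simp
    ultimately show ?case using H by auto
  qed (auto cong: map_cong)
qed (use H in auto)

text \<open>An isomorphic copy of \<open>M\<close> whenever \<open>h\<close> is injective on the
  universe. Arguments are pulled back by \<open>inv_into\<close>, which is meaningful on the image
  of the universe only.\<close>

definition transport :: "('a \<Rightarrow> 'b) \<Rightarrow> ('f, 'r, 'a) struct \<Rightarrow> ('f, 'r, 'b) struct" where
  "transport h M =
     (let g = inv_into (universe M) h in
      \<lparr>universe = h ` universe M, fun_of = (\<lambda>f xs. h (fun_of M f (map g xs))),
       rel_of = (\<lambda>r xs. rel_of M r (map g xs))\<rparr>)"

lemma transport_simps:
  "universe (transport h M) = h ` universe M"
  "fun_of (transport h M) f xs = h (fun_of M f (map (inv_into (universe M) h) xs))"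
  "rel_of (transport h M) r xs = rel_of M r (map (inv_into (universe M) h) xs)"
  by (simp_all add: transport_def Let_def)

lemma val_transport:
  assumes "inj_on h (universe M)" "is_struct L M" "range v \<subseteq> universe M" "wf_tm L t"
  shows "val (transport h M) (\<lambda>i. h (v i)) t = h (val M v t)"
  using assms(4)
proof (induction t)
  case (Fn f ts)
  have "inv_into (universe M) h (h (val M v t)) = val M v t" if "t \<in> set ts" for t
    using val_closed[OF assms(2), of t v] assms that Fn.prems by (auto intro!: inv_into_f_f)
  then have "map (inv_into (universe M) h) (map (val (transport h M) (\<lambda>i. h (v i))) ts) =
      map (val M v) ts"
    using Fn by auto
  then show ?case by (simp add: transport_simps del: map_map)
qed auto

lemma sat_transport:
  assumes "inj_on h (universe M)" "is_struct L M" "range v \<subseteq> universe M" "wf_fm L \<phi>"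
  shows "sat (transport h M) (\<lambda>i. h (v i)) \<phi> = sat M v \<phi>"
  using assms(3,4)
proof (induction \<phi> arbitrary: v)
  case (Equal s t)
  have "val M v s \<in> universe M" "val M v t \<in> universe M"
    using Equal.prems by (auto intro!: val_closed[OF assms(2)] dest: subsetD)
  then show ?case
    using Equal.prems assms(1) by (simp add: val_transport[OF assms(1,2)] inj_on_eq_iff)
next
  case (Rel r ts)
  have "inv_into (universe M) h (h (val M v t)) = val M v t" if "t \<in> set ts" for t
    using val_closed[OF assms(2), of t v] assms(1) that Rel.prems by (auto intro!: inv_into_f_f)
  then have "map (inv_into (universe M) h) (map (val (transport h M) (\<lambda>i. h (v i))) ts) =
      map (val M v) ts"
    using Rel by (auto simp: val_transport[OF assms(1,2)])
  then show ?case by (simp add: transport_simps del: map_map)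
next
  case (Exists i \<phi>)
  have "sat (transport h M) ((\<lambda>k. h (v k))(i := h x)) \<phi> = sat M (v(i := x)) \<phi>"
    if "x \<in> universe M" for x
  proof -
    have eq: "(\<lambda>k. h (v k))(i := h x) = (\<lambda>k. h ((v(i := x)) k))" by auto
    show ?thesis unfolding eq
      by (rule Exists.IH) (use Exists.prems that range_upd in auto)
  qed
  then show ?case by (simp add: transport_simps del: map_map)
qed auto

lemma transport_struct: "is_struct L M \<Longrightarrow> is_struct L (transport h M)"
  unfolding is_struct_def transport_def Let_def
proof (simp, elim conjE, intro ballI allI impI imageI, elim conjE)
  fix f xs
  assume M: "\<forall>f\<in>funs L. \<forall>xs. length xs = fun_arity L f \<and> set xs \<subseteq> universe M \<longrightarrow>
      fun_of M f xs \<in> universe M"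
    and "f \<in> funs L" "length xs = fun_arity L f" "set xs \<subseteq> h ` universe M"
  moreover from this have "set (map (inv_into (universe M) h) xs) \<subseteq> universe M"
    by (auto intro: inv_into_into)
  ultimately show "fun_of M f (map (inv_into (universe M) h) xs) \<in> universe M" by auto
qed

section \<open>Injections of terms and formulas into an infinite type\<close>

instance tm :: (countable) countable by countable_datatype
instance fm :: (countable, countable) countable by countable_datatype

text \<open>An infinite set is in bijection with its square, and iterating the pairing function
  codes the lists of any fixed length.\<close>

lemma inj_list_code:
  assumes "infinite (UNIV :: 'a set)" "\<exists>c :: 'x \<Rightarrow> 'a. inj c"
  shows "\<exists>c :: 'x list \<Rightarrow> 'a. inj c"
proof -
  have "(card_of (UNIV :: ('a \<times> 'a) set), card_of (UNIV :: 'a set)) \<in> ordIso"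
    using card_of_Times_same_infinite[OF assms(1)] by simp
  then obtain p :: "'a \<times> 'a \<Rightarrow> 'a" where "bij p"
    unfolding card_of_ordIso[symmetric] by blast
  then have p: "inj p" by (rule bij_is_inj)
  obtain n :: "nat \<Rightarrow> 'a" where n: "inj n"
    using infinite_countable_subset[OF assms(1)] by auto
  obtain c :: "'x \<Rightarrow> 'a" where c: "inj c" using assms(2) by auto
  define e where "e = rec_list (n 0) (\<lambda>x _ r. p (c x, r))"
  have e: "xs = ys" if "length xs = length ys" "e xs = e ys" for xs ys
    using that by (induction xs ys rule: list_induct2) (auto simp: e_def inj_eq[OF p] inj_eq[OF c])
  \<comment> \<open>The length is recorded separately, because \<open>e\<close> alone may give a
    nonempty list the code \<open>n 0\<close> of the empty one.\<close>
  have "inj (\<lambda>xs. p (n (length xs), e xs))"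
    by (rule injI) (auto simp: inj_eq[OF p] inj_eq[OF n] intro: e)
  then show ?thesis by blast
qed

lemma inj_countable_code:
  assumes "infinite (UNIV :: 'a set)"
  shows "\<exists>c :: 'x :: countable \<Rightarrow> 'a. inj c"
proof -
  obtain n :: "nat \<Rightarrow> 'a" where "inj n"
    using infinite_countable_subset[OF assms] by auto
  then have "inj (n \<circ> (to_nat :: 'x \<Rightarrow> nat))" by (simp add: inj_compose)
  then show ?thesis by blast
qed

lemma inj_pair_code:
  assumes "infinite (UNIV :: 'a set)" "\<exists>c :: 'x \<Rightarrow> 'a. inj c" "\<exists>c :: 'y \<Rightarrow> 'a. inj c"
  shows "\<exists>c :: 'x \<times> 'y \<Rightarrow> 'a. inj c"
proof -
  obtain l :: "'a list \<Rightarrow> 'a" where l: "inj l" using inj_list_code[OF assms(1)] by (metis inj_on_id)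
  obtain c :: "'x \<Rightarrow> 'a" and d :: "'y \<Rightarrow> 'a" where "inj c" "inj d" using assms by auto
  then have "inj (\<lambda>(x, y). l [c x, d y])"
    by (auto intro!: injI simp: inj_eq[OF l] dest: injD)
  then show ?thesis by blast
qed

lemma finite_set_tm: "finite (set_tm t)"
  by (induction t) auto

lemma finite_set1_fm: "finite (set1_fm \<phi>)" and finite_set2_fm: "finite (set2_fm \<phi>)"
  by (induction \<phi>) (auto simp: finite_set_tm)

lemma list_index:
  assumes "finite A"
  obtains xs k where "\<And>x. x \<in> A \<Longrightarrow> xs ! k x = x"
proof -
  obtain xs where "set xs = A" using finite_list[OF assms] by auto
  then have "\<forall>x\<in>A. \<exists>k. xs ! k = x" by (auto simp: in_set_conv_nth)
  then show thesis using that by metis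
qed

text \<open>A term is determined by its shape, in which the symbols are replaced by positions in a list,
  and that list; there are only countably many shapes.\<close>

lemma inj_tm_code:
  assumes "infinite (UNIV :: 'a set)" "\<exists>c :: 'x \<Rightarrow> 'a. inj c"
  shows "\<exists>c :: 'x tm \<Rightarrow> 'a. inj c"
proof -
  let ?g = "\<lambda>p :: nat tm \<times> 'x list. map_tm ((!) (snd p)) (fst p)"
  have "\<exists>p. ?g p = t" for t
  proof -
    obtain xs k where k: "\<And>x. x \<in> set_tm t \<Longrightarrow> (xs ! k x :: 'x) = x"
      using list_index[OF finite_set_tm[of t]] by blast
    have "map_tm ((!) xs) (map_tm k t) = map_tm id t"
      unfolding tm.map_comp by (rule tm.map_cong) (use k in auto)
    then show ?thesis by (intro exI[of _ "(map_tm k t, xs)"]) (simp add: tm.map_id)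
  qed
  then have "\<forall>t. \<exists>p. ?g p = t" by blast
  from choice[OF this] obtain f where f: "\<And>t. ?g (f t) = t" by blast
  then have i: "inj f" by (rule inj_on_inverseI)
  obtain c :: "nat tm \<times> 'x list \<Rightarrow> 'a" where c: "inj c"
    using inj_pair_code[OF assms(1) inj_countable_code[OF assms(1)] inj_list_code[OF assms]] by auto
  show ?thesis using inj_compose[OF c i] by blast
qed

text \<open>As for terms, except that a shape now refers to two lists, one of function symbols and
  one of relation symbols.\<close>

lemma inj_fm_code:
  assumes "infinite (UNIV :: 'a set)" "\<exists>c :: 'x \<Rightarrow> 'a. inj c" "\<exists>c :: 'y \<Rightarrow> 'a. inj c"
  shows "\<exists>c :: ('x, 'y) fm \<Rightarrow> 'a. inj c"
proof -
  let ?g = "\<lambda>p :: (nat, nat) fm \<times> 'x list \<times> 'y list.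
    map_fm ((!) (fst (snd p))) ((!) (snd (snd p))) (fst p)"
  have "\<exists>p. ?g p = \<phi>" for \<phi>
  proof -
    obtain xs k where k: "\<And>x. x \<in> set1_fm \<phi> \<Longrightarrow> (xs ! k x :: 'x) = x"
      using list_index[OF finite_set1_fm[of \<phi>]] by blast
    obtain ys l where l: "\<And>y. y \<in> set2_fm \<phi> \<Longrightarrow> (ys ! l y :: 'y) = y"
      using list_index[OF finite_set2_fm[of \<phi>]] by blast
    have "map_fm ((!) xs) ((!) ys) (map_fm k l \<phi>) = map_fm id id \<phi>"
      unfolding fm.map_comp by (rule fm.map_cong) (use k l in auto)
    then show ?thesis by (intro exI[of _ "(map_fm k l \<phi>, xs, ys)"]) (simp add: fm.map_id)
  qed
  then have "\<forall>\<phi>. \<exists>p. ?g p = \<phi>" by blast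
  from choice[OF this] obtain f where f: "\<And>\<phi>. ?g (f \<phi>) = \<phi>" by blast
  then have i: "inj f" by (rule inj_on_inverseI)
  obtain c :: "(nat, nat) fm \<times> 'x list \<times> 'y list \<Rightarrow> 'a" where c: "inj c"
    using inj_pair_code[OF assms(1) inj_countable_code[OF assms(1)]
        inj_pair_code[OF assms(1) inj_list_code[OF assms(1,2)] inj_list_code[OF assms(1,3)]]] by auto
  show ?thesis using inj_compose[OF c i] by blast
qed

text \<open>The elementary hull of the values of s consists of the values of Skolem terms, which are
  terms whose function symbols are pairs of a formula and a variable.\<close>

lemma elementary_hull:
  fixes M :: "('f, 'r, 'b) struct" and s :: "nat \<Rightarrow> 'b"
  assumes M: "is_struct L M" and s: "range s \<subseteq> universe M"
  obtains H and e :: "(('f, 'r) fm \<times> nat) tm \<Rightarrow> 'b"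
  where "elementary_sub L M H" "range s \<subseteq> H" "H = range e"
proof -
  obtain d where d: "d \<in> universe M" using M by (auto simp: is_struct_def)
  \<comment> \<open>The assignment read off an argument list. Values beyond the list are immaterial,
    since lists long enough to cover all free variables of the formula will be used.\<close>
  define w where "w xs n = (if n < length xs then xs ! n else s 0)" for xs n
  define sk where "sk q xs = (case q of (\<phi>, i) \<Rightarrow>
      if \<exists>x\<in>universe M. sat M ((w xs)(i := x)) \<phi>
      then SOME x. x \<in> universe M \<and> sat M ((w xs)(i := x)) \<phi> else d)" for q xs
  have sk: "sk (\<phi>, i) xs \<in> universe M \<and> sat M ((w xs)(i := sk (\<phi>, i) xs)) \<phi>"
    if "\<exists>x\<in>universe M. sat M ((w xs)(i := x)) \<phi>" for \<phi> i xs
    unfolding sk_def prod.case if_P[OF that] by (rule someI_ex) (use that in auto)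
  then have sk': "sk q xs \<in> universe M" for q xs
    using d by (cases q) (auto simp: sk_def)
  \<comment> \<open>Only the functions of \<open>S\<close> matter: \<open>val\<close> evaluates
    Skolem terms in it, and since \<open>val\<close> does not check arities, a Skolem symbol takes
    argument lists of any length.\<close>
  define S :: "(('f, 'r) fm \<times> nat, 'r, 'b) struct"
    where "S = \<lparr>universe = universe M, fun_of = sk, rel_of = \<lambda>_ _. True\<rparr>"
  have fS: "fun_of S = sk" by (simp add: S_def)
  let ?H = "range (val S s)"
  have sH: "s n \<in> ?H" for n by (metis rangeI val.simps(1))
  have "elementary_sub L M ?H"
  proof (rule tarski_vaught[OF M])
    have "val S s t \<in> universe M" for t
      using s sk' by (cases t) (auto simp: S_def)
    then show "?H \<subseteq> universe M" by auto
    fix \<phi> i and v :: "nat \<Rightarrow> 'b"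
    assume v: "range v \<subseteq> ?H" and ex: "\<exists>x\<in>universe M. sat M (v(i := x)) \<phi>"
    obtain n where n: "\<And>k. k \<in> fv \<phi> \<Longrightarrow> k < n"
      using finite_nat_set_iff_bounded[of "fv \<phi>"] by auto
    have "\<forall>k. \<exists>t. v k = val S s t" using v by (simp add: image_subset_iff image_iff)
    from choice[OF this] obtain t where t: "\<And>k. v k = val S s (t k)" by blast
    let ?xs = "map v [0..<n]"
    have agree: "sat M ((w ?xs)(i := x)) \<phi> = sat M (v(i := x)) \<phi>" for x
      by (rule sat_cong) (auto simp: w_def dest: n)
    have "sat M (v(i := sk (\<phi>, i) ?xs)) \<phi>" using sk[of ?xs i \<phi>] ex agree by auto
    moreover have "sk (\<phi>, i) ?xs = val S s (Fn (\<phi>, i) (map t [0..<n]))"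
      by (simp add: fS comp_def t[symmetric])
    ultimately show "\<exists>x\<in>?H. sat M (v(i := x)) \<phi>" by (simp only:) blast
  qed auto
  then show thesis using that sH by blast
qed

text \<open>The ultrapower along the finite subsets of \<open>\<Sigma>\<close> realizes
  \<open>\<Sigma>\<close>, but its elements are functions and its universe may be too large. The
  Skolem hull of the realizing assignment is indexed by Skolem terms, which inject into
  \<open>'a\<close> by the hypotheses on the symbols; so the hull has a copy in the original
  type.\<close>

theorem compactness:
  fixes M :: "('f, 'r, 'a) struct"
  assumes M: "is_struct L M" and inf: "infinite (UNIV :: 'a set)"
    and f: "\<exists>c :: 'f \<Rightarrow> 'a. inj c" and r: "\<exists>c :: 'r \<Rightarrow> 'a. inj c"
    and wf: "\<And>\<phi>. \<phi> \<in> \<Sigma> \<Longrightarrow> wf_fm L \<phi>"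
    and fin: "\<And>\<Delta>. finite \<Delta> \<Longrightarrow> \<Delta> \<subseteq> \<Sigma> \<Longrightarrow> \<exists>v. range v \<subseteq> universe M \<and> (\<forall>\<phi>\<in>\<Delta>. sat M v \<phi>)"
  obtains N :: "('f, 'r, 'a) struct" and s
  where "is_struct L N" "range s \<subseteq> universe N" "\<And>\<phi>. \<phi> \<in> \<Sigma> \<Longrightarrow> sat N s \<phi>"
    "\<And>\<phi>. wf_fm L \<phi> \<Longrightarrow> satisfies M \<phi> \<Longrightarrow> satisfies N \<phi>"
proof -
  obtain d where d: "d \<in> universe M" using M by (auto simp: is_struct_def)
  \<comment> \<open>Index sets that are infinite or not contained in \<open>\<Sigma>\<close> get a
    constant assignment, so that a single function \<open>v\<close> is defined on all of
    them.\<close>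
  have "\<exists>v. range v \<subseteq> universe M \<and> (finite \<Delta> \<and> \<Delta> \<subseteq> \<Sigma> \<longrightarrow> (\<forall>\<phi>\<in>\<Delta>. sat M v \<phi>))" for \<Delta>
    using fin[of \<Delta>] d by (cases "finite \<Delta> \<and> \<Delta> \<subseteq> \<Sigma>") (auto intro!: exI[of _ "\<lambda>_. d"])
  then have "\<forall>\<Delta>. \<exists>v. range v \<subseteq> universe M \<and> (finite \<Delta> \<and> \<Delta> \<subseteq> \<Sigma> \<longrightarrow> (\<forall>\<phi>\<in>\<Delta>. sat M v \<phi>))"
    by blast
  from choice[OF this] obtain v where
    v': "\<forall>\<Delta>. range (v \<Delta>) \<subseteq> universe M \<and> (finite \<Delta> \<and> \<Delta> \<subseteq> \<Sigma> \<longrightarrow> (\<forall>\<phi>\<in>\<Delta>. sat M (v \<Delta>) \<phi>))" ..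
  then have v: "range (v \<Delta>) \<subseteq> universe M"
    "finite \<Delta> \<Longrightarrow> \<Delta> \<subseteq> \<Sigma> \<Longrightarrow> \<phi> \<in> \<Delta> \<Longrightarrow> sat M (v \<Delta>) \<phi>" for \<Delta> \<phi> by simp_all
  obtain G where G: "G \<le> finite_subsets_at_top \<Sigma>" "G \<noteq> bot"
    "\<And>P. eventually P G \<or> eventually (\<lambda>x. \<not> P x) G"
    using ultrafilter_exists[OF finite_subsets_at_top_neq_bot] by blast
  let ?U = "ultrapower G M"
  define s where "s n = ultra_rep G (universe M) (\<lambda>\<Delta>. v \<Delta> n)" for n
  have rv: "range (\<lambda>\<Delta>. v \<Delta> n) \<subseteq> universe M" for n using v(1) by auto
  have s: "s n \<in> universe ?U" for n unfolding s_def using rv by (auto simp: ultrapower_def)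
  have sat: "sat ?U s \<phi>" if \<phi>: "\<phi> \<in> \<Sigma>" for \<phi>
  proof -
    have 1: "\<forall>\<^sub>F \<Delta> in G. \<forall>n\<in>fv \<phi>. v \<Delta> n = s n \<Delta>"
      unfolding s_def by (rule eventually_ball_finite) (use ultra_rep(2)[OF rv] in auto)
    have "\<forall>\<^sub>F \<Delta> in finite_subsets_at_top \<Sigma>. sat M (v \<Delta>) \<phi>"
      unfolding eventually_finite_subsets_at_top
      by (rule exI[of _ "{\<phi>}"]) (use \<phi> v(2) in auto)
    then have "\<forall>\<^sub>F \<Delta> in G. sat M (v \<Delta>) \<phi>" using G(1) by (simp add: filter_leD)
    with 1 have "\<forall>\<^sub>F \<Delta> in G. sat M (\<lambda>n. s n \<Delta>) \<phi>"
    proof eventually_elim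
      case (elim \<Delta>)
      then show ?case using sat_cong[of \<phi> "v \<Delta>" "\<lambda>n. s n \<Delta>" M] by auto
    qed
    then show ?thesis using los[OF G(2,3) M s wf[OF \<phi>]] by simp
  qed
  have valid: "sat ?U u \<phi>" if "wf_fm L \<phi>" "satisfies M \<phi>" "range u \<subseteq> universe ?U" for \<phi> u
  proof -
    have u: "u n \<in> universe ?U" for n using that(3) by auto
    have "range (\<lambda>n. u n i) \<subseteq> universe M" for i
      by (intro image_subsetI) (rule ultrapower_range[OF u])
    then have "sat M (\<lambda>n. u n i) \<phi>" for i using that(2) by (simp add: satisfies_def)
    then show ?thesis using los[OF G(2,3) M u that(1)] by simp
  qed
  have "range s \<subseteq> universe ?U" using s by auto
  then obtain H and e :: "(('f, 'r) fm \<times> nat) tm \<Rightarrow> ('f, 'r) fm set \<Rightarrow> 'a"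
    where H: "elementary_sub L ?U H" "range s \<subseteq> H" "H = range e"
    by (rule elementary_hull[OF ultrapower_struct[OF M]])
  let ?H = "?U\<lparr>universe := H\<rparr>"
  obtain c :: "(('f, 'r) fm \<times> nat) tm \<Rightarrow> 'a" where c: "inj c"
    using inj_tm_code[OF inf inj_pair_code[OF inf inj_fm_code[OF inf f r] inj_countable_code[OF inf]]]
    by auto
  \<comment> \<open>An element of the hull is coded through some Skolem term that has it as
    value.\<close>
  define h where "h = c \<circ> inv_into UNIV e"
  have h: "inj_on h (universe ?H)"
    using comp_inj_on[OF inj_on_inv_into[of "range e" e UNIV] inj_on_subset[OF c]] H(3)
    by (simp add: h_def)
  have HS: "is_struct L ?H" and HU: "H \<subseteq> universe ?U"
    and el: "\<And>\<phi> u. wf_fm L \<phi> \<Longrightarrow> range u \<subseteq> H \<Longrightarrow> sat ?H u \<phi> = sat ?U u \<phi>"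
    using H(1) by (auto simp: elementary_sub_def)
  show thesis
  proof (rule that)
    show "is_struct L (transport h ?H)" by (rule transport_struct[OF HS])
    show "range (\<lambda>n. h (s n)) \<subseteq> universe (transport h ?H)"
      using H(2) by (auto simp: transport_simps)
    show "sat (transport h ?H) (\<lambda>n. h (s n)) \<phi>" if "\<phi> \<in> \<Sigma>" for \<phi>
      using sat_transport[OF h HS _ wf[OF that], of s] H(2) el[OF wf[OF that] H(2)] sat[OF that] by simp
    show "satisfies (transport h ?H) \<phi>" if "wf_fm L \<phi>" "satisfies M \<phi>" for \<phi>
      unfolding satisfies_def
    proof (intro allI impI)
      fix u :: "nat \<Rightarrow> 'a" assume "range u \<subseteq> universe (transport h ?H)"
      then have "\<forall>n. \<exists>x\<in>H. u n = h x" by (auto simp: transport_simps)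
      then have "\<forall>n. \<exists>x. x \<in> H \<and> u n = h x" by blast
      from choice[OF this] obtain t where "\<forall>n. t n \<in> H \<and> u n = h (t n)" ..
      then have t: "t n \<in> H" "u n = h (t n)" for n by simp_all
      have rt: "range t \<subseteq> universe ?H" using t(1) by auto
      have "sat ?H t \<phi>" using el[OF that(1), of t] valid[OF that, of t] rt HU by auto
      then have "sat (transport h ?H) (\<lambda>n. h (t n)) \<phi>"
        using sat_transport[OF h HS rt that(1)] by simp
      moreover have "u = (\<lambda>n. h (t n))" using t(2) by auto
      ultimately show "sat (transport h ?H) u \<phi>" by simp
    qed
  qed
qed

section \<open>Pregeometries\<close>

locale pregeometry =
  fixes U :: "'a set" and cl :: "'a set \<Rightarrow> 'a set"
  assumes cl_incr: "A \<subseteq> U \<Longrightarrow> A \<subseteq> cl A"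
    and cl_closed: "A \<subseteq> U \<Longrightarrow> cl A \<subseteq> U"
    and cl_mono: "A \<subseteq> B \<Longrightarrow> cl A \<subseteq> cl B"
    and cl_idem: "A \<subseteq> U \<Longrightarrow> cl (cl A) \<subseteq> cl A"
    and cl_finitary: "x \<in> cl A \<Longrightarrow> \<exists>F. finite F \<and> F \<subseteq> A \<and> x \<in> cl F"
    and cl_exchange: "A \<subseteq> U \<Longrightarrow> a \<in> U \<Longrightarrow> b \<in> U \<Longrightarrow> a \<in> cl (insert b A) \<Longrightarrow> a \<notin> cl A \<Longrightarrow>
      b \<in> cl (insert a A)"
begin

lemma cl_trans: "B \<subseteq> U \<Longrightarrow> A \<subseteq> cl B \<Longrightarrow> cl A \<subseteq> cl B"
  using cl_mono[of A "cl B"] cl_idem[of B] by blast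

text \<open>If adding the last element \<open>w r\<close> makes \<open>w i\<close> dependent on the
  others, then by exchange \<open>w r\<close> depends on \<open>w i\<close> and the others, that is,
  on its own predecessors.\<close>

lemma sequence_independent:
  fixes r :: nat
  assumes "B \<subseteq> U" "w ` {..<r} \<subseteq> U" "\<forall>j<r. w j \<notin> cl (B \<union> w ` {..<j})" "i < r"
  shows "w i \<notin> cl (B \<union> w ` ({..<r} - {i}))"
  using assms(2-4)
proof (induction r)
  case (Suc r)
  show ?case
  proof (cases "i = r")
    case True
    moreover have "{..<Suc r} - {r} = {..<r}" by auto
    ultimately show ?thesis using Suc.prems(2) by simp
  next
    case False
    let ?A = "B \<union> w ` ({..<r} - {i})"
    have i: "i < r" using False Suc.prems by auto
    have "w ` {..<r} \<subseteq> U" using Suc.prems(1) by (auto simp: lessThan_Suc)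
    then have IH: "w i \<notin> cl ?A" using Suc.IH i Suc.prems(2) by simp
    have "{..<Suc r} - {i} = insert r ({..<r} - {i})" using i by auto
    then have eq: "B \<union> w ` ({..<Suc r} - {i}) = insert (w r) ?A" by auto
    have sub: "?A \<subseteq> U" "w i \<in> U" "w r \<in> U"
      using Suc.prems(1) assms(1) i by (auto simp: image_subset_iff)
    show ?thesis
    proof
      assume "w i \<in> cl (B \<union> w ` ({..<Suc r} - {i}))"
      then have "w r \<in> cl (insert (w i) ?A)" using cl_exchange[OF sub] IH eq by simp
      moreover have "insert (w i) ?A = B \<union> w ` {..<r}" using i by auto
      ultimately show False using Suc.prems(2) by simp
    qed
  qed
qed simp

text \<open>Exchange trades an element of \<open>F\<close> for \<open>w 0\<close>. Moving
  \<open>w 0\<close> into \<open>C\<close> leaves the shifted sequence and one element less in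
  \<open>F\<close>, which is why \<open>C\<close> varies in the induction.\<close>

lemma steinitz:
  fixes k :: nat
  assumes "C \<subseteq> U" "finite F" "F \<subseteq> U" "w ` {..<k} \<subseteq> cl (C \<union> F)"
    "\<And>i. i < k \<Longrightarrow> w i \<notin> cl (C \<union> w ` {..<i})"
  shows "k \<le> card F"
  using assms
proof (induction k arbitrary: C F w)
  case (Suc k)
  have w0: "w 0 \<in> cl (C \<union> F)" "w 0 \<notin> cl C" using Suc.prems(4) Suc.prems(5)[of 0] by auto
  \<comment> \<open>The element to be traded is taken from a smallest part of \<open>F\<close> that
    generates \<open>w 0\<close> over \<open>C\<close>; without it, \<open>w 0\<close> is no longer
    generated.\<close>
  let ?P = "\<lambda>F'. F' \<subseteq> F \<and> w 0 \<in> cl (C \<union> F')"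
  have "\<exists>F'. ?P F' \<and> (\<forall>G. ?P G \<longrightarrow> card F' \<le> card G)"
    by (rule ex_has_least_nat[of ?P F]) (use w0 in simp)
  then obtain F' where "?P F' \<and> (\<forall>G. ?P G \<longrightarrow> card F' \<le> card G)" ..
  then have F': "F' \<subseteq> F" "w 0 \<in> cl (C \<union> F')"
    and min: "G \<subseteq> F \<Longrightarrow> w 0 \<in> cl (C \<union> G) \<Longrightarrow> card F' \<le> card G" for G by simp_all
  have "F' \<noteq> {}" using F' w0 by auto
  then obtain f where f: "f \<in> F'" by auto
  have fF: "finite F'" using F' Suc.prems(2) finite_subset by blast
  have "w 0 \<notin> cl (C \<union> (F' - {f}))"
    using min[of "F' - {f}"] F'(1) card_Diff1_less[OF fF f] by auto
  moreover have "insert f (C \<union> (F' - {f})) = C \<union> F'" using f by auto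
  moreover have U: "w 0 \<in> U" "f \<in> U" "C \<union> (F' - {f}) \<subseteq> U"
    using w0 cl_closed[of "C \<union> F"] Suc.prems f F' by auto
  ultimately have "f \<in> cl (insert (w 0) (C \<union> (F' - {f})))"
    using cl_exchange[of "C \<union> (F' - {f})" "w 0" f] F'(2) by simp
  then have f': "f \<in> cl (insert (w 0) C \<union> (F - {f}))"
    using cl_mono[of "insert (w 0) (C \<union> (F' - {f}))" "insert (w 0) C \<union> (F - {f})"] F'(1) by auto
  have sub: "insert (w 0) C \<union> (F - {f}) \<subseteq> U" using U Suc.prems by auto
  have "k \<le> card (F - {f})"
  proof (rule Suc.IH[of "insert (w 0) C" _ "\<lambda>i. w (Suc i)"])
    show "insert (w 0) C \<subseteq> U" "finite (F - {f})" "F - {f} \<subseteq> U" using U Suc.prems by auto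
    have "C \<union> F \<subseteq> cl (insert (w 0) C \<union> (F - {f}))" using cl_incr[OF sub] f' by auto
    then have "cl (C \<union> F) \<subseteq> cl (insert (w 0) C \<union> (F - {f}))" by (rule cl_trans[OF sub])
    then show "(\<lambda>i. w (Suc i)) ` {..<k} \<subseteq> cl (insert (w 0) C \<union> (F - {f}))"
      using Suc.prems(4) by (auto simp: image_subset_iff)
    fix i assume i: "i < k"
    have "insert (w 0) C \<union> (\<lambda>i. w (Suc i)) ` {..<i} = C \<union> w ` {..<Suc i}"
      unfolding lessThan_Suc_eq_insert_0 by auto
    then show "w (Suc i) \<notin> cl (insert (w 0) C \<union> (\<lambda>i. w (Suc i)) ` {..<i})"
      using Suc.prems(5)[of "Suc i"] i by simp
  qed
  then show ?case using card_Suc_Diff1[of F f] f F'(1) Suc.prems(2) by auto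
qed simp

text \<open>A spanning part of least size is independent, since an element generated by the others
  could be dropped.\<close>

lemma basis_in_spanning:
  assumes "finite I" "B \<union> I \<subseteq> U" "S \<subseteq> cl (B \<union> I)"
  obtains J where "J \<subseteq> I" "S \<subseteq> cl (B \<union> J)" "\<And>a. a \<in> J \<Longrightarrow> a \<notin> cl (B \<union> (J - {a}))"
proof -
  let ?P = "\<lambda>J. J \<subseteq> I \<and> S \<subseteq> cl (B \<union> J)"
  have "\<exists>J. ?P J \<and> (\<forall>G. ?P G \<longrightarrow> card J \<le> card G)"
    by (rule ex_has_least_nat[of ?P I]) (use assms in simp)
  then obtain J where "?P J \<and> (\<forall>G. ?P G \<longrightarrow> card J \<le> card G)" ..
  then have J: "J \<subseteq> I" "S \<subseteq> cl (B \<union> J)"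
    and min: "G \<subseteq> I \<Longrightarrow> S \<subseteq> cl (B \<union> G) \<Longrightarrow> card J \<le> card G" for G by simp_all
  have fJ: "finite J" using J assms finite_subset by blast
  have "a \<notin> cl (B \<union> (J - {a}))" if a: "a \<in> J" for a
  proof
    assume "a \<in> cl (B \<union> (J - {a}))"
    moreover have sub: "B \<union> (J - {a}) \<subseteq> U" using J assms by auto
    ultimately have "B \<union> J \<subseteq> cl (B \<union> (J - {a}))" using cl_incr[OF sub] by auto
    then have "S \<subseteq> cl (B \<union> (J - {a}))" using cl_trans[OF sub] J(2) by blast
    then have "card J \<le> card (J - {a})" using min J(1) by blast
    then show False using card_Diff1_less[OF fJ a] by simp
  qed
  then show thesis using that J by blast
qed

end

section \<open>Pairs as structures\<close>

abbreviation lift :: "('f, 'r) fm \<Rightarrow> ('f, 'r option) fm" where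
  "lift \<equiv> map_fm id Some"

definition reduct :: "('f, 'r option, 'a) struct \<Rightarrow> ('f, 'r, 'a) struct" where
  "reduct N = \<lparr>universe = universe N, fun_of = fun_of N, rel_of = (\<lambda>r. rel_of N (Some r))\<rparr>"

lemma reduct_simps [simp]:
  "universe (reduct N) = universe N" "fun_of (reduct N) = fun_of N"
  "rel_of (reduct N) r = rel_of N (Some r)"
  by (simp_all add: reduct_def)

lemma pair_struct_simps [simp]:
  "universe (pair_struct M E) = universe M" "fun_of (pair_struct M E) = fun_of M"
  "rel_of (pair_struct M E) (Some r) = rel_of M r" "rel_of (pair_struct M E) None [x] \<longleftrightarrow> x \<in> E"
  by (simp_all add: pair_struct_def)

lemma reduct_pair_struct [simp]: "reduct (pair_struct M E) = M"
  by (simp add: reduct_def)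

lemma val_reduct [simp]: "val (reduct N) = val N"
proof (intro ext)
  show "val (reduct N) v t = val N v t" for v t
    by (induction t) (auto cong: map_cong)
qed

lemma sat_lift [simp]: "sat N v (lift \<phi>) = sat (reduct N) v \<phi>"
  by (induction \<phi> arbitrary: v) (simp_all add: tm.map_ident id_def comp_def)

lemma fv_lift [simp]: "fv (lift \<phi>) = fv \<phi>"
  by (induction \<phi>) (simp_all add: tm.map_ident id_def)

lemma pair_lang_simps [simp]:
  "funs (pair_lang L) = funs L" "rels (pair_lang L) = insert None (Some ` rels L)"
  "fun_arity (pair_lang L) = fun_arity L" "rel_arity (pair_lang L) (Some r) = rel_arity L r"
  "rel_arity (pair_lang L) None = 1"
  by (simp_all add: pair_lang_def)

lemma wf_tm_pair_lang [simp]: "wf_tm (pair_lang L) t = wf_tm L t"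
  by (induction t) auto

lemma wf_lift [simp]: "wf_fm (pair_lang L) (lift \<phi>) = wf_fm L \<phi>"
  by (induction \<phi>) (auto simp add: tm.map_ident id_def)

lemma expr_lift: "expr L V Q \<Longrightarrow> expr (pair_lang L) V (\<lambda>N. Q (reduct N))"
  unfolding expr_def
proof (elim exE conjE)
  fix \<phi> assume "wf_fm L \<phi>" "fv \<phi> \<subseteq> V" "\<forall>M v. sat M v \<phi> = Q M v"
  then show "\<exists>\<phi>. wf_fm (pair_lang L) \<phi> \<and> fv \<phi> \<subseteq> V \<and> (\<forall>N v. sat N v \<phi> = Q (reduct N) v)"
    by (intro exI[of _ "lift \<phi>"]) simp
qed

lemma expr_P: "i \<in> V \<Longrightarrow> expr (pair_lang L) V (\<lambda>N v. rel_of N None [v i])"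
  using expr_sat[of "pair_lang L" "Rel None [Var i]" V] by simp

lemma pair_struct_is_struct [simp]:
  "is_struct (pair_lang L) (pair_struct M E) \<longleftrightarrow> is_struct L M"
  by (simp add: is_struct_def)

lemma reduct_is_struct: "is_struct (pair_lang L) N \<Longrightarrow> is_struct L (reduct N)"
  by (simp add: is_struct_def)

lemma eqtp_reduct:
  assumes "eqtp (pair_lang L) (pair_struct M E) s (pair_struct M' E') s' m"
  shows "eqtp L M s M' s' m"
proof (rule eqtpI)
  fix Q assume Q: "expr L {..<m} Q" "Q M s"
  show "Q M' s'" using eqtp_expr[OF assms expr_lift[OF Q(1)]] Q(2) by simp
qed

definition predicate :: "('f, 'r option, 'a) struct \<Rightarrow> 'a set" where
  "predicate N = {x \<in> universe N. rel_of N None [x]}"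

text \<open>A structure for the pair language may interpret the predicate arbitrarily outside the
  universe and on lists that are not singletons. It therefore agrees with an honest pair only on
  well-formed formulas and on assignments into the universe.\<close>

lemma sat_pair_struct_reduct:
  assumes "is_struct (pair_lang L) N" "wf_fm (pair_lang L) \<phi>" "range v \<subseteq> universe N"
  shows "sat (pair_struct (reduct N) (predicate N)) v \<phi> = sat N v \<phi>"
proof -
  let ?N = "pair_struct (reduct N) (predicate N)"
  have val: "val ?N v t = val N v t" for v t
    by (induction t) (auto cong: map_cong simp: pair_struct_def reduct_def)
  show ?thesis using assms(2,3)
  proof (induction \<phi> arbitrary: v)
    case (Rel r ts)
    show ?case
    proof (cases r)
      case None
      then obtain t where t: "ts = [t]" "wf_tm L t" using Rel.prems(1) by (auto simp: length_Suc_conv)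
      have "val N v t \<in> universe N"
        using val_closed[of "pair_lang L" N t v] assms(1) t(2) Rel.prems(2) by auto
      then show ?thesis unfolding t None
        by (simp only: sat.simps list.map val pair_struct_simps) (simp add: predicate_def)
    next
      case (Some q)
      have "map (val ?N v) ts = map (val N v) ts" by (simp add: val)
      then show ?thesis unfolding Some
        by (simp only: sat.simps pair_struct_simps reduct_simps)
    qed
  next
    case (Exists i \<phi>)
    have "sat ?N (v(i := x)) \<phi> = sat N (v(i := x)) \<phi>" if "x \<in> universe N" for x
      by (rule Exists.IH) (use Exists.prems that range_upd in auto)
    then show ?case by simp
  qed (auto simp: val)
qed

section \<open>Algebraic closure in geometric theories\<close>

text \<open>Uniqueness of the value at position \<open>n\<close> is demanded in all structures, not
  just in models of the theory. So the property belongs to the formula alone and needs no check when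
  passing from one pair to another.\<close>

definition functional :: "'u ulang \<Rightarrow> nat \<Rightarrow> 'u ufm \<Rightarrow> bool" where
  "functional L n \<kappa> \<longleftrightarrow> wf_fm L \<kappa> \<and> fv \<kappa> \<subseteq> {..n} \<and>
     (\<forall>(M :: 'u ustruct) v. \<forall>x\<in>universe M. \<forall>y\<in>universe M.
        sat M (v(n := x)) \<kappa> \<longrightarrow> sat M (v(n := y)) \<kappa> \<longrightarrow> x = y)"

lemma functional_wf: "functional L n \<kappa> \<Longrightarrow> wf_fm L \<kappa>"
  and functional_fv: "functional L n \<kappa> \<Longrightarrow> fv \<kappa> \<subseteq> {..n}"
  by (auto simp: functional_def)

lemma functional_unique:
  fixes M :: "'u ustruct"
  assumes "functional L n \<kappa>" "sat M (v(n := x)) \<kappa>" "sat M (v(n := y)) \<kappa>"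
    "x \<in> universe M" "y \<in> universe M"
  shows "x = y"
  using assms unfolding functional_def by blast

lemma fv_renameI: "(\<And>i. i \<in> fv \<phi> \<Longrightarrow> r i \<in> V) \<Longrightarrow> fv (rename r \<phi>) \<subseteq> V"
  using fv_rename[of r \<phi>] by auto

lemma atMost_diff: "A \<subseteq> {..Suc n} \<Longrightarrow> A - {Suc n} \<subseteq> {..n}"
proof
  fix x assume "A \<subseteq> {..Suc n}" "x \<in> A - {Suc n}"
  then have "x \<le> Suc n" "x \<noteq> Suc n" by auto
  then show "x \<in> {..n}" by simp
qed

lemma restrict_tuples: "g ` {..<n} \<subseteq> A \<Longrightarrow> restrict g {..<n} \<in> tuples A n"
  by (auto simp: tuples_def)

lemma tuples_mono: "A \<subseteq> B \<Longrightarrow> tuples A n \<subseteq> tuples B n"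
  unfolding tuples_def by (rule PiE_mono)

lemma tuples_image: "b \<in> tuples A n \<Longrightarrow> b ` {..<n} \<subseteq> A"
  by (auto simp: tuples_def)

lemma tuples_ext: "x \<in> tuples A n \<Longrightarrow> y \<in> tuples B n \<Longrightarrow> (\<And>i. i < n \<Longrightarrow> x i = y i) \<Longrightarrow> x = y"
  unfolding tuples_def by (metis PiE_ext lessThan_iff PiE_restrict restrict_PiE_iff restrict_ext)

lemma finite_enum:
  assumes "finite F" obtains g :: "nat \<Rightarrow> 'a" and n where "F = g ` {..<n}"
proof -
  obtain xs where "set xs = F" using finite_list[OF assms] by auto
  then have "F = (\<lambda>i. xs ! i) ` {..<length xs}" by (auto simp: set_conv_nth)
  then show thesis by (rule that)
qed

text \<open>The definitions put the distinguished variable first; below it comes last, so that parameters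
  and further variables can be appended without renaming.\<close>

lemma fiber_last:
  assumes "fv \<phi> \<subseteq> {..k}"
  shows "fiber M \<phi> (restrict g {..<k}) = {x \<in> universe M. sat M (g(k := x)) (rename (case_nat k id) \<phi>)}"
proof -
  have "sat M (case_nat x (restrict g {..<k})) \<phi> = sat M (\<lambda>i. (g(k := x)) (case_nat k id i)) \<phi>" for x
    by (rule sat_cong) (use assms in \<open>auto split: nat.splits\<close>)
  then show ?thesis by (simp add: fiber_def)
qed

lemma last_fiber:
  assumes "fv \<phi> \<subseteq> {..n}"
  shows "{x \<in> universe M. sat M (g(n := x)) \<phi>} =
    fiber M (rename (\<lambda>i. if i = n then 0 else Suc i) \<phi>) (restrict g {..<n})"
proof -
  have "sat M (g(n := x)) \<phi> =
    sat M (\<lambda>i. case_nat x (restrict g {..<n}) (if i = n then 0 else Suc i)) \<phi>" for x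
    by (rule sat_cong) (use assms in force)
  then show ?thesis by (simp add: fiber_def)
qed

lemma definable_subset_last:
  assumes "wf_fm L \<phi>" "fv \<phi> \<subseteq> {..n}" "g ` {..<n} \<subseteq> A"
  shows "definable_subset L M A {x \<in> universe M. sat M (g(n := x)) \<phi>}"
proof -
  let ?r = "\<lambda>i. if i = n then 0 else Suc i"
  have "fv (rename ?r \<phi>) \<subseteq> {..n}"
    by (rule fv_renameI) (use assms(2) in \<open>auto simp: less_eq_Suc_le[symmetric] dest!: subsetD\<close>)
  then show ?thesis
    unfolding definable_subset_def last_fiber[OF assms(2)]
    using assms(1) restrict_tuples[OF assms(3)] by (metis wf_rename)
qed

lemma definable_subset_lastE:
  assumes "definable_subset L M A X"
  obtains \<phi> n g where "wf_fm L \<phi>" "fv \<phi> \<subseteq> {..n}" "g ` {..<n} \<subseteq> A"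
    "X = {x \<in> universe M. sat M (g(n := x)) \<phi>}"
proof -
  obtain \<phi> k b where b: "b \<in> tuples A k" "wf_fm L \<phi>" "fv \<phi> \<subseteq> {..k}" "X = fiber M \<phi> b"
    using assms by (auto simp: definable_subset_def)
  have "restrict b {..<k} = b" using b(1) by (simp add: tuples_def PiE_restrict)
  then have "X = {x \<in> universe M. sat M (b(k := x)) (rename (case_nat k id) \<phi>)}"
    using fiber_last[OF b(3), of M b] b(4) by simp
  moreover have "fv (rename (case_nat k id) \<phi>) \<subseteq> {..k}"
    by (rule fv_renameI) (use b(3) in \<open>auto split: nat.splits\<close>)
  ultimately show thesis
    using that[of "rename (case_nat k id) \<phi>" k b] b(2) tuples_image[OF b(1)] by (simp only: wf_rename)
qed

lemma acl_last:
  "x \<in> acl L M A \<longleftrightarrow> (\<exists>\<phi> n g. wf_fm L \<phi> \<and> fv \<phi> \<subseteq> {..n} \<and> g ` {..<n} \<subseteq> A \<and>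
     finite {y \<in> universe M. sat M (g(n := y)) \<phi>} \<and> x \<in> universe M \<and> sat M (g(n := x)) \<phi>)"
  (is "?l \<longleftrightarrow> ?r")
proof
  assume ?l
  then obtain X where X: "definable_subset L M A X" "finite X" "x \<in> X" by (auto simp: acl_def)
  from X(1) show ?r
  proof (rule definable_subset_lastE)
    fix \<phi> n g assume "wf_fm L \<phi>" "fv \<phi> \<subseteq> {..n}" "g ` {..<n} \<subseteq> A"
      "X = {x \<in> universe M. sat M (g(n := x)) \<phi>}"
    then show ?r using X(2,3) by (intro exI[of _ \<phi>] exI[of _ n] exI[of _ g]) auto
  qed
next
  assume ?r
  then obtain \<phi> n g where "wf_fm L \<phi>" "fv \<phi> \<subseteq> {..n}" "g ` {..<n} \<subseteq> A"
    "finite {y \<in> universe M. sat M (g(n := y)) \<phi>}" "x \<in> universe M" "sat M (g(n := x)) \<phi>" by blast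
  then show ?l unfolding acl_def using definable_subset_last[of L \<phi> n g A M] by blast
qed

lemma acl_finitary:
  assumes "x \<in> acl L M A" shows "\<exists>F. finite F \<and> F \<subseteq> A \<and> x \<in> acl L M F"
proof -
  obtain \<phi> n g where "wf_fm L \<phi>" "fv \<phi> \<subseteq> {..n}" "g ` {..<n} \<subseteq> A"
    "finite {y \<in> universe M. sat M (g(n := y)) \<phi>}" "x \<in> universe M" "sat M (g(n := x)) \<phi>"
    using assms unfolding acl_last by blast
  then have "x \<in> acl L M (g ` {..<n})" unfolding acl_last by blast
  with \<open>g ` {..<n} \<subseteq> A\<close> show ?thesis by (intro exI[of _ "g ` {..<n}"]) simp
qed

lemma acl_mono: "A \<subseteq> B \<Longrightarrow> acl L M A \<subseteq> acl L M B"
  unfolding acl_def definable_subset_def using tuples_mono by blast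

lemma acl_universe: "acl L M A \<subseteq> universe M"
  by (auto simp: acl_last)

lemma acl_incr: "A \<subseteq> universe M \<Longrightarrow> A \<subseteq> acl L M A"
proof
  fix a assume a: "a \<in> A" "A \<subseteq> universe M"
  then have "{y \<in> universe M. sat M ((\<lambda>_. a)(1 := y)) (Equal (Var 0) (Var 1))} = {a}" by auto
  then show "a \<in> acl L M A" unfolding acl_last
    using a by (intro exI[of _ "Equal (Var 0) (Var 1)"] exI[of _ 1] exI[of _ "\<lambda>_. a"]) auto
qed

locale geometric =
  fixes L :: "'u ulang" and R :: "'u ring_symbols" and T :: "'u ufm set" and \<theta> :: "'u ufm" and p :: nat
  assumes geom: "geometric_theory L R T \<theta> p"
begin

abbreviation model :: "'u ustruct \<Rightarrow> bool" where "model M \<equiv> models L M T"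
abbreviation pair :: "'u ustruct \<Rightarrow> 'u set \<Rightarrow> bool" where "pair M E \<equiv> dense_pair L T \<theta> p M E"
abbreviation top_of :: "'u ustruct \<Rightarrow> 'u topology" where "top_of M \<equiv> def_top M \<theta> p"
abbreviation PL :: "('u, 'u option) lang" where "PL \<equiv> pair_lang L"

lemma model_struct: "model M \<Longrightarrow> is_struct L M"
  by (simp add: models_def)

lemma model_facts:
  assumes "model M"
  shows "acl_exchange L M" "good_topology M \<theta> p" "cell_decomposition L M (top_of M)"
    "topological_domain R M (top_of M)"
    "definable_subset L M (universe M) X \<Longrightarrow> finite X \<or> top_of M interior_of X \<noteq> {}"
  using geom assms by (auto simp: geometric_theory_def)

text \<open>A Skolem formula defines a single element only in models and only when there is a
  solution. Conjoining that no other element satisfies it yields uniqueness everywhere and loses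
  nothing in the good case.\<close>

lemma functional_selector:
  assumes "wf_fm L \<phi>" "fv \<phi> \<subseteq> {..n}"
  obtains \<kappa> where "functional L n \<kappa>"
    "\<And>M g. model M \<Longrightarrow> g ` {..<n} \<subseteq> universe M \<Longrightarrow> \<exists>x\<in>universe M. sat M (g(n := x)) \<phi> \<Longrightarrow>
      \<exists>x\<in>universe M. sat M (g(n := x)) \<phi> \<and> sat M (g(n := x)) \<kappa>"
proof -
  let ?r = "\<lambda>i. if i = n then 0 else Suc i"
  have "fv (rename ?r \<phi>) \<subseteq> {..n}"
    by (rule fv_renameI) (use assms(2) in \<open>auto simp: less_eq_Suc_le[symmetric] dest!: subsetD\<close>)
  then have "\<exists>\<psi>. wf_fm L \<psi> \<and> fv \<psi> \<subseteq> {..n} \<and> (\<forall>M :: 'u ustruct. model M \<longrightarrow>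
      (\<forall>b\<in>tuples (universe M) n. fiber M (rename ?r \<phi>) b \<noteq> {} \<longrightarrow>
        (\<exists>c\<in>fiber M (rename ?r \<phi>) b. fiber M \<psi> b = {c})))"
    using geom assms(1) unfolding geometric_theory_def definable_skolem_functions_def by simp
  then obtain \<psi> where \<psi>: "wf_fm L \<psi>" "fv \<psi> \<subseteq> {..n}"
    and sk: "\<And>(M :: 'u ustruct) b. model M \<Longrightarrow> b \<in> tuples (universe M) n \<Longrightarrow>
      fiber M (rename ?r \<phi>) b \<noteq> {} \<Longrightarrow> \<exists>c\<in>fiber M (rename ?r \<phi>) b. fiber M \<psi> b = {c}" by blast
  define \<psi>' where "\<psi>' = rename (case_nat n id) \<psi>"
  have "fv (rename (case_nat n id) \<psi>) \<subseteq> {..n}"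
    by (rule fv_renameI) (use \<psi>(2) in \<open>auto split: nat.splits\<close>)
  then have \<psi>': "wf_fm L \<psi>'" "fv \<psi>' \<subseteq> {..n}" using \<psi>(1) by (simp_all add: \<psi>'_def)
  let ?q = "\<lambda>i. if i = n then Suc n else i"
  define \<kappa> where "\<kappa> = Conj \<psi>' (Neg (Exists (Suc n) (Conj (rename ?q \<psi>') (Neg (Equal (Var (Suc n)) (Var n))))))"
  have sat_q: "sat M (\<lambda>i. (v(Suc n := y)) (?q i)) \<psi>' = sat M (v(n := y)) \<psi>'" for M v and y :: 'u
    by (rule sat_cong) (use \<psi>' in force)
  have sat_\<kappa>: "sat M v \<kappa> \<longleftrightarrow> sat M v \<psi>' \<and> (\<forall>y\<in>universe M. sat M (v(n := y)) \<psi>' \<longrightarrow> y = v n)"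
    for M and v :: "nat \<Rightarrow> 'u"
    using sat_q by (auto simp: \<kappa>_def)
  have "fv (rename ?q \<psi>') \<subseteq> {..Suc n}"
    by (rule fv_renameI) (use \<psi>'(2) in auto)
  then have "fv (rename ?q \<psi>') \<union> {Suc n, n} - {Suc n} \<subseteq> {..n}" by (intro atMost_diff) simp
  moreover have "fv \<kappa> = fv \<psi>' \<union> (fv (rename ?q \<psi>') \<union> {Suc n, n} - {Suc n})"
    unfolding \<kappa>_def by auto
  ultimately have fv: "fv \<kappa> \<subseteq> {..n}" using \<psi>'(2) by (simp only: Un_subset_iff)
  have "functional L n \<kappa>"
    unfolding functional_def
  proof (intro conjI allI ballI impI)
    show "wf_fm L \<kappa>" using \<psi>'(1) by (simp add: \<kappa>_def)
    fix M :: "'u ustruct" and v x y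
    assume "x \<in> universe M" "sat M (v(n := x)) \<kappa>" "sat M (v(n := y)) \<kappa>"
    then show "x = y" unfolding sat_\<kappa> fun_upd_upd fun_upd_same by blast
  qed (rule fv)
  moreover have "\<exists>x\<in>universe M. sat M (g(n := x)) \<phi> \<and> sat M (g(n := x)) \<kappa>"
    if M: "model M" and g: "g ` {..<n} \<subseteq> universe M" and ex: "\<exists>x\<in>universe M. sat M (g(n := x)) \<phi>"
    for M g
  proof -
    have "fiber M (rename ?r \<phi>) (restrict g {..<n}) \<noteq> {}"
      using ex unfolding last_fiber[OF assms(2), symmetric] by auto
    then obtain c where "c \<in> fiber M (rename ?r \<phi>) (restrict g {..<n})"
      "fiber M \<psi> (restrict g {..<n}) = {c}"
      using sk[OF M restrict_tuples[OF g]] by blast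
    then have c: "c \<in> universe M" "sat M (g(n := c)) \<phi>"
      "{x \<in> universe M. sat M (g(n := x)) \<psi>'} = {c}"
      unfolding last_fiber[OF assms(2), symmetric] fiber_last[OF \<psi>(2)] \<psi>'_def by auto
    then have "sat M (g(n := c)) \<kappa>" unfolding sat_\<kappa> fun_upd_upd fun_upd_same by blast
    with c show ?thesis by blast
  qed
  ultimately show thesis by (rule that)
qed

text \<open>Algebraic elements are definable: a Skolem function selects one element of the finite
  solution set; if this is not \<open>x\<close>, it is removed and the argument is repeated on the
  smaller set.\<close>

lemma acl_functional:
  fixes n :: nat
  assumes M: "model M" and g: "g ` {..<n} \<subseteq> universe M"
  shows "x \<in> acl L M (g ` {..<n}) \<longleftrightarrow> x \<in> universe M \<and> (\<exists>\<kappa>. functional L n \<kappa> \<and> sat M (g(n := x)) \<kappa>)"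
    (is "?l \<longleftrightarrow> ?r")
proof
  assume ?r
  then obtain \<kappa> where \<kappa>: "x \<in> universe M" "functional L n \<kappa>" "sat M (g(n := x)) \<kappa>" by blast
  then have "{y \<in> universe M. sat M (g(n := y)) \<kappa>} \<subseteq> {x}"
    using functional_unique[of L n \<kappa> M g _ x] by blast
  then have "finite {y \<in> universe M. sat M (g(n := y)) \<kappa>}" using finite_subset by blast
  then show ?l unfolding acl_last using \<kappa> functional_wf functional_fv by blast
next
  have step: "\<exists>\<kappa>. functional L n \<kappa> \<and> sat M (g(n := x)) \<kappa>"
    if "wf_fm L \<phi>" "fv \<phi> \<subseteq> {..n}" "finite {y \<in> universe M. sat M (g(n := y)) \<phi>}"
      "x \<in> universe M" "sat M (g(n := x)) \<phi>" for \<phi>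
    using that
  proof (induction "card {y \<in> universe M. sat M (g(n := y)) \<phi>}" arbitrary: \<phi> rule: less_induct)
    case less
    let ?S = "\<lambda>\<phi>. {y \<in> universe M. sat M (g(n := y)) \<phi>}"
    from less.prems(1,2) show ?case
    proof (rule functional_selector)
      fix \<kappa> assume \<kappa>: "functional L n \<kappa>"
        and "\<And>M g. model M \<Longrightarrow> g ` {..<n} \<subseteq> universe M \<Longrightarrow> \<exists>x\<in>universe M. sat M (g(n := x)) \<phi> \<Longrightarrow>
          \<exists>x\<in>universe M. sat M (g(n := x)) \<phi> \<and> sat M (g(n := x)) \<kappa>"
      then obtain c where c: "c \<in> universe M" "sat M (g(n := c)) \<phi>" "sat M (g(n := c)) \<kappa>"
        using M g less.prems by blast
      show ?thesis
      proof (cases "c = x")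
        case False
        have nx: "\<not> sat M (g(n := x)) \<kappa>"
          using functional_unique[OF \<kappa>, of M g x c] c less.prems False by blast
        have sub: "?S (Conj \<phi> (Neg \<kappa>)) \<subset> ?S \<phi>" using c by auto
        then have "card (?S (Conj \<phi> (Neg \<kappa>))) < card (?S \<phi>)"
          by (rule psubset_card_mono[OF less.prems(3)])
        then show ?thesis
        proof (rule less.hyps)
          show "finite (?S (Conj \<phi> (Neg \<kappa>)))" using sub less.prems(3) finite_subset by blast
        qed (use \<kappa> less.prems nx in \<open>auto simp: functional_def\<close>)
      qed (use c \<kappa> in blast)
    qed
  qed
  assume ?l
  then obtain \<phi> k h where \<phi>: "wf_fm L \<phi>" "fv \<phi> \<subseteq> {..k}" "h ` {..<k} \<subseteq> g ` {..<n}"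
    "finite {y \<in> universe M. sat M (h(k := y)) \<phi>}" "x \<in> universe M" "sat M (h(k := x)) \<phi>"
    unfolding acl_last by blast
  \<comment> \<open>The parameters witnessing algebraicity may repeat or reorder the entries of
    \<open>g\<close>; they are renamed to positions in \<open>g\<close>.\<close>
  have "\<forall>j. \<exists>i. j < k \<longrightarrow> i < n \<and> h j = g i" using \<phi>(3) by (auto simp: image_subset_iff image_iff)
  from choice[OF this] obtain \<rho> where \<rho>: "\<forall>j. j < k \<longrightarrow> \<rho> j < n \<and> h j = g (\<rho> j)" ..
  let ?rn = "\<lambda>i. if i = k then n else \<rho> i"
  have eq: "sat M (g(n := y)) (rename ?rn \<phi>) = sat M (h(k := y)) \<phi>" for y
    unfolding sat_rename
  proof (rule sat_cong)
    fix i assume "i \<in> fv \<phi>"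
    then have "i \<le> k" using \<phi>(2) by auto
    then show "(g(n := y)) (?rn i) = (h(k := y)) i"
      using \<rho>[rule_format, of i] by (cases "i = k") auto
  qed
  have "fv (rename ?rn \<phi>) \<subseteq> {..n}"
  proof (rule fv_renameI)
    fix i assume "i \<in> fv \<phi>"
    then have "i \<le> k" using \<phi>(2) by auto
    then show "?rn i \<in> {..n}" using \<rho>[rule_format, of i] by (cases "i = k") auto
  qed
  then show ?r using step[of "rename ?rn \<phi>"] \<phi> by (simp only: eq wf_rename simp_thms)
qed

text \<open>Functional formulas compose: \<open>a\<close> is a function of \<open>g\<close>, and
  \<open>x\<close> is a function of \<open>g\<close> and \<open>a\<close>.\<close>

lemma acl_cut:
  fixes n :: nat
  assumes M: "model M" and g: "g ` {..<n} \<subseteq> universe M"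
    and a: "a \<in> acl L M (g ` {..<n})" and x: "x \<in> acl L M (insert a (g ` {..<n}))"
  shows "x \<in> acl L M (g ` {..<n})"
proof -
  obtain \<kappa> where \<kappa>: "functional L n \<kappa>" "sat M (g(n := a)) \<kappa>" and aM: "a \<in> universe M"
    using a acl_functional[OF M g] by blast
  have ins: "insert a (g ` {..<n}) = (g(n := a)) ` {..<Suc n}"
    by (auto simp: lessThan_Suc)
  have ga: "(g(n := a)) ` {..<Suc n} \<subseteq> universe M" using g aM ins by auto
  obtain \<psi> where \<psi>: "functional L (Suc n) \<psi>" "sat M (g(n := a, Suc n := x)) \<psi>" and xM: "x \<in> universe M"
    using x acl_functional[OF M ga] unfolding ins by blast
  \<comment> \<open>In the composed formula the free variable \<open>n\<close> is the value and the
    bound variable \<open>Suc n\<close> is the intermediate element. Since \<open>\<psi>\<close> has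
    these two in the opposite order, \<open>?q\<close> swaps them.\<close>
  let ?r = "\<lambda>i. if i = n then Suc n else i"
  let ?q = "\<lambda>i. if i = n then Suc n else if i = Suc n then n else i"
  let ?\<phi> = "Exists (Suc n) (Conj (rename ?r \<kappa>) (rename ?q \<psi>))"
  have wf: "wf_fm L ?\<phi>" using \<kappa>(1) \<psi>(1) by (simp add: functional_wf)
  have "fv (rename ?r \<kappa>) \<subseteq> {..Suc n}"
    by (rule fv_renameI) (use functional_fv[OF \<kappa>(1)] in auto)
  moreover have "fv (rename ?q \<psi>) \<subseteq> {..Suc n}"
    by (rule fv_renameI) (use functional_fv[OF \<psi>(1)] in auto)
  ultimately have "fv (rename ?r \<kappa>) \<union> fv (rename ?q \<psi>) - {Suc n} \<subseteq> {..n}"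
    by (intro atMost_diff) simp
  then have fv: "fv ?\<phi> \<subseteq> {..n}" by simp
  have 1: "sat M (\<lambda>i. (g(n := y, Suc n := b)) (?r i)) \<kappa> = sat M (g(n := b)) \<kappa>" for y b
    by (rule sat_cong) (use functional_fv[OF \<kappa>(1)] in force)
  have 2: "sat M (\<lambda>i. (g(n := y, Suc n := b)) (?q i)) \<psi> = sat M (g(n := b, Suc n := y)) \<psi>" for y b
    by (rule sat_cong) (use functional_fv[OF \<psi>(1)] in force)
  have sat: "sat M (g(n := y)) ?\<phi> \<longleftrightarrow>
      (\<exists>b\<in>universe M. sat M (g(n := b)) \<kappa> \<and> sat M (g(n := b, Suc n := y)) \<psi>)" for y
    unfolding sat.simps sat_rename 1 2 ..
  have "{y \<in> universe M. sat M (g(n := y)) ?\<phi>} \<subseteq> {x}"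
  proof
    fix y assume "y \<in> {y \<in> universe M. sat M (g(n := y)) ?\<phi>}"
    then obtain b where b: "y \<in> universe M" "b \<in> universe M" "sat M (g(n := b)) \<kappa>"
      "sat M (g(n := b, Suc n := y)) \<psi>" unfolding sat by blast
    have "b = a" using functional_unique[OF \<kappa>(1)] b \<kappa>(2) aM by blast
    then show "y \<in> {x}" using functional_unique[OF \<psi>(1)] b \<psi>(2) xM by blast
  qed
  then have fin: "finite {y \<in> universe M. sat M (g(n := y)) ?\<phi>}" using finite_subset by blast
  have "sat M (g(n := x)) ?\<phi>" unfolding sat using \<kappa> \<psi> aM by blast
  with wf fv fin xM show ?thesis unfolding acl_last by blast
qed

text \<open>Only idempotence needs work. By finite character it reduces to finitely many algebraic
  parameters, which \<open>acl_cut\<close> removes one at a time.\<close>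

lemma acl_pregeometry:
  assumes M: "model M"
  shows "pregeometry (universe M) (acl L M)"
proof
  fix A assume A: "A \<subseteq> universe M"
  have "x \<in> acl L M A" if "finite F" "F \<subseteq> acl L M A" "finite B" "B \<subseteq> A" "x \<in> acl L M (F \<union> B)" for F B x
    using that
  proof (induction F arbitrary: B rule: finite_induct)
    case empty
    then show ?case using acl_mono[of B A] by auto
  next
    case (insert f F)
    obtain C where C: "finite C" "C \<subseteq> A" "f \<in> acl L M C"
      using insert.prems(1) acl_finitary[of f L M A] by auto
    have "finite (F \<union> (B \<union> C))" using insert C by auto
    then obtain g and n :: nat where g: "F \<union> (B \<union> C) = g ` {..<n}" using finite_enum by metis
    have "g ` {..<n} \<subseteq> universe M"
      using insert.prems C A acl_universe[of L M A] unfolding g[symmetric] by blast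
    moreover have "f \<in> acl L M (g ` {..<n})"
      using C(3) acl_mono[of C "g ` {..<n}"] unfolding g[symmetric] by blast
    moreover have "x \<in> acl L M (insert f (g ` {..<n}))"
      using insert.prems(4) acl_mono[of "insert f F \<union> B" "insert f (g ` {..<n})"]
      unfolding g[symmetric] by blast
    ultimately have "x \<in> acl L M (F \<union> (B \<union> C))" unfolding g by (rule acl_cut[OF M])
    then show ?case using insert C by blast
  qed
  then show "acl L M (acl L M A) \<subseteq> acl L M A"
    using acl_finitary[of _ L M "acl L M A"] by (metis Un_empty_right empty_subsetI finite.emptyI subsetI)
next
  fix A a b assume "A \<subseteq> universe M" "a \<in> universe M" "b \<in> universe M"
    "a \<in> acl L M (insert b A)" "a \<notin> acl L M A"
  then show "b \<in> acl L M (insert a A)"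
    using model_facts(1)[OF M] unfolding acl_exchange_def by blast
next
  show "\<And>A. A \<subseteq> universe M \<Longrightarrow> A \<subseteq> acl L M A" by (rule acl_incr)
  show "\<And>A. A \<subseteq> universe M \<Longrightarrow> acl L M A \<subseteq> universe M" by (rule acl_universe)
  show "\<And>A B. A \<subseteq> B \<Longrightarrow> acl L M A \<subseteq> acl L M B" by (rule acl_mono)
  show "\<And>x A. x \<in> acl L M A \<Longrightarrow> \<exists>F. finite F \<and> F \<subseteq> A \<and> x \<in> acl L M F" by (rule acl_finitary)
qed

end

section \<open>Dense pairs\<close>

context geometric
begin

definition \<theta>' :: "'u ufm" where
  "\<theta>' = rename (case_nat p id) \<theta>"

text \<open>The parameters are an arbitrary function instead of an extensional tuple, so that they
  can be read off any assignment.\<close>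

definition basic :: "'u ustruct \<Rightarrow> (nat \<Rightarrow> 'u) \<Rightarrow> 'u set" where
  "basic M q = {x \<in> universe M. sat M (\<lambda>j. if j < p then q j else x) \<theta>'}"

lemma wf_\<theta>': "wf_fm L \<theta>'" and fv_\<theta>': "fv \<theta>' \<subseteq> {..p}"
proof -
  have "wf_fm L \<theta>" and fv: "fv \<theta> \<subseteq> {..p}" using geom by (auto simp: geometric_theory_def)
  then show "wf_fm L \<theta>'" by (simp add: \<theta>'_def)
  show "fv \<theta>' \<subseteq> {..p}" unfolding \<theta>'_def
    by (rule fv_renameI) (use fv in \<open>auto split: nat.splits\<close>)
qed

lemma basic_cong: "(\<And>j. j < p \<Longrightarrow> q j = q' j) \<Longrightarrow> basic M q = basic M q'"
proof -
  assume "\<And>j. j < p \<Longrightarrow> q j = q' j"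
  then have "(\<lambda>j. if j < p then q j else x) = (\<lambda>j. if j < p then q' j else x)" for x by auto
  then show ?thesis by (simp add: basic_def)
qed

lemma fiber_basic: "fiber M \<theta> (restrict q {..<p}) = basic M q"
proof -
  have "sat M (q(p := x)) \<theta>' = sat M (\<lambda>j. if j < p then q j else x) \<theta>'" for x
    by (rule sat_cong) (use fv_\<theta>' in force)
  moreover have "fv \<theta> \<subseteq> {..p}" using geom by (auto simp: geometric_theory_def)
  ultimately show ?thesis by (simp add: fiber_last basic_def \<theta>'_def)
qed

lemma expr_basic:
  assumes "i \<in> V" "r ` {..<p} \<subseteq> V"
  shows "expr L V (\<lambda>M v. sat M (\<lambda>j. if j < p then v (r j) else v i) \<theta>')"
  by (rule expr_subst[OF expr_sat[OF wf_\<theta>' subset_refl], of "\<lambda>j. if j < p then r j else i"])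
    (use assms in auto)

lemma openin_top:
  assumes M: "model M"
  shows "openin (top_of M) U \<longleftrightarrow>
    (\<forall>x\<in>U. \<exists>q. q ` {..<p} \<subseteq> universe M \<and> x \<in> basic M q \<and> basic M q \<subseteq> U)"
proof -
  have "istopology (arbitrary union_of (\<lambda>U. U \<in> basic_sets M \<theta> p))"
    using model_facts(2)[OF M] by (simp add: good_topology_def)
  then have "openin (top_of M) U \<longleftrightarrow> (\<forall>x\<in>U. \<exists>B. B \<in> basic_sets M \<theta> p \<and> x \<in> B \<and> B \<subseteq> U)"
    unfolding def_top_def by (simp add: topology_inverse' arbitrary_union_of_alt)
  moreover have "(\<exists>B. B \<in> basic_sets M \<theta> p \<and> x \<in> B \<and> B \<subseteq> U) \<longleftrightarrow>
      (\<exists>q. q ` {..<p} \<subseteq> universe M \<and> x \<in> basic M q \<and> basic M q \<subseteq> U)" for x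
  proof
    assume "\<exists>B. B \<in> basic_sets M \<theta> p \<and> x \<in> B \<and> B \<subseteq> U"
    then obtain q where q: "q \<in> tuples (universe M) p" "x \<in> fiber M \<theta> q" "fiber M \<theta> q \<subseteq> U"
      by (auto simp: basic_sets_def)
    moreover have "restrict q {..<p} = q" using q(1) by (simp add: tuples_def PiE_restrict)
    ultimately show "\<exists>q. q ` {..<p} \<subseteq> universe M \<and> x \<in> basic M q \<and> basic M q \<subseteq> U"
      using fiber_basic[of M q] tuples_image[OF q(1)] by (intro exI[of _ q]) simp
  next
    assume "\<exists>q. q ` {..<p} \<subseteq> universe M \<and> x \<in> basic M q \<and> basic M q \<subseteq> U"
    then obtain q where q: "q ` {..<p} \<subseteq> universe M" "x \<in> basic M q" "basic M q \<subseteq> U" by blast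
    have "basic M q \<in> basic_sets M \<theta> p"
      unfolding basic_sets_def fiber_basic[symmetric] using restrict_tuples[OF q(1)] by blast
    with q show "\<exists>B. B \<in> basic_sets M \<theta> p \<and> x \<in> B \<and> B \<subseteq> U" by blast
  qed
  ultimately show ?thesis by simp
qed

lemma openin_basic: "model M \<Longrightarrow> q ` {..<p} \<subseteq> universe M \<Longrightarrow> openin (top_of M) (basic M q)"
  unfolding openin_top by blast

lemma topspace_top: "model M \<Longrightarrow> topspace (top_of M) = universe M"
  by (drule model_facts(2)) (simp add: good_topology_def)

lemma open_minus_finite:
  assumes "model M" "openin (top_of M) U" "finite F"
  shows "openin (top_of M) (U - F)"
proof -
  have "t1_space (top_of M)"
    using model_facts(2)[OF assms(1)] unfolding good_topology_def by blast
  moreover have "finite (F \<inter> U)" "F \<inter> U \<subseteq> topspace (top_of M)"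
    using assms(3) openin_subset[OF assms(2)] by auto
  ultimately have "closedin (top_of M) (F \<inter> U)"
    unfolding t1_space_closedin_finite by blast
  then have "openin (top_of M) (U - F \<inter> U)" by (rule openin_diff[OF assms(2)])
  moreover have "U - F \<inter> U = U - F" by auto
  ultimately show ?thesis by simp
qed

text \<open>In a T1 space all points but one of a finite open set can be removed, leaving an
  isolated point.\<close>

lemma open_infinite:
  assumes M: "model M" and U: "openin (top_of M) U" "U \<noteq> {}"
  shows "infinite U"
proof
  assume "finite U"
  obtain x where x: "x \<in> U" using U by auto
  have "openin (top_of M) (U - (U - {x}))"
    using open_minus_finite[OF M U(1)] \<open>finite U\<close> by blast
  moreover have "U - (U - {x}) = {x}" using x by auto
  moreover have "x \<in> universe M" using openin_subset[OF U(1)] x topspace_top[OF M] by auto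
  ultimately show False using model_facts(2)[OF M] by (simp add: good_topology_def)
qed

lemma universe_nonempty: "model M \<Longrightarrow> universe M \<noteq> {}"
  by (drule model_struct) (auto simp: is_struct_def)

lemma infinite_universe: "model M \<Longrightarrow> infinite (universe M)"
  using open_infinite[of M "universe M"] openin_topspace[of "top_of M"] topspace_top[of M]
    universe_nonempty[of M] by simp

lemma infinite_UNIV: "infinite (UNIV :: 'u set)"
proof -
  obtain M where "model M" using geom by (auto simp: geometric_theory_def complete_theory_def)
  then show ?thesis using infinite_universe[of M] finite_subset[OF subset_UNIV] by blast
qed

lemma infinite_definable_open:
  assumes M: "model M" and \<phi>: "wf_fm L \<phi>" "fv \<phi> \<subseteq> {..n}" and g: "g ` {..<n} \<subseteq> universe M"
    and inf: "infinite {x \<in> universe M. sat M (g(n := x)) \<phi>}"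
  obtains V where "openin (top_of M) V" "V \<noteq> {}" "V \<subseteq> {x \<in> universe M. sat M (g(n := x)) \<phi>}"
proof (rule that)
  let ?X = "{x \<in> universe M. sat M (g(n := x)) \<phi>}"
  show "top_of M interior_of ?X \<noteq> {}"
    using model_facts(5)[OF M definable_subset_last[OF \<phi> g]] inf by blast
qed (auto simp: interior_of_subset)

section \<open>Elementarity and density in a pair\<close>

lemma pair_model: "pair M E \<Longrightarrow> model M"
  and pair_subset: "pair M E \<Longrightarrow> E \<subseteq> universe M"
  and pair_proper: "pair M E \<Longrightarrow> E \<noteq> universe M"
  and pair_elementary: "pair M E \<Longrightarrow> elementary_sub L M E"
  by (auto simp: dense_pair_def elementary_sub_def)

lemma pair_nonempty: "pair M E \<Longrightarrow> E \<noteq> {}"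
  using pair_elementary[of M E] by (auto simp: elementary_sub_def is_struct_def)

lemma pair_tarski_vaught:
  assumes "pair M E" "wf_fm L \<phi>" "\<And>j. j \<in> fv \<phi> \<Longrightarrow> j \<noteq> i \<Longrightarrow> v j \<in> E"
    "\<exists>x\<in>universe M. sat M (v(i := x)) \<phi>"
  shows "\<exists>x\<in>E. sat M (v(i := x)) \<phi>"
proof -
  obtain d where d: "d \<in> E" using pair_nonempty[OF assms(1)] by auto
  \<comment> \<open>Elementarity speaks of assignments into \<open>E\<close> only, so the values at
    irrelevant variables are replaced by an element of \<open>E\<close>.\<close>
  define w where "w j = (if j \<in> fv \<phi> \<and> j \<noteq> i then v j else d)" for j
  have w: "range w \<subseteq> E" using d assms(3) by (auto simp: w_def)
  have eq: "sat M (v(i := x)) \<phi> = sat M (w(i := x)) \<phi>" for x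
    by (rule sat_cong) (auto simp: w_def)
  have el: "\<And>\<phi> v. wf_fm L \<phi> \<Longrightarrow> range v \<subseteq> E \<Longrightarrow> sat (M\<lparr>universe := E\<rparr>) v \<phi> = sat M v \<phi>"
    using pair_elementary[OF assms(1)] by (auto simp: elementary_sub_def)
  have "sat M w (Exists i \<phi>)" using assms(4) eq by simp
  then have "sat (M\<lparr>universe := E\<rparr>) w (Exists i \<phi>)" using el[of "Exists i \<phi>" w] w assms(2) by simp
  then obtain x where x: "x \<in> E" "sat (M\<lparr>universe := E\<rparr>) (w(i := x)) \<phi>" by auto
  then have "sat M (w(i := x)) \<phi>" using el[OF assms(2), of "w(i := x)"] range_upd[OF w] by simp
  then show ?thesis using x(1) eq by blast
qed

text \<open>By elementarity, a functional formula with parameters in \<open>E\<close> that has a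
  solution has one in \<open>E\<close>, and by uniqueness it is the given one.\<close>

lemma pair_acl_closed:
  assumes P: "pair M E" and B: "B \<subseteq> E"
  shows "acl L M B \<subseteq> E"
proof
  fix x assume x: "x \<in> acl L M B"
  obtain F where F: "finite F" "F \<subseteq> B" "x \<in> acl L M F" using acl_finitary[OF x] by blast
  obtain g and n :: nat where g: "F = g ` {..<n}" using finite_enum[OF F(1)] by blast
  have gE: "g ` {..<n} \<subseteq> E" using F(2) B unfolding g by (rule subset_trans)
  have gM: "g ` {..<n} \<subseteq> universe M" using gE pair_subset[OF P] by (rule subset_trans)
  obtain \<kappa> where \<kappa>: "functional L n \<kappa>" "sat M (g(n := x)) \<kappa>" and xM: "x \<in> universe M"
    using F(3) unfolding g acl_functional[OF pair_model[OF P] gM] by blast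
  have "\<exists>y\<in>E. sat M (g(n := y)) \<kappa>"
  proof (rule pair_tarski_vaught[OF P functional_wf[OF \<kappa>(1)]])
    fix j assume "j \<in> fv \<kappa>" "j \<noteq> n"
    then have "j < n" using functional_fv[OF \<kappa>(1)] by force
    then show "g j \<in> E" using gE by auto
  qed (use \<kappa> xM in blast)
  then obtain y where y: "y \<in> E" "sat M (g(n := y)) \<kappa>" by blast
  have "y \<in> universe M" using y(1) pair_subset[OF P] by blast
  then have "y = x" using functional_unique[OF \<kappa>(1) y(2) \<kappa>(2)] xM by simp
  then show "x \<in> E" using y by simp
qed

text \<open>Density gives one point of \<open>E\<close>; since finitely many points can be removed
  from \<open>U\<close> without losing openness or nonemptiness, there are infinitely many.\<close>

lemma pair_meets:
  assumes P: "pair M E" and U: "openin (top_of M) U" "U \<noteq> {}"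
  shows "infinite (U \<inter> E)"
proof
  assume fin: "finite (U \<inter> E)"
  have "U - (U \<inter> E) \<noteq> {}"
    using open_infinite[OF pair_model[OF P] U] fin finite_subset[of U "U \<inter> E"] by auto
  then obtain x where x: "x \<in> U - (U \<inter> E)" by blast
  have "x \<in> universe M" using x openin_subset[OF U(1)] topspace_top[OF pair_model[OF P]] by auto
  then have "x \<in> top_of M closure_of E" using P by (simp add: dense_pair_def)
  then have "\<forall>V. x \<in> V \<and> openin (top_of M) V \<longrightarrow> (\<exists>y. y \<in> E \<and> y \<in> V)"
    unfolding in_closure_of by (rule conjunct2)
  from spec[OF this, of "U - (U \<inter> E)"] show False
    using x open_minus_finite[OF pair_model[OF P] U(1) fin] by blast
qed

text \<open>Being a dense pair is a first-order property: elementarity is the Tarski-Vaught scheme,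
  and density is expressible because the basic open sets form a uniformly definable family.\<close>

lemma dense_pair_transfer:
  assumes P: "pair M E" and N: "is_struct PL N"
    and valid: "\<And>\<phi>. wf_fm PL \<phi> \<Longrightarrow> satisfies (pair_struct M E) \<phi> \<Longrightarrow> satisfies N \<phi>"
  shows "pair (reduct N) (predicate N)"
proof -
  let ?M = "reduct N" and ?E = "predicate N"
  have tr: "Q N v" if Q: "expr PL V Q" "\<And>v. range v \<subseteq> universe M \<Longrightarrow> Q (pair_struct M E) v"
    "range v \<subseteq> universe N" for V Q v
  proof -
    obtain \<phi> where \<phi>: "wf_fm PL \<phi>" "\<And>N v. sat N v \<phi> = Q N v" using Q(1) unfolding expr_def by blast
    then have "satisfies (pair_struct M E) \<phi>" using Q(2) by (simp add: satisfies_def)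
    then show ?thesis using valid[OF \<phi>(1)] \<phi>(2) Q(3) by (simp add: satisfies_def)
  qed
  obtain d where d: "d \<in> universe N" using N by (auto simp: is_struct_def)
  have rd: "range (\<lambda>_. d) \<subseteq> universe N" using d by auto
  have NM: "is_struct L ?M" by (rule reduct_is_struct[OF N])
  have mod: "model ?M"
    unfolding models_def
  proof (intro conjI ballI NM)
    fix \<phi> assume "\<phi> \<in> T"
    then have \<phi>: "wf_fm L \<phi>" "satisfies M \<phi>"
      using geom pair_model[OF P]
      by (auto simp: geometric_theory_def complete_theory_def sentence_def models_def)
    then have "satisfies (pair_struct M E) (lift \<phi>)" by (simp add: satisfies_def)
    then have "satisfies N (lift \<phi>)" using valid \<phi>(1) by simp
    then show "satisfies ?M \<phi>" by (simp add: satisfies_def)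
  qed
  have sub: "?E \<subseteq> universe ?M" by (auto simp: predicate_def)
  have el: "elementary_sub L ?M ?E"
  proof (rule tarski_vaught[OF NM sub])
    have "expr PL {} (\<lambda>N v. \<exists>x\<in>universe N. rel_of N None [(v(0 := x)) 0])"
      by (rule expr_mono[OF expr_ex[OF expr_P, of 0 "{0}"]]) auto
    from tr[OF this _ rd] show "?E \<noteq> {}"
      using pair_nonempty[OF P] pair_subset[OF P] by (auto simp: predicate_def)
    fix \<phi> i v
    assume \<phi>: "wf_fm L \<phi>" and v: "range v \<subseteq> ?E" and ex: "\<exists>x\<in>universe ?M. sat ?M (v(i := x)) \<phi>"
    \<comment> \<open>The Tarski-Vaught criterion for the one formula \<open>\<phi>\<close>: if its
      parameters lie in the predicate and it has a solution, then it has one in the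
      predicate.\<close>
    define Q where "Q = (\<lambda>(N :: ('u, 'u option, 'u) struct) v.
      (\<forall>j\<in>fv \<phi>. rel_of N None [v j]) \<longrightarrow>
      (\<exists>x\<in>universe N. sat (reduct N) (v(i := x)) \<phi>) \<longrightarrow>
      (\<exists>x\<in>universe N. rel_of N None [(v(i := x)) i] \<and> sat (reduct N) (v(i := x)) \<phi>))"
    have "expr PL (insert i (fv \<phi>)) Q"
      unfolding Q_def
      by (intro expr_imp expr_ball expr_P expr_mono[OF expr_ex[of _ "insert i (fv \<phi>)"]] expr_conj
          expr_lift[OF expr_sat] \<phi>) auto
    moreover have "Q (pair_struct M E) w" for w
      unfolding Q_def using pair_tarski_vaught[OF P \<phi>, of i w] pair_subset[OF P] by auto
    moreover have "range v \<subseteq> universe N" using v sub by auto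
    ultimately have "Q N v" by (rule tr)
    then show "\<exists>x\<in>?E. sat ?M (v(i := x)) \<phi>"
      using v ex by (auto simp: Q_def predicate_def)
  qed
  have "expr PL {} (\<lambda>N v. \<exists>x\<in>universe N. \<not> rel_of N None [(v(0 := x)) 0])"
    by (rule expr_mono[OF expr_ex[OF expr_neg[OF expr_P], of 0 "{0}"]]) auto
  from tr[OF this _ rd] have ne: "?E \<noteq> universe ?M"
    using pair_proper[OF P] pair_subset[OF P] by (auto simp: predicate_def)
  have "top_of ?M closure_of ?E = universe ?M"
  proof (intro equalityI subsetI)
    show "x \<in> universe ?M" if "x \<in> top_of ?M closure_of ?E" for x
      using that by (simp add: in_closure_of topspace_top[OF mod])
    define B where "B = (\<lambda>(N :: ('u, 'u option, 'u) struct) v.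
      sat (reduct N) (\<lambda>j. if j < p then v j else v p) \<theta>')"
    have B: "expr PL {..<Suc p} B"
      unfolding B_def by (rule expr_lift, rule expr_basic[of _ _ "\<lambda>j. j"]) auto
    have Bupd: "B N (v(p := x)) \<longleftrightarrow> sat (reduct N) (\<lambda>j. if j < p then v j else x) \<theta>'" for N v x
      unfolding B_def by (rule sat_cong) auto
    \<comment> \<open>Density, stated for basic sets: each nonempty one meets the predicate.\<close>
    define Q where "Q = (\<lambda>(N :: ('u, 'u option, 'u) struct) v.
      (\<exists>x\<in>universe N. B N (v(p := x))) \<longrightarrow>
      (\<exists>x\<in>universe N. rel_of N None [(v(p := x)) p] \<and> B N (v(p := x))))"
    have "expr PL {..<p} Q" unfolding Q_def
      by (intro expr_imp expr_ex_last expr_conj expr_P B) auto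
    moreover have "Q (pair_struct M E) q" if q: "range q \<subseteq> universe M" for q
    proof -
      have "q ` {..<p} \<subseteq> universe M" using q by auto
      then have "basic M q \<noteq> {} \<Longrightarrow> infinite (basic M q \<inter> E)"
        using pair_meets[OF P openin_basic[OF pair_model[OF P]]] by blast
      then have "basic M q \<noteq> {} \<Longrightarrow> basic M q \<inter> E \<noteq> {}" by force
      then show ?thesis using pair_subset[OF P] by (auto simp: Q_def Bupd basic_def)
    qed
    ultimately have Q: "Q N q" if "range q \<subseteq> universe N" for q using tr that by blast
    fix x assume x: "x \<in> universe ?M"
    have "\<exists>y\<in>?E. y \<in> U" if U: "x \<in> U" "openin (top_of ?M) U" for U
    proof -
      obtain q where q: "q ` {..<p} \<subseteq> universe ?M" "x \<in> basic ?M q" "basic ?M q \<subseteq> U"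
        using U(2)[unfolded openin_top[OF mod]] U(1) by blast
      let ?q = "\<lambda>j. if j < p then q j else d"
      have eq: "basic ?M ?q = basic ?M q" by (rule basic_cong) simp
      have "range ?q \<subseteq> universe N" using q(1) d by auto
      from Q[OF this] have "basic ?M ?q \<noteq> {} \<longrightarrow> basic ?M ?q \<inter> ?E \<noteq> {}"
        unfolding Q_def Bupd basic_def predicate_def by auto
      then show ?thesis using q eq by blast
    qed
    then show "x \<in> top_of ?M closure_of ?E"
      using x by (auto simp: in_closure_of topspace_top[OF mod])
  qed
  then show ?thesis using mod el ne by (simp add: dense_pair_def)
qed

text \<open>Compactness for \<open>\<Sigma>\<close> together with the complete type of the first
  \<open>m\<close> entries of \<open>s\<close>. The elements of \<open>M\<close> are not named, so
  the new pair contains a copy of these entries only up to type, and need not extend the old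
  pair.\<close>

theorem pair_extension:
  assumes P: "pair M E" and s: "range s \<subseteq> universe M"
    and wf: "\<And>\<phi>. \<phi> \<in> \<Sigma> \<Longrightarrow> wf_fm PL \<phi>"
    and fin: "\<And>\<Delta>. finite \<Delta> \<Longrightarrow> \<Delta> \<subseteq> \<Sigma> \<Longrightarrow> \<exists>v. range v \<subseteq> universe M \<and> (\<forall>i<m. v i = s i) \<and>
      (\<forall>\<phi>\<in>\<Delta>. sat (pair_struct M E) v \<phi>)"
  obtains M' E' s' where "pair M' E'" "range s' \<subseteq> universe M'"
    "eqtp PL (pair_struct M E) s (pair_struct M' E') s' m"
    "\<And>\<phi>. \<phi> \<in> \<Sigma> \<Longrightarrow> sat (pair_struct M' E') s' \<phi>"
proof -
  let ?P = "pair_struct M E"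
  let ?\<Gamma> = "{\<phi>. wf_fm PL \<phi> \<and> fv \<phi> \<subseteq> {..<m} \<and> sat ?P s \<phi>}"
  have str: "is_struct PL ?P" using model_struct[OF pair_model[OF P]] by simp
  \<comment> \<open>The relation symbols of the pair language form an option type, which must inject
    into \<open>'u\<close> for compactness to apply.\<close>
  have "\<exists>c :: 'u list \<Rightarrow> 'u. inj c" by (rule inj_list_code[OF infinite_UNIV]) (rule exI[of _ "\<lambda>x. x"], simp)
  then obtain l :: "'u list \<Rightarrow> 'u" where l: "inj l" ..
  have "inj (case_option (l []) (\<lambda>x. l [x]))"
    by (rule injI) (auto simp: inj_eq[OF l] split: option.splits)
  then have opt: "\<exists>c :: 'u option \<Rightarrow> 'u. inj c" by blast
  have id: "\<exists>c :: 'u \<Rightarrow> 'u. inj c" by (rule exI[of _ "\<lambda>x. x"]) simp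
  have sat: "\<exists>v. range v \<subseteq> universe ?P \<and> (\<forall>\<phi>\<in>\<Delta>. sat ?P v \<phi>)"
    if "finite \<Delta>" "\<Delta> \<subseteq> \<Sigma> \<union> ?\<Gamma>" for \<Delta>
  proof -
    have "finite (\<Delta> \<inter> \<Sigma>)" using that by simp
    then have "\<exists>v. range v \<subseteq> universe M \<and> (\<forall>i<m. v i = s i) \<and> (\<forall>\<phi>\<in>\<Delta> \<inter> \<Sigma>. sat ?P v \<phi>)"
      by (rule fin) simp
    then obtain v where v: "range v \<subseteq> universe M" "\<forall>i<m. v i = s i"
      "\<forall>\<phi>\<in>\<Delta> \<inter> \<Sigma>. sat ?P v \<phi>" by blast
    have "sat ?P v \<phi>" if "\<phi> \<in> ?\<Gamma>" for \<phi>
    proof -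
      have "sat ?P v \<phi> = sat ?P s \<phi>" by (rule sat_cong) (use that v(2) in auto)
      then show ?thesis using that by simp
    qed
    then show ?thesis using v that by (intro exI[of _ v]) auto
  qed
  have wfS: "\<phi> \<in> \<Sigma> \<union> ?\<Gamma> \<Longrightarrow> wf_fm PL \<phi>" for \<phi> using wf by blast
  show thesis
  proof (rule compactness[OF str infinite_UNIV id opt wfS sat])
    fix N :: "('u, 'u option, 'u) struct" and s' :: "nat \<Rightarrow> 'u"
    assume N: "is_struct PL N" "range s' \<subseteq> universe N"
      "\<And>\<phi>. \<phi> \<in> \<Sigma> \<union> ?\<Gamma> \<Longrightarrow> sat N s' \<phi>"
      "\<And>\<phi>. wf_fm PL \<phi> \<Longrightarrow> satisfies ?P \<phi> \<Longrightarrow> satisfies N \<phi>"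
    let ?M = "reduct N" and ?E = "predicate N"
    have eq: "sat (pair_struct ?M ?E) s' \<phi> = sat N s' \<phi>" if "wf_fm PL \<phi>" for \<phi>
      by (rule sat_pair_struct_reduct[OF N(1) that N(2)])
    show thesis
    proof (rule that)
      show "pair ?M ?E" by (rule dense_pair_transfer[OF P N(1,4)])
      show "range s' \<subseteq> universe ?M" using N(2) by simp
      show "sat (pair_struct ?M ?E) s' \<phi>" if "\<phi> \<in> \<Sigma>" for \<phi> using N(3) that eq wf by simp
      show "eqtp PL ?P s (pair_struct ?M ?E) s' m"
        unfolding eqtp_def
      proof (intro allI impI)
        fix \<phi> assume \<phi>: "wf_fm PL \<phi> \<and> fv \<phi> \<subseteq> {..<m}"
        show "sat ?P s \<phi> = sat (pair_struct ?M ?E) s' \<phi>"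
          using N(3)[of \<phi>] N(3)[of "Neg \<phi>"] \<phi> eq[of \<phi>] by auto
      qed
    qed
  qed
qed

end

section \<open>Tuples of generators\<close>

context geometric
begin

text \<open>For functional \<open>\<kappa>\<close>, these \<open>x\<close> form the image of a power
  of \<open>E\<close> under a partial function definable over \<open>v\<close>.\<close>

definition small_at :: "'u ustruct \<Rightarrow> 'u set \<Rightarrow> nat \<Rightarrow> nat \<Rightarrow> 'u ufm \<Rightarrow> (nat \<Rightarrow> 'u) \<Rightarrow> 'u \<Rightarrow> bool" where
  "small_at M E n k \<kappa> v x \<longleftrightarrow> (\<exists>e\<in>tuples E k. sat M ((append_tuple n v e)(n + k := x)) \<kappa>)"

lemma image_append_tuple: "append_tuple n v e ` {..<n + k} = v ` {..<n} \<union> e ` {..<k}"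
proof -
  have "{..<n + k} = {..<n} \<union> (\<lambda>j. n + j) ` {..<k}"
  proof (intro equalityI subsetI)
    fix i assume "i \<in> {..<n + k}"
    then show "i \<in> {..<n} \<union> (\<lambda>j. n + j) ` {..<k}"
      by (cases "i < n") (auto intro!: image_eqI[of _ _ "i - n"])
  qed auto
  moreover have "append_tuple n v e ` {..<n} = v ` {..<n}"
    by (rule image_cong) (auto simp: append_tuple_def)
  moreover have "append_tuple n v e ` (\<lambda>j. n + j) ` {..<k} = e ` {..<k}"
    unfolding image_image by (rule image_cong) (auto simp: append_tuple_def)
  ultimately show ?thesis by (simp add: image_Un)
qed

text \<open>Algebraicity over \<open>E\<close>, which refers to infinitely many parameters, becomes
  an infinite disjunction of formulas of the pair language. Its negation can therefore be part of a
  type.\<close>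

lemma acl_over:
  fixes n :: nat
  assumes P: "pair M E" and s: "s ` {..<n} \<subseteq> universe M"
  shows "x \<in> acl L M (E \<union> s ` {..<n}) \<longleftrightarrow>
    x \<in> universe M \<and> (\<exists>k \<kappa>. functional L (n + k) \<kappa> \<and> small_at M E n k \<kappa> s x)" (is "?l \<longleftrightarrow> ?r")
proof
  assume ?l
  from acl_finitary[OF this] obtain F
    where F: "finite F" "F \<subseteq> E \<union> s ` {..<n}" "x \<in> acl L M F" by blast
  have "finite (F \<inter> E)" using F(1) by simp
  then obtain e0 and k :: nat where e0: "F \<inter> E = e0 ` {..<k}" by (rule finite_enum)
  define e where "e = restrict e0 {..<k}"
  have e: "e \<in> tuples E k" unfolding e_def by (rule restrict_tuples) (use e0 in blast)
  have ek: "e ` {..<k} = F \<inter> E" unfolding e0 e_def by auto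
  have sub: "append_tuple n s e ` {..<n + k} \<subseteq> universe M"
    unfolding image_append_tuple using s tuples_image[OF e] pair_subset[OF P] by blast
  have "F \<subseteq> append_tuple n s e ` {..<n + k}"
    unfolding image_append_tuple ek using F(2) by blast
  from acl_mono[OF this, of L M] have "x \<in> acl L M (append_tuple n s e ` {..<n + k})"
    using F(3) by blast
  then show ?r unfolding acl_functional[OF pair_model[OF P] sub] small_at_def using e by blast
next
  assume ?r
  then obtain k \<kappa> e where x: "x \<in> universe M" "functional L (n + k) \<kappa>" and e: "e \<in> tuples E k"
    and sat: "sat M ((append_tuple n s e)(n + k := x)) \<kappa>"
    unfolding small_at_def by blast
  have sub: "append_tuple n s e ` {..<n + k} \<subseteq> universe M"
    unfolding image_append_tuple using s tuples_image[OF e] pair_subset[OF P] by blast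
  have "x \<in> acl L M (append_tuple n s e ` {..<n + k})"
    unfolding acl_functional[OF pair_model[OF P] sub] using x sat by blast
  moreover have "append_tuple n s e ` {..<n + k} \<subseteq> E \<union> s ` {..<n}"
    unfolding image_append_tuple using tuples_image[OF e] by blast
  ultimately show ?l using acl_mono by blast
qed

lemma tuples_sub: "E \<subseteq> U \<Longrightarrow> e \<in> tuples E k \<longleftrightarrow> e \<in> tuples U k \<and> (\<forall>j<k. e j \<in> E)"
  by (auto simp: tuples_def PiE_iff)

lemma small_formula:
  assumes "functional L (n + k) \<kappa>"
  shows "\<exists>\<phi>. wf_fm PL \<phi> \<and> fv \<phi> \<subseteq> {..n} \<and> (\<forall>M E v. E \<subseteq> universe M \<longrightarrow>
    (sat (pair_struct M E) v \<phi> \<longleftrightarrow> small_at M E n k \<kappa> v (v n)))"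
proof -
  let ?r = "\<lambda>i. if i < n then i else if i < n + k then Suc i else n"
  define Q where "Q = (\<lambda>(N :: ('u, 'u option, 'u) struct) w.
    (\<forall>j\<in>{..<k}. rel_of N None [w (Suc n + j)]) \<and> sat (reduct N) (\<lambda>i. w (?r i)) \<kappa>)"
  have "expr PL {..<Suc n + k} Q" unfolding Q_def
    by (intro expr_conj expr_ball expr_P expr_lift[OF expr_rename_sat] functional_wf[OF assms]) auto
  then have "expr PL {..<Suc n} (\<lambda>N v. \<exists>e\<in>tuples (universe N) k. Q N (append_tuple (Suc n) v e))"
    by (rule expr_ex_block)
  then obtain \<phi> where \<phi>: "wf_fm PL \<phi>" "fv \<phi> \<subseteq> {..<Suc n}"
    "\<And>N v. sat N v \<phi> = (\<exists>e\<in>tuples (universe N) k. Q N (append_tuple (Suc n) v e))"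
    unfolding expr_def by blast
  have "sat M (\<lambda>i. append_tuple (Suc n) v e (?r i)) \<kappa> =
    sat M ((append_tuple n v e)(n + k := v n)) \<kappa>" for M v and e :: "nat \<Rightarrow> 'u"
    by (rule sat_cong) (use functional_fv[OF assms] in \<open>auto simp: append_tuple_def\<close>)
  then have "sat (pair_struct M E) v \<phi> \<longleftrightarrow> small_at M E n k \<kappa> v (v n)" if "E \<subseteq> universe M" for M E v
    unfolding \<phi>(3) small_at_def Q_def Bex_def using tuples_sub[OF that, of _ k]
    by (auto simp: append_tuple_def)
  then show ?thesis using \<phi>(1,2) by (auto simp: lessThan_Suc_atMost)
qed

text \<open>One formula is fixed for each \<open>\<kappa>\<close>, so that sets of such formulas can
  be formed.\<close>

definition small_fm :: "nat \<Rightarrow> nat \<Rightarrow> 'u ufm \<Rightarrow> ('u, 'u option) fm" where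
  "small_fm n k \<kappa> = (SOME \<phi>. wf_fm PL \<phi> \<and> fv \<phi> \<subseteq> {..n} \<and> (\<forall>M E v. E \<subseteq> universe M \<longrightarrow>
    (sat (pair_struct M E) v \<phi> \<longleftrightarrow> small_at M E n k \<kappa> v (v n))))"

lemma small_fm:
  assumes "functional L (n + k) \<kappa>"
  shows "wf_fm PL (small_fm n k \<kappa>)" "fv (small_fm n k \<kappa>) \<subseteq> {..n}"
    "E \<subseteq> universe M \<Longrightarrow> sat (pair_struct M E) v (small_fm n k \<kappa>) \<longleftrightarrow> small_at M E n k \<kappa> v (v n)"
  using someI_ex[OF small_formula[OF assms]] unfolding small_fm_def by blast+

lemma acl_transfer:
  assumes M: "model M" and M': "model M'" and s: "range s \<subseteq> universe M" and s': "range s' \<subseteq> universe M'"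
    and eq: "eqtp L M s M' s' m" and I: "I \<subseteq> {..<m}" and i: "i < m" and acl: "s i \<in> acl L M (s ` I)"
  shows "s' i \<in> acl L M' (s' ` I)"
proof -
  have "finite I" using I finite_subset by blast
  then obtain \<rho> and n :: nat where \<rho>: "I = \<rho> ` {..<n}" by (rule finite_enum)
  have im: "t ` I = (\<lambda>j. t (\<rho> j)) ` {..<n}" for t :: "nat \<Rightarrow> 'u" unfolding \<rho> by auto
  have sub: "(\<lambda>j. s (\<rho> j)) ` {..<n} \<subseteq> universe M" "(\<lambda>j. s' (\<rho> j)) ` {..<n} \<subseteq> universe M'"
    using s s' by auto
  obtain \<kappa> where \<kappa>: "functional L n \<kappa>" "sat M ((\<lambda>j. s (\<rho> j))(n := s i)) \<kappa>"
    using acl unfolding im acl_functional[OF M sub(1)] by blast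
  let ?r = "\<lambda>j. if j = n then i else \<rho> j"
  have cong: "sat N ((\<lambda>j. t (\<rho> j))(n := t i)) \<kappa> = sat N (\<lambda>j. t (?r j)) \<kappa>" for N and t :: "nat \<Rightarrow> 'u"
    by (rule sat_cong) simp
  have "expr L {..<m} (\<lambda>N t. sat N (\<lambda>j. t (?r j)) \<kappa>)"
  proof (rule expr_rename_sat[OF functional_wf[OF \<kappa>(1)]], rule image_subsetI)
    fix j assume "j \<in> fv \<kappa>"
    then have "j = n \<or> j < n" using functional_fv[OF \<kappa>(1)] by force
    then show "?r j \<in> {..<m}" using i I unfolding \<rho> by auto
  qed
  from eqtp_expr[OF eq this] have "sat M' ((\<lambda>j. s' (\<rho> j))(n := s' i)) \<kappa>"
    using \<kappa>(2) unfolding cong by simp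
  moreover have "s' i \<in> universe M'" using s' by auto
  ultimately show ?thesis unfolding im acl_functional[OF M' sub(2)] using \<kappa>(1) by blast
qed

text \<open>J and K are the positions of the generators inside and outside E.\<close>

definition good :: "'u ustruct \<Rightarrow> 'u set \<Rightarrow> (nat \<Rightarrow> 'u) \<Rightarrow> nat \<Rightarrow> nat set \<Rightarrow> nat set \<Rightarrow> bool" where
  "good M E s m J K \<longleftrightarrow> pair M E \<and> range s \<subseteq> universe M \<and> (\<forall>i<m.
     (i \<in> J \<longrightarrow> s i \<in> E) \<and> (i \<in> K \<longrightarrow> s i \<notin> acl L M (E \<union> s ` {..<i})) \<and>
     (i \<notin> J \<longrightarrow> i \<notin> K \<longrightarrow> s i \<in> acl L M (s ` {..<i})))"

lemma good_pair: "good M E s m J K \<Longrightarrow> pair M E"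
  and good_range: "good M E s m J K \<Longrightarrow> range s \<subseteq> universe M"
  and good_mono: "good M E s m J K \<Longrightarrow> n \<le> m \<Longrightarrow> good M E s n J K"
  by (auto simp: good_def)

lemma image_cong_less: "(\<And>i. i < m \<Longrightarrow> t i = s i) \<Longrightarrow> i \<le> m \<Longrightarrow> t ` {..<i} = s ` {..<i :: nat}"
  by (rule image_cong) auto

lemma good_cong:
  assumes "good M E s m J K" "range t \<subseteq> universe M" "\<And>i. i < m \<Longrightarrow> t i = s i"
    "\<And>i. i < m \<Longrightarrow> i \<in> J' \<longleftrightarrow> i \<in> J" "\<And>i. i < m \<Longrightarrow> i \<in> K' \<longleftrightarrow> i \<in> K"
  shows "good M E t m J' K'"
  using assms image_cong_less[of m t s] by (simp add: good_def)

text \<open>By induction on the length. A generator inside \<open>E\<close> is moved into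
  \<open>B\<close>. A generator outside \<open>E\<close> cannot help to reach an element
  \<open>x\<close> of \<open>E\<close>, since by exchange it would be algebraic over
  \<open>x\<close> and its predecessors. A dependent entry does not change the closure.\<close>

lemma good_acl:
  assumes "good M E s m J K" "B \<subseteq> E"
  shows "acl L M (B \<union> s ` {..<m}) \<inter> E \<subseteq> acl L M (B \<union> s ` (J \<inter> {..<m}))"
  using assms
proof (induction m arbitrary: B)
  case (Suc m)
  have P: "pair M E" and s: "range s \<subseteq> universe M" and good: "good M E s m J K"
    using Suc.prems good_pair good_range good_mono[of M E s "Suc m" J K m] by auto
  interpret pregeometry "universe M" "acl L M" by (rule acl_pregeometry[OF pair_model[OF P]])
  have EU: "E \<subseteq> universe M" and BU: "B \<subseteq> universe M" using pair_subset[OF P] Suc.prems by auto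
  have sub: "B \<union> s ` {..<m} \<subseteq> universe M" using BU s by auto
  have Sucm: "B \<union> s ` {..<Suc m} = insert (s m) (B \<union> s ` {..<m})" by (auto simp: lessThan_Suc)
  have mono: "acl L M (B \<union> s ` (J \<inter> {..<m})) \<subseteq> acl L M (B \<union> s ` (J \<inter> {..<Suc m}))"
    by (rule acl_mono) auto
  consider (J) "m \<in> J" | (K) "m \<in> K" "m \<notin> J" | (D) "m \<notin> K" "m \<notin> J" by blast
  then show ?case
  proof cases
    case J
    have "insert (s m) B \<subseteq> E" using J Suc.prems by (auto simp: good_def)
    from Suc.IH[OF good this] have "acl L M (insert (s m) B \<union> s ` {..<m}) \<inter> E \<subseteq>
      acl L M (insert (s m) B \<union> s ` (J \<inter> {..<m}))" .
    moreover have "insert (s m) B \<union> s ` (J \<inter> {..<m}) = B \<union> s ` (J \<inter> {..<Suc m})"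
      using J by (auto simp: lessThan_Suc)
    ultimately show ?thesis unfolding Sucm by simp
  next
    case K
    have sm: "s m \<notin> acl L M (E \<union> s ` {..<m})" using K Suc.prems by (auto simp: good_def)
    have "x \<in> acl L M (B \<union> s ` {..<m})" if x: "x \<in> acl L M (insert (s m) (B \<union> s ` {..<m}))" "x \<in> E" for x
    proof (rule ccontr)
      assume "x \<notin> acl L M (B \<union> s ` {..<m})"
      then have "s m \<in> acl L M (insert x (B \<union> s ` {..<m}))"
        using cl_exchange[OF sub] x EU s by blast
      moreover have "insert x (B \<union> s ` {..<m}) \<subseteq> E \<union> s ` {..<m}" using x(2) Suc.prems by auto
      ultimately show False using sm acl_mono by blast
    qed
    then show ?thesis unfolding Sucm using Suc.IH[OF good Suc.prems(2)] mono by blast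
  next
    case D
    have "s m \<in> acl L M (s ` {..<m})" using D Suc.prems by (auto simp: good_def)
    then have "s m \<in> acl L M (B \<union> s ` {..<m})" using acl_mono[of "s ` {..<m}" "B \<union> s ` {..<m}"] by blast
    then have "insert (s m) (B \<union> s ` {..<m}) \<subseteq> acl L M (B \<union> s ` {..<m})" using cl_incr[OF sub] by blast
    from cl_trans[OF sub this] show ?thesis
      unfolding Sucm using Suc.IH[OF good Suc.prems(2)] mono by blast
  qed
qed simp

text \<open>All three clauses are visible in the type over the pair language. For a generator
  outside \<open>E\<close>, a formula making the new entry algebraic over \<open>E'\<close> and its
  predecessors would have to hold of the old entry as well.\<close>

lemma good_transfer:
  assumes g: "good M E s m J K" and P': "pair M' E'" and s': "range s' \<subseteq> universe M'"
    and eq: "eqtp PL (pair_struct M E) s (pair_struct M' E') s' m"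
  shows "good M' E' s' m J K"
  unfolding good_def
proof (intro conjI P' s' allI impI)
  have P: "pair M E" and s: "range s \<subseteq> universe M" using good_pair[OF g] good_range[OF g] .
  fix i assume i: "i < m"
  show "s' i \<in> E'" if "i \<in> J"
    using eqtp_expr[OF eq expr_P[of i]] i that g by (simp add: good_def)
  show "s' i \<in> acl L M' (s' ` {..<i})" if "i \<notin> J" "i \<notin> K"
    by (rule acl_transfer[OF pair_model[OF P] pair_model[OF P'] s s' eqtp_reduct[OF eq]])
      (use i that g in \<open>auto simp: good_def\<close>)
  show "s' i \<notin> acl L M' (E' \<union> s' ` {..<i})" if K: "i \<in> K"
  proof
    have sub: "s ` {..<i} \<subseteq> universe M" "s' ` {..<i} \<subseteq> universe M'" using s s' by auto
    assume "s' i \<in> acl L M' (E' \<union> s' ` {..<i})"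
    then obtain k \<kappa> where \<kappa>: "functional L (i + k) \<kappa>" "small_at M' E' i k \<kappa> s' (s' i)"
      unfolding acl_over[OF P' sub(2)] by blast
    have "expr PL {..<m} (\<lambda>N v. sat N v (small_fm i k \<kappa>))"
      using small_fm(1,2)[OF \<kappa>(1)] i by (intro expr_sat) auto
    from eqtp_expr[OF eq this] have "small_at M E i k \<kappa> s (s i)"
      using \<kappa>(2) small_fm(3)[OF \<kappa>(1) pair_subset[OF P]] small_fm(3)[OF \<kappa>(1) pair_subset[OF P']] by simp
    moreover have "s i \<in> universe M" using s by auto
    ultimately have "s i \<in> acl L M (E \<union> s ` {..<i})" unfolding acl_over[OF P sub(1)] using \<kappa>(1) by blast
    then show False using g i K by (simp add: good_def)
  qed
qed

text \<open>Goodness up to \<open>m\<close> says nothing about \<open>m\<close> itself belonging to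
  \<open>J\<close> or \<open>K\<close>; the set operations fix this for the new entry.\<close>

lemma good_add:
  assumes g: "good M E s m J K" and t: "range t \<subseteq> universe M" "\<And>i. i < m \<Longrightarrow> t i = s i"
  shows "t m \<in> acl L M (s ` {..<m}) \<Longrightarrow> good M E t (Suc m) (J - {m}) (K - {m})"
    and "t m \<in> E \<Longrightarrow> good M E t (Suc m) (insert m J) (K - {m})"
    and "t m \<notin> acl L M (E \<union> s ` {..<m}) \<Longrightarrow> good M E t (Suc m) (J - {m}) (insert m K)"
proof -
  have im: "t ` {..<i} = s ` {..<i}" if "i \<le> m" for i
    by (rule image_cong_less[of m]) (use that t(2) in auto)
  have gi: "(i \<in> J \<longrightarrow> t i \<in> E) \<and> (i \<in> K \<longrightarrow> t i \<notin> acl L M (E \<union> t ` {..<i})) \<and>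
     (i \<notin> J \<longrightarrow> i \<notin> K \<longrightarrow> t i \<in> acl L M (t ` {..<i}))" if "i < m" for i
    using g im[of i] t(2)[OF that] that by (simp add: good_def)
  note P = good_pair[OF g]
  show "good M E t (Suc m) (J - {m}) (K - {m})" if "t m \<in> acl L M (s ` {..<m})"
    unfolding good_def less_Suc_eq using P t(1) gi im[of m] that by auto
  show "good M E t (Suc m) (insert m J) (K - {m})" if "t m \<in> E"
    unfolding good_def less_Suc_eq using P t(1) gi im[of m] that by auto
  show "good M E t (Suc m) (J - {m}) (insert m K)" if "t m \<notin> acl L M (E \<union> s ` {..<m})"
    unfolding good_def less_Suc_eq using P t(1) gi im[of m] that by auto
qed

text \<open>Only generators are added, and those inside \<open>E\<close> must also be independent of
  their predecessors. This makes the added entries an independent sequence, which can later be moved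
  inside open sets.\<close>

definition ext :: "'u ustruct \<Rightarrow> 'u set \<Rightarrow> (nat \<Rightarrow> 'u) \<Rightarrow> nat \<Rightarrow> nat set \<Rightarrow> nat set
    \<Rightarrow> (nat \<Rightarrow> 'u) \<Rightarrow> nat \<Rightarrow> nat set \<Rightarrow> nat set \<Rightarrow> bool" where
  "ext M E s m J K s' m' J' K' \<longleftrightarrow> m \<le> m' \<and> good M E s' m' J' K' \<and>
     (\<forall>i<m. s' i = s i \<and> (i \<in> J' \<longleftrightarrow> i \<in> J) \<and> (i \<in> K' \<longleftrightarrow> i \<in> K)) \<and>
     (\<forall>i. m \<le> i \<and> i < m' \<longrightarrow> i \<in> J' \<union> K' \<and> s' i \<notin> acl L M (s' ` {..<i}))"

lemma ext_refl: "good M E s m J K \<Longrightarrow> ext M E s m J K s m J K"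
  by (auto simp: ext_def)

lemma ext_good: "ext M E s m J K s' m' J' K' \<Longrightarrow> good M E s' m' J' K'"
  by (simp add: ext_def)

lemma ext_trans:
  assumes 1: "ext M E s m J K s' m' J' K'" and 2: "ext M E s' m' J' K' s'' m'' J'' K''"
  shows "ext M E s m J K s'' m'' J'' K''"
proof -
  have "i \<in> J'' \<union> K'' \<and> s'' i \<notin> acl L M (s'' ` {..<i})" if i: "m \<le> i" "i < m''" for i
  proof (cases "i < m'")
    case True
    have "s'' ` {..<i} = s' ` {..<i}" by (rule image_cong_less[of m']) (use 2 True in \<open>auto simp: ext_def\<close>)
    then show ?thesis using 1 2 i True by (simp add: ext_def)
  next
    case False
    then show ?thesis using 2 i by (simp add: ext_def)
  qed
  then show ?thesis using 1 2 by (simp add: ext_def)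
qed

lemma ext_acl:
  assumes "ext M E s m J K s' m' J' K'"
  shows "acl L M (s ` {..<m}) \<subseteq> acl L M (s' ` {..<m'})"
proof -
  have "s ` {..<m} = s' ` {..<m}" by (rule image_cong_less[of m]) (use assms in \<open>auto simp: ext_def\<close>)
  moreover have "s' ` {..<m} \<subseteq> s' ` {..<m'}"
    by (rule image_mono) (use assms in \<open>auto simp: ext_def\<close>)
  ultimately show ?thesis using acl_mono by simp
qed

lemma ext_in:
  assumes g: "good M E s m J K" and F: "finite F" "F \<subseteq> E"
  shows "\<exists>s' m' J' K'. ext M E s m J K s' m' J' K' \<and> F \<subseteq> acl L M (s' ` {..<m'})"
  using F
proof (induction F rule: finite_induct)
  case empty
  then show ?case using ext_refl[OF g] by blast
next
  case (insert x F)
  then obtain s1 m1 J1 K1 where 1: "ext M E s m J K s1 m1 J1 K1" "F \<subseteq> acl L M (s1 ` {..<m1})" by blast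
  have g1: "good M E s1 m1 J1 K1" using 1(1) by (rule ext_good)
  have x: "x \<in> E" "x \<in> universe M" using insert.prems pair_subset[OF good_pair[OF g]] by auto
  show ?case
  proof (cases "x \<in> acl L M (s1 ` {..<m1})")
    case True
    then show ?thesis using 1 by blast
  next
    case False
    define t where "t = s1(m1 := x)"
    have t: "\<And>i. i < m1 \<Longrightarrow> t i = s1 i" "t m1 = x" by (simp_all add: t_def)
    have rt: "range t \<subseteq> universe M" unfolding t_def by (rule range_upd[OF good_range[OF g1] x(2)])
    have im: "t ` {..<m1} = s1 ` {..<m1}" by (rule image_cong_less[of m1]) (use t in auto)
    have 2: "ext M E s1 m1 J1 K1 t (Suc m1) (insert m1 J1) (K1 - {m1})"
      using good_add(2)[OF g1 rt t(1)] False im x t by (auto simp: ext_def less_Suc_eq)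
    have "t ` {..<Suc m1} \<subseteq> acl L M (t ` {..<Suc m1})" by (rule acl_incr) (use rt in auto)
    then have "x \<in> acl L M (t ` {..<Suc m1})" using t(2) by auto
    then show ?thesis using ext_trans[OF 1(1) 2] ext_acl[OF 2] 1(2) by blast
  qed
qed

text \<open>If \<open>x\<close> is algebraic over \<open>E\<close> and the tuple, then it suffices
  to add the finitely many parameters from \<open>E\<close> that are involved; otherwise
  \<open>x\<close> itself is a generator outside \<open>E\<close>.\<close>

lemma ext_one:
  assumes g: "good M E s m J K" and x: "x \<in> universe M"
  shows "\<exists>s' m' J' K'. ext M E s m J K s' m' J' K' \<and> x \<in> acl L M (s' ` {..<m'})"
proof (cases "x \<in> acl L M (E \<union> s ` {..<m})")
  case True
  have sM: "s ` {..<m} \<subseteq> universe M" using good_range[OF g] by auto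
  obtain k \<kappa> where \<kappa>: "functional L (m + k) \<kappa>" "small_at M E m k \<kappa> s x"
    using True unfolding acl_over[OF good_pair[OF g] sM] by blast
  then obtain e where e: "e \<in> tuples E k" "sat M ((append_tuple m s e)(m + k := x)) \<kappa>"
    by (auto simp: small_at_def)
  have eE: "e ` {..<k} \<subseteq> E" using e(1) by (rule tuples_image)
  obtain s1 m1 J1 K1 where 1: "ext M E s m J K s1 m1 J1 K1" "e ` {..<k} \<subseteq> acl L M (s1 ` {..<m1})"
    using ext_in[OF g _ eE] by blast
  have sub: "append_tuple m s e ` {..<m + k} \<subseteq> universe M"
    unfolding image_append_tuple using sM eE pair_subset[OF good_pair[OF g]] by blast
  have "x \<in> acl L M (append_tuple m s e ` {..<m + k})"
    unfolding acl_functional[OF pair_model[OF good_pair[OF g]] sub] using x e \<kappa> by blast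
  moreover have "append_tuple m s e ` {..<m + k} \<subseteq> acl L M (s1 ` {..<m1})"
    unfolding image_append_tuple using 1(2) acl_incr[OF sM, of L] ext_acl[OF 1(1)] by blast
  moreover have "s1 ` {..<m1} \<subseteq> universe M" using good_range[OF ext_good[OF 1(1)]] by auto
  ultimately have "x \<in> acl L M (s1 ` {..<m1})"
    using pregeometry.cl_trans[OF acl_pregeometry[OF pair_model[OF good_pair[OF g]]]] by blast
  then show ?thesis using 1(1) by blast
next
  case False
  define t where "t = s(m := x)"
  have t: "\<And>i. i < m \<Longrightarrow> t i = s i" "t m = x" by (simp_all add: t_def)
  have rt: "range t \<subseteq> universe M" unfolding t_def by (rule range_upd[OF good_range[OF g] x])
  have im: "t ` {..<m} = s ` {..<m}" by (rule image_cong_less[of m]) (use t in auto)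
  have "x \<notin> acl L M (s ` {..<m})" using False acl_mono[of "s ` {..<m}" "E \<union> s ` {..<m}"] by blast
  then have 2: "ext M E s m J K t (Suc m) (J - {m}) (insert m K)"
    using good_add(3)[OF g rt t(1)] False im t by (auto simp: ext_def less_Suc_eq)
  have "t ` {..<Suc m} \<subseteq> acl L M (t ` {..<Suc m})" by (rule acl_incr) (use rt in auto)
  then have "x \<in> acl L M (t ` {..<Suc m})" using t(2) by auto
  then show ?thesis using 2 by blast
qed

lemma ext_finite:
  assumes g: "good M E s m J K" and Y: "finite Y" "Y \<subseteq> universe M"
  shows "\<exists>s' m' J' K'. ext M E s m J K s' m' J' K' \<and> Y \<subseteq> acl L M (s' ` {..<m'})"
  using Y
proof (induction Y rule: finite_induct)
  case empty
  then show ?case using ext_refl[OF g] by blast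
next
  case (insert x F)
  then obtain s1 m1 J1 K1 where 1: "ext M E s m J K s1 m1 J1 K1" "F \<subseteq> acl L M (s1 ` {..<m1})" by blast
  have x: "x \<in> universe M" using insert.prems by simp
  obtain s2 m2 J2 K2 where 2: "ext M E s1 m1 J1 K1 s2 m2 J2 K2" "x \<in> acl L M (s2 ` {..<m2})"
    using ext_one[OF ext_good[OF 1(1)] x] by blast
  show ?case using ext_trans[OF 1(1) 2(1)] 1(2) 2(2) ext_acl[OF 2(1)] by blast
qed

lemma eqtp_add:
  assumes eq: "eqtp L M s M' s' m" and \<phi>: "wf_fm L \<phi>" "fv \<phi> \<subseteq> {..m}"
    and x: "{y \<in> universe M. sat M (s(m := y)) \<phi>} = {x}"
    and x': "{y \<in> universe M'. sat M' (s'(m := y)) \<phi>} = {x'}"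
  shows "eqtp L M (s(m := x)) M' (s'(m := x')) (Suc m)"
proof (rule eqtpI)
  fix Q assume Q: "expr L {..<Suc m} Q" "Q M (s(m := x))"
  have "expr L {..<m} (\<lambda>N v. \<exists>y\<in>universe N. sat N (v(m := y)) \<phi> \<and> Q N (v(m := y)))"
    by (rule expr_ex_last, intro expr_conj expr_sat \<phi> Q(1)) (use \<phi>(2) in \<open>simp add: lessThan_Suc_atMost\<close>)
  from eqtp_expr[OF eq this] have
    "(\<exists>y\<in>{y \<in> universe M. sat M (s(m := y)) \<phi>}. Q M (s(m := y))) =
     (\<exists>y\<in>{y \<in> universe M'. sat M' (s'(m := y)) \<phi>}. Q M' (s'(m := y)))" by auto
  then show "Q M' (s'(m := x'))" unfolding x x' using Q(2) by simp
qed

text \<open>An algebraic element is defined by a functional formula, so its type over the tuple is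
  determined, and the same formula has a solution on the other side.\<close>

lemma eqtp_acl:
  assumes M: "model M" and M': "model M'" and s: "range s \<subseteq> universe M" and s': "range s' \<subseteq> universe M'"
    and eq: "eqtp L M s M' s' m" and x: "x \<in> acl L M (s ` {..<m})"
  obtains x' where "x' \<in> acl L M' (s' ` {..<m})" "eqtp L M (s(m := x)) M' (s'(m := x')) (Suc m)"
proof -
  have sub: "s ` {..<m} \<subseteq> universe M" "s' ` {..<m} \<subseteq> universe M'" using s s' by auto
  obtain \<kappa> where \<kappa>: "functional L m \<kappa>" "sat M (s(m := x)) \<kappa>" and xM: "x \<in> universe M"
    using x unfolding acl_functional[OF M sub(1)] by blast
  have "expr L {..<m} (\<lambda>N v. \<exists>y\<in>universe N. sat N (v(m := y)) \<kappa>)"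
    by (rule expr_ex_last, rule expr_sat)
      (use functional_wf[OF \<kappa>(1)] functional_fv[OF \<kappa>(1)] in \<open>simp_all add: lessThan_Suc_atMost\<close>)
  from eqtp_expr[OF eq this] obtain x' where x': "x' \<in> universe M'" "sat M' (s'(m := x')) \<kappa>"
    using \<kappa>(2) xM by blast
  have "{y \<in> universe N. sat N (v(m := y)) \<kappa>} = {z}"
    if "z \<in> universe N" "sat N (v(m := z)) \<kappa>" for N :: "'u ustruct" and v z
    using functional_unique[OF \<kappa>(1), of N v _ z] that by blast
  from eqtp_add[OF eq functional_wf[OF \<kappa>(1)] functional_fv[OF \<kappa>(1)] this[OF xM \<kappa>(2)] this[OF x']]
  have "eqtp L M (s(m := x)) M' (s'(m := x')) (Suc m)" .
  moreover have "x' \<in> acl L M' (s' ` {..<m})" unfolding acl_functional[OF M' sub(2)] using x' \<kappa>(1) by blast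
  ultimately show thesis using that by blast
qed

end

section \<open>Realizing types in extensions\<close>

context geometric
begin

text \<open>The conditions that make entry \<open>n\<close> a generator of the prescribed kind.
  Inside \<open>E\<close> they also forbid algebraicity over the preceding entries, which
  \<open>good\<close> alone does not.\<close>

definition req :: "nat set \<Rightarrow> nat \<Rightarrow> ('u, 'u option) fm set" where
  "req J n = (if n \<in> J
     then insert (Rel None [Var n]) ((\<lambda>\<kappa>. Neg (lift \<kappa>)) ` {\<kappa>. functional L n \<kappa>})
     else (\<lambda>(k, \<kappa>). Neg (small_fm n k \<kappa>)) ` {(k, \<kappa>). functional L (n + k) \<kappa>})"

text \<open>That E is small in every open set is only available once extensions with many independent
  elements of E have been constructed; hence it is an assumption of the next lemmas.\<close>

definition thick :: "'u ustruct \<Rightarrow> 'u set \<Rightarrow> bool" where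
  "thick M E \<longleftrightarrow> (\<forall>V v n F. openin (top_of M) V \<longrightarrow> V \<noteq> {} \<longrightarrow> range v \<subseteq> universe M \<longrightarrow>
     finite F \<longrightarrow> (\<forall>(k, \<kappa>)\<in>F. functional L (n + k) \<kappa>) \<longrightarrow>
     (\<exists>x\<in>V. \<forall>(k, \<kappa>)\<in>F. \<not> small_at M E n k \<kappa> v x))"

lemma thickD:
  assumes "thick M E" "openin (top_of M) V" "V \<noteq> {}" "range v \<subseteq> universe M" "finite F"
    "\<forall>(k, \<kappa>)\<in>F. functional L (n + k) \<kappa>"
  shows "\<exists>x\<in>V. \<forall>(k, \<kappa>)\<in>F. \<not> small_at M E n k \<kappa> v x"
  using assms(1)[unfolded thick_def, rule_format, OF assms(2-5)] assms(6) by simp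

lemma req_wf_fv: "\<phi> \<in> req J n \<Longrightarrow> wf_fm PL \<phi> \<and> fv \<phi> \<subseteq> {..n}"
  using small_fm(1,2) functional_wf functional_fv
  by (fastforce simp: req_def split: if_splits)

text \<open>Inside \<open>E\<close>, each of finitely many functional formulas excludes at most one
  element, while an open set contains infinitely many elements of \<open>E\<close>. Outside
  \<open>E\<close>, this is what thickness says.\<close>

lemma req_choice:
  assumes P: "pair M E" and v: "range v \<subseteq> universe M" and V: "openin (top_of M) V" "V \<noteq> {}"
    and \<Delta>: "finite \<Delta>" "\<Delta> \<subseteq> req J n" and thick: "n \<notin> J \<Longrightarrow> thick M E"
  shows "\<exists>x\<in>V. \<forall>\<phi>\<in>\<Delta>. sat (pair_struct M E) (v(n := x)) \<phi>"
proof (cases "n \<in> J")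
  case True
  let ?f = "\<lambda>\<kappa>. Neg (lift \<kappa>) :: ('u, 'u option) fm"
  have sub: "\<Delta> - {Rel None [Var n]} \<subseteq> ?f ` {\<kappa>. functional L n \<kappa>}"
    using \<Delta>(2) True by (auto simp: req_def)
  have fin: "finite (\<Delta> - {Rel None [Var n]})" using \<Delta>(1) by simp
  obtain C where C: "C \<subseteq> {\<kappa>. functional L n \<kappa>}" "finite C" "\<Delta> - {Rel None [Var n]} = ?f ` C"
    using finite_subset_image[OF fin sub] by blast
  have "finite (\<Union>\<kappa>\<in>C. {x \<in> universe M. sat M (v(n := x)) \<kappa>})"
  proof (intro finite_UN_I C(2))
    fix \<kappa> assume "\<kappa> \<in> C"
    then have \<kappa>: "functional L n \<kappa>" using C(1) by blast
    have "\<exists>a. {x \<in> universe M. sat M (v(n := x)) \<kappa>} \<subseteq> {a}"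
      using functional_unique[OF \<kappa>, of M v] by blast
    then show "finite {x \<in> universe M. sat M (v(n := x)) \<kappa>}" using finite_subset by blast
  qed
  then have "\<not> V \<inter> E \<subseteq> (\<Union>\<kappa>\<in>C. {x \<in> universe M. sat M (v(n := x)) \<kappa>})"
    using pair_meets[OF P V] finite_subset by blast
  then obtain x where x: "x \<in> V" "x \<in> E" "\<And>\<kappa>. \<kappa> \<in> C \<Longrightarrow> \<not> sat M (v(n := x)) \<kappa>"
    using pair_subset[OF P] by blast
  have "sat (pair_struct M E) (v(n := x)) \<phi>" if \<phi>: "\<phi> \<in> \<Delta>" for \<phi>
  proof (cases "\<phi> = Rel None [Var n]")
    case True
    then show ?thesis using x(2) by simp
  next
    case False
    then obtain \<kappa> where "\<kappa> \<in> C" "\<phi> = ?f \<kappa>" using C(3) \<phi> by blast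
    then show ?thesis using x(3) by simp
  qed
  then show ?thesis using x(1) by blast
next
  case False
  let ?f = "\<lambda>(k, \<kappa>). Neg (small_fm n k \<kappa>)"
  have sub: "\<Delta> \<subseteq> ?f ` {(k, \<kappa>). functional L (n + k) \<kappa>}" using \<Delta>(2) False by (simp add: req_def)
  obtain C where C: "C \<subseteq> {(k, \<kappa>). functional L (n + k) \<kappa>}" "finite C" "\<Delta> = ?f ` C"
    using finite_subset_image[OF \<Delta>(1) sub] by blast
  have "\<forall>(k, \<kappa>)\<in>C. functional L (n + k) \<kappa>" using C(1) by blast
  from thickD[OF thick[OF False] V v C(2) this]
  obtain x where x: "x \<in> V" "\<forall>(k, \<kappa>)\<in>C. \<not> small_at M E n k \<kappa> v x" by blast
  have app: "append_tuple n (v(n := x)) e = append_tuple n v e" for e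
    by (auto simp: append_tuple_def)
  have "sat (pair_struct M E) (v(n := x)) \<phi>" if \<phi>: "\<phi> \<in> \<Delta>" for \<phi>
  proof -
    obtain k \<kappa> where \<kappa>: "(k, \<kappa>) \<in> C" "\<phi> = Neg (small_fm n k \<kappa>)" using C(3) \<phi> by auto
    then have "functional L (n + k) \<kappa>" using C(1) by blast
    from small_fm(3)[OF this pair_subset[OF P]] show ?thesis
      using x(2) \<kappa> by (auto simp: small_at_def app)
  qed
  then show ?thesis using x(1) by blast
qed

text \<open>Entries are chosen from left to right: a requirement on an entry mentions no later
  variable, so later choices cannot destroy it.\<close>

lemma req_sequence:
  assumes P: "pair M E" and s: "range s \<subseteq> universe M" and \<Delta>: "finite \<Delta>"
    and V: "\<And>i. i < r \<Longrightarrow> openin (top_of M) (V i) \<and> V i \<noteq> {}"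
    and thick: "\<And>i. i < r \<Longrightarrow> m + i \<notin> J \<Longrightarrow> thick M E"
  shows "\<exists>v. range v \<subseteq> universe M \<and> (\<forall>i<m. v i = s i) \<and> (\<forall>i<r. v (m + i) \<in> V i) \<and>
    (\<forall>i<r. \<forall>\<phi>\<in>\<Delta> \<inter> req J (m + i). sat (pair_struct M E) v \<phi>)"
  using V thick
proof (induction r)
  case 0
  then show ?case using s by auto
next
  case (Suc r)
  have "\<exists>v. range v \<subseteq> universe M \<and> (\<forall>i<m. v i = s i) \<and> (\<forall>i<r. v (m + i) \<in> V i) \<and>
    (\<forall>i<r. \<forall>\<phi>\<in>\<Delta> \<inter> req J (m + i). sat (pair_struct M E) v \<phi>)"
    by (rule Suc.IH) (use Suc.prems less_SucI in blast)+
  then obtain v where v: "range v \<subseteq> universe M" "\<forall>i<m. v i = s i" "\<forall>i<r. v (m + i) \<in> V i"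
    "\<forall>i<r. \<forall>\<phi>\<in>\<Delta> \<inter> req J (m + i). sat (pair_struct M E) v \<phi>" by blast
  have Vr: "openin (top_of M) (V r)" "V r \<noteq> {}" using Suc.prems(1)[of r] by auto
  obtain x where x: "x \<in> V r" "\<forall>\<phi>\<in>\<Delta> \<inter> req J (m + r). sat (pair_struct M E) (v(m + r := x)) \<phi>"
    using req_choice[OF P v(1) Vr, of "\<Delta> \<inter> req J (m + r)" J "m + r"] \<Delta> Suc.prems(2)[of r] by auto
  have xM: "x \<in> universe M"
    using x(1) openin_subset[OF Vr(1)] topspace_top[OF pair_model[OF P]] by auto
  have old: "sat (pair_struct M E) (v(m + r := x)) \<phi>" if "i < r" "\<phi> \<in> \<Delta> \<inter> req J (m + i)" for i \<phi>
  proof -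
    have "sat (pair_struct M E) (v(m + r := x)) \<phi> = sat (pair_struct M E) v \<phi>"
      by (rule sat_cong) (use req_wf_fv[of \<phi> J "m + i"] that in force)
    then show ?thesis using v(4) that by blast
  qed
  show ?case
  proof (intro exI[of _ "v(m + r := x)"] conjI allI impI ballI)
    show "range (v(m + r := x)) \<subseteq> universe M" by (rule range_upd[OF v(1) xM])
    fix i assume i: "i < Suc r"
    show "(v(m + r := x)) (m + i) \<in> V i" using i v(3) x(1) by (auto simp: less_Suc_eq)
    show "sat (pair_struct M E) (v(m + r := x)) \<phi>" if "\<phi> \<in> \<Delta> \<inter> req J (m + i)" for \<phi>
      using i old[of i \<phi>] x(2) that by (cases "i = r") auto
  qed (use v(2) in auto)
qed

text \<open>If every finite part of \<open>\<Psi>\<close> holds on a box of nonempty open sets, then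
  its solution can be chosen in the box so as to meet finitely many requirements too; compactness
  realizes everything at once.\<close>

lemma realize:
  assumes P: "pair M E" and s: "range s \<subseteq> universe M"
    and \<Psi>: "\<And>\<phi>. \<phi> \<in> \<Psi> \<Longrightarrow> wf_fm PL \<phi>"
    and box: "\<And>\<Delta>. finite \<Delta> \<Longrightarrow> \<Delta> \<subseteq> \<Psi> \<Longrightarrow> \<exists>V. (\<forall>i<r. openin (top_of M) (V i) \<and> V i \<noteq> {}) \<and>
      (\<forall>v. range v \<subseteq> universe M \<longrightarrow> (\<forall>i<m. v i = s i) \<longrightarrow> (\<forall>i<r. v (m + i) \<in> V i) \<longrightarrow>
        (\<forall>\<phi>\<in>\<Delta>. sat (pair_struct M E) v \<phi>))"
    and thick: "\<And>i. i < r \<Longrightarrow> m + i \<notin> J \<Longrightarrow> thick M E"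
  obtains M' E' s' where "pair M' E'" "range s' \<subseteq> universe M'"
    "eqtp PL (pair_struct M E) s (pair_struct M' E') s' m"
    "\<And>\<phi>. \<phi> \<in> \<Psi> \<Longrightarrow> sat (pair_struct M' E') s' \<phi>"
    "\<And>i. i < r \<Longrightarrow> m + i \<in> J \<Longrightarrow> s' (m + i) \<in> E' \<and> s' (m + i) \<notin> acl L M' (s' ` {..<m + i})"
    "\<And>i. i < r \<Longrightarrow> m + i \<notin> J \<Longrightarrow> s' (m + i) \<notin> acl L M' (E' \<union> s' ` {..<m + i})"
proof -
  let ?\<Sigma> = "\<Psi> \<union> (\<Union>i<r. req J (m + i))"
  have wf: "wf_fm PL \<phi>" if "\<phi> \<in> ?\<Sigma>" for \<phi> using that \<Psi> req_wf_fv by blast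
  have fin: "\<exists>v. range v \<subseteq> universe M \<and> (\<forall>i<m. v i = s i) \<and> (\<forall>\<phi>\<in>\<Delta>. sat (pair_struct M E) v \<phi>)"
    if \<Delta>: "finite \<Delta>" "\<Delta> \<subseteq> ?\<Sigma>" for \<Delta>
  proof -
    have "finite (\<Delta> \<inter> \<Psi>)" "\<Delta> \<inter> \<Psi> \<subseteq> \<Psi>" using \<Delta> by auto
    from box[OF this] obtain V where V: "\<And>i. i < r \<Longrightarrow> openin (top_of M) (V i) \<and> V i \<noteq> {}"
      "\<And>v. range v \<subseteq> universe M \<Longrightarrow> \<forall>i<m. v i = s i \<Longrightarrow> \<forall>i<r. v (m + i) \<in> V i \<Longrightarrow>
        \<forall>\<phi>\<in>\<Delta> \<inter> \<Psi>. sat (pair_struct M E) v \<phi>" by blast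
    have "\<exists>v. range v \<subseteq> universe M \<and> (\<forall>i<m. v i = s i) \<and> (\<forall>i<r. v (m + i) \<in> V i) \<and>
      (\<forall>i<r. \<forall>\<phi>\<in>\<Delta> \<inter> req J (m + i). sat (pair_struct M E) v \<phi>)"
      by (rule req_sequence[OF P s \<Delta>(1) V(1) thick])
    then obtain v where v: "range v \<subseteq> universe M" "\<forall>i<m. v i = s i" "\<forall>i<r. v (m + i) \<in> V i"
      and req: "\<forall>i<r. \<forall>\<phi>\<in>\<Delta> \<inter> req J (m + i). sat (pair_struct M E) v \<phi>" by (elim exE conjE)
    have "sat (pair_struct M E) v \<phi>" if \<phi>: "\<phi> \<in> \<Delta>" for \<phi>
    proof (cases "\<phi> \<in> \<Psi>")
      case True
      then show ?thesis using V(2)[OF v] \<phi> by (simp add: Ball_def)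
    next
      case False
      then obtain i where "i < r" "\<phi> \<in> req J (m + i)" using \<Delta>(2) \<phi> by auto
      then show ?thesis using req \<phi> by (simp add: Ball_def)
    qed
    then show ?thesis using v(1,2) by (intro exI[of _ v]) simp
  qed
  show thesis
  proof (rule pair_extension[OF P s wf fin])
    fix M' E' s'
    assume P': "pair M' E'" and s': "range s' \<subseteq> universe M'"
      and eq: "eqtp PL (pair_struct M E) s (pair_struct M' E') s' m"
      and sat: "\<And>\<phi>. \<phi> \<in> ?\<Sigma> \<Longrightarrow> sat (pair_struct M' E') s' \<phi>"
    have sub: "s' ` {..<i} \<subseteq> universe M'" for i :: nat using s' by auto
    show thesis
    proof (rule that[OF P' s' eq])
      show "sat (pair_struct M' E') s' \<phi>" if "\<phi> \<in> \<Psi>" for \<phi> using sat that by blast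
    next
      fix i assume i: "i < r" "m + i \<in> J"
      have req: "sat (pair_struct M' E') s' \<phi>" if "\<phi> \<in> req J (m + i)" for \<phi> using sat that i(1) by blast
      have "s' (m + i) \<in> E'" using req[of "Rel None [Var (m + i)]"] i(2) by (simp add: req_def)
      moreover have "\<not> sat M' s' \<kappa>" if "functional L (m + i) \<kappa>" for \<kappa>
        using req[of "Neg (lift \<kappa>)"] i(2) that by (simp add: req_def)
      ultimately show "s' (m + i) \<in> E' \<and> s' (m + i) \<notin> acl L M' (s' ` {..<m + i})"
        unfolding acl_functional[OF pair_model[OF P'] sub] fun_upd_triv by blast
    next
      fix i assume i: "i < r" "m + i \<notin> J"
      have "\<not> small_at M' E' (m + i) k \<kappa> s' (s' (m + i))" if \<kappa>: "functional L (m + i + k) \<kappa>" for k \<kappa>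
      proof -
        have "Neg (small_fm (m + i) k \<kappa>) \<in> req J (m + i)" using i(2) \<kappa> by (auto simp: req_def)
        then have "sat (pair_struct M' E') s' (Neg (small_fm (m + i) k \<kappa>))" using sat i(1) by blast
        then show ?thesis using small_fm(3)[OF \<kappa> pair_subset[OF P']] by simp
      qed
      then show "s' (m + i) \<notin> acl L M' (E' \<union> s' ` {..<m + i})"
        unfolding acl_over[OF P' sub] by blast
    qed
  qed
qed

end

section \<open>Polynomials\<close>

context domain
begin

text \<open>Coefficients come in order of decreasing degree: \<open>x 0\<close> is the leading one
  and \<open>x (k - 1)\<close> the constant term.\<close>

fun horner :: "(nat \<Rightarrow> 'a) \<Rightarrow> 'a \<Rightarrow> nat \<Rightarrow> 'a" where
  "horner x z 0 = \<zero>"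
| "horner x z (Suc k) = x k \<oplus> z \<otimes> horner x z k"

lemma horner_closed: "(\<And>i. i < k \<Longrightarrow> x i \<in> carrier R) \<Longrightarrow> z \<in> carrier R \<Longrightarrow> horner x z k \<in> carrier R"
  by (induction k) auto

lemma horner_diff:
  assumes "\<And>i. i < k \<Longrightarrow> x i \<in> carrier R" "\<And>i. i < k \<Longrightarrow> y i \<in> carrier R" "z \<in> carrier R"
  shows "horner (\<lambda>i. x i \<ominus> y i) z k = horner x z k \<ominus> horner y z k"
  using assms
proof (induction k)
  case (Suc k)
  have "horner x z k \<in> carrier R" "horner y z k \<in> carrier R" "x k \<in> carrier R" "y k \<in> carrier R"
    using Suc.prems horner_closed[of k] by auto
  moreover from this have "z \<otimes> (horner x z k \<ominus> horner y z k) = z \<otimes> horner x z k \<ominus> z \<otimes> horner y z k"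
    using Suc.prems(3) by (simp add: minus_eq r_distr r_minus)
  ultimately show ?case using Suc by (simp add: minus_eq minus_add a_ac)
qed (simp add: minus_eq)

text \<open>Synthetic division by \<open>z - r\<close>: the intermediate values of Horner's scheme
  at \<open>r\<close> are the coefficients of the quotient, and the last value is the
  remainder.\<close>

lemma horner_divide:
  assumes "\<And>i. i < Suc k \<Longrightarrow> x i \<in> carrier R" "z \<in> carrier R" "r \<in> carrier R"
  shows "horner x z (Suc k) \<ominus> horner x r (Suc k) = (z \<ominus> r) \<otimes> horner (\<lambda>i. horner x r (Suc i)) z k"
  using assms(1)
proof (induction k)
  case 0
  then show ?case using assms(2,3) by (simp add: minus_eq r_neg)
next
  case (Suc k)
  let ?a = "horner x z (Suc k)" and ?b = "horner x r (Suc k)"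
  let ?q = "horner (\<lambda>i. horner x r (Suc i)) z k"
  have c: "?a \<in> carrier R" "?b \<in> carrier R" "x (Suc k) \<in> carrier R" "?q \<in> carrier R"
    using Suc.prems assms(2,3) by (auto intro!: horner_closed simp del: horner.simps)
  have "horner x z (Suc (Suc k)) \<ominus> horner x r (Suc (Suc k)) = z \<otimes> ?a \<ominus> r \<otimes> ?b"
    using c assms(2,3) unfolding horner.simps(2)[of x _ "Suc k"]
    by (simp add: minus_eq minus_add a_ac r_neg1 r_neg2 r_neg del: horner.simps)
  also have "\<dots> = z \<otimes> (?a \<ominus> ?b) \<oplus> (z \<ominus> r) \<otimes> ?b"
    using c assms(2,3) by (simp add: minus_eq r_distr l_distr r_minus l_minus a_assoc r_neg1 del: horner.simps)
  also have "?a \<ominus> ?b = (z \<ominus> r) \<otimes> ?q" by (rule Suc.IH) (use Suc.prems in auto)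
  also have "z \<otimes> ((z \<ominus> r) \<otimes> ?q) \<oplus> (z \<ominus> r) \<otimes> ?b = (z \<ominus> r) \<otimes> (?b \<oplus> z \<otimes> ?q)"
    using c assms(2,3) by (simp add: r_distr m_ac a_comm del: horner.simps)
  finally show ?case by (simp only: horner.simps(2)[of "\<lambda>i. horner x r (Suc i)"])
qed

lemma eq_of_minus_zero: "a \<in> carrier R \<Longrightarrow> b \<in> carrier R \<Longrightarrow> a \<ominus> b = \<zero> \<Longrightarrow> a = b"
  using minus_equality[of a "\<ominus> b"] by (simp add: minus_eq)

lemma finite_horner_roots:
  assumes "\<And>i. i < k \<Longrightarrow> x i \<in> carrier R" "\<exists>i<k. x i \<noteq> \<zero>"
  shows "finite {z \<in> carrier R. horner x z k = \<zero>}"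
  using assms
proof (induction k arbitrary: x)
  case (Suc k)
  show ?case
  proof (cases "\<exists>r\<in>carrier R. horner x r (Suc k) = \<zero>")
    case False
    then have "{z \<in> carrier R. horner x z (Suc k) = \<zero>} = {}" by blast
    then show ?thesis by (simp only: finite.emptyI)
  next
    case True
    then obtain r where r: "r \<in> carrier R" "horner x r (Suc k) = \<zero>" by blast
    let ?q = "\<lambda>i. horner x r (Suc i)"
    have q: "?q i \<in> carrier R" if "i < k" for i
      by (rule horner_closed) (use Suc.prems(1) that r in auto)
    \<comment> \<open>If all intermediate values at the root \<open>r\<close> vanish, then so does
      every \<open>x i\<close>, being such a value minus \<open>r\<close> times the preceding
      one.\<close>
    have "\<exists>i<k. ?q i \<noteq> \<zero>"
    proof (rule ccontr)
      assume "\<not> ?thesis"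
      then have zero: "horner x r i = \<zero>" if "i \<le> k" for i
        using that by (cases i) auto
      have "x i = \<zero>" if "i < Suc k" for i
      proof -
        have "horner x r (Suc i) = \<zero>" using zero[of "Suc i"] r(2) that by (cases "i = k") auto
        then show ?thesis using zero[of i] that Suc.prems(1)[OF that] r(1) by simp
      qed
      then show False using Suc.prems(2) by blast
    qed
    then have "finite {z \<in> carrier R. horner ?q z k = \<zero>}" by (intro Suc.IH q)
    moreover have "{z \<in> carrier R. horner x z (Suc k) = \<zero>} \<subseteq> insert r {z \<in> carrier R. horner ?q z k = \<zero>}"
    proof
      fix z assume "z \<in> {z \<in> carrier R. horner x z (Suc k) = \<zero>}"
      then have z: "z \<in> carrier R" "horner x z (Suc k) = \<zero>" by auto
      have "horner x z (Suc k) \<ominus> horner x r (Suc k) = (z \<ominus> r) \<otimes> horner ?q z k"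
        by (rule horner_divide[OF Suc.prems(1) z(1) r(1)])
      moreover have "\<zero> \<ominus> \<zero> = \<zero>" by (simp add: minus_eq)
      ultimately have "(z \<ominus> r) \<otimes> horner ?q z k = \<zero>" unfolding z(2) r(2) by (simp only:)
      then have "z \<ominus> r = \<zero> \<or> horner ?q z k = \<zero>"
        using z(1) r(1) horner_closed[of k ?q z] q by (intro integral) auto
      then show "z \<in> insert r {z \<in> carrier R. horner ?q z k = \<zero>}"
        using z(1) r(1) eq_of_minus_zero by blast
    qed
    ultimately show ?thesis using finite_subset by blast
  qed
qed simp

lemma finite_horner_eq:
  assumes x: "\<And>i. i < k \<Longrightarrow> x i \<in> carrier R" and y: "\<And>i. i < k \<Longrightarrow> y i \<in> carrier R"
    and ne: "i < k" "x i \<noteq> y i"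
  shows "finite {z \<in> carrier R. horner x z k = horner y z k}"
proof -
  have "x i \<ominus> y i \<noteq> \<zero>" using ne x[of i] y[of i] eq_of_minus_zero by blast
  then have "finite {z \<in> carrier R. horner (\<lambda>i. x i \<ominus> y i) z k = \<zero>}"
    using ne(1) x y by (intro finite_horner_roots) auto
  moreover have "horner (\<lambda>i. x i \<ominus> y i) z k = \<zero>" if "z \<in> carrier R" "horner x z k = horner y z k" for z
    using horner_diff[OF x y that(1)] that(2) horner_closed[of k y z] y that(1) by (simp add: minus_eq r_neg)
  then have "{z \<in> carrier R. horner x z k = horner y z k} \<subseteq> {z \<in> carrier R. horner (\<lambda>i. x i \<ominus> y i) z k = \<zero>}"
    by blast
  ultimately show ?thesis using finite_subset by blast
qed

end

lemma (in domain) horner_cong: "(\<And>i. i < k \<Longrightarrow> x i = y i) \<Longrightarrow> horner x z k = horner y z k"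
  by (induction k) auto

section \<open>E is small\<close>

context geometric
begin

abbreviation (input) poly :: "'u ustruct \<Rightarrow> (nat \<Rightarrow> 'u) \<Rightarrow> 'u \<Rightarrow> nat \<Rightarrow> 'u" where
  "poly M \<equiv> domain.horner (ring_of R M)"

fun poly_tm :: "nat \<Rightarrow> (nat \<Rightarrow> nat) \<Rightarrow> nat \<Rightarrow> 'u tm" where
  "poly_tm i r 0 = Fn (zero_sym R) []"
| "poly_tm i r (Suc k) = Fn (add_sym R) [Var (r k), Fn (mult_sym R) [Var i, poly_tm i r k]]"

lemma ring_symbols: "contains_ring_language L R"
  using geom by (simp add: geometric_theory_def)

lemma model_domain: "model M \<Longrightarrow> domain (ring_of R M)"
  using model_facts(4)[of M] by (simp add: topological_domain_def)

lemma ring_of_simps [simp]: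
  "carrier (ring_of R M) = universe M"
  "x \<otimes>\<^bsub>ring_of R M\<^esub> y = fun_of M (mult_sym R) [x, y]"
  "x \<oplus>\<^bsub>ring_of R M\<^esub> y = fun_of M (add_sym R) [x, y]"
  "\<zero>\<^bsub>ring_of R M\<^esub> = fun_of M (zero_sym R) []"
  by (simp_all add: ring_of_def)

lemma wf_poly_tm: "wf_tm L (poly_tm i r k)"
  using ring_symbols by (induction k) (auto simp: contains_ring_language_def)

lemma fv_poly_tm: "fv_tm (poly_tm i r k) \<subseteq> insert i (r ` {..<k})"
  by (induction k) (auto simp: lessThan_Suc)

lemma val_poly_tm:
  assumes "model M"
  shows "val M v (poly_tm i r k) = poly M (\<lambda>j. v (r j)) (v i) k"
proof -
  interpret domain "ring_of R M" by (rule model_domain[OF assms])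
  show ?thesis by (induction k) simp_all
qed

lemma poly_cong:
  "model M \<Longrightarrow> (\<And>i. i < k \<Longrightarrow> x i = y i) \<Longrightarrow> poly M x t k = poly M y t k"
  by (rule domain.horner_cong[OF model_domain])

lemma poly_closed:
  "model M \<Longrightarrow> (\<And>i. i < k \<Longrightarrow> x i \<in> universe M) \<Longrightarrow> t \<in> universe M \<Longrightarrow> poly M x t k \<in> universe M"
  using domain.horner_closed[OF model_domain, of M k x t] by simp

text \<open>The difference of the two polynomials is nonzero and has the root \<open>t\<close>. So
  \<open>t\<close> is algebraic over elements of \<open>E\<close>, hence in \<open>E\<close>. For
  \<open>t\<close> outside \<open>E\<close>, the value thus determines coefficients from
  \<open>E\<close>.\<close>

lemma poly_agree:
  assumes P: "pair M E" and t: "t \<in> universe M" and x: "\<And>j. j < k \<Longrightarrow> x j \<in> E" and y: "\<And>j. j < k \<Longrightarrow> y j \<in> E"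
    and i: "i < k" "x i \<noteq> y i" and eq: "poly M x t k = poly M y t k"
  shows "t \<in> E"
proof -
  note M = pair_model[OF P]
  let ?g = "\<lambda>l. if l < k then x l else y (l - k)"
  let ?\<phi> = "Equal (poly_tm (2 * k) (\<lambda>j. j) k) (poly_tm (2 * k) (\<lambda>j. k + j) k)"
  have xU: "\<And>j. j < k \<Longrightarrow> x j \<in> universe M" and yU: "\<And>j. j < k \<Longrightarrow> y j \<in> universe M"
    using x y pair_subset[OF P] by blast+
  have sat: "sat M (?g(2 * k := z)) ?\<phi> \<longleftrightarrow> poly M x z k = poly M y z k" for z
  proof -
    have "poly M (\<lambda>j. (?g(2 * k := z)) j) z k = poly M x z k" by (rule poly_cong[OF M]) simp
    moreover have "poly M (\<lambda>j. (?g(2 * k := z)) (k + j)) z k = poly M y z k" by (rule poly_cong[OF M]) simp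
    ultimately show ?thesis by (simp add: val_poly_tm[OF M])
  qed
  have "finite {z \<in> universe M. poly M x z k = poly M y z k}"
    using domain.finite_horner_eq[OF model_domain[OF M], of k x y i] xU yU i by simp
  moreover have "fv ?\<phi> \<subseteq> {..2 * k}"
    using fv_poly_tm[of "2 * k" "\<lambda>j. j" k] fv_poly_tm[of "2 * k" "\<lambda>j. k + j" k] by auto
  moreover have gE: "?g ` {..<2 * k} \<subseteq> E" using x y by auto
  moreover have "wf_fm L ?\<phi>" by (simp add: wf_poly_tm)
  ultimately have "t \<in> acl L M (?g ` {..<2 * k})"
    unfolding acl_last
    by (intro exI[of _ ?\<phi>] exI[of _ "2 * k"] exI[of _ ?g] conjI subset_refl) (use t eq in \<open>simp_all only: sat\<close>)
  then show ?thesis using pair_acl_closed[OF P gE] by blast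
qed

text \<open>By continuity at \<open>(v, 0)\<close> of the map from \<open>(u, z)\<close> to
  \<open>u + t z\<close>, the constant term may range near a point \<open>v\<close> of
  \<open>V\<close> as long as the rest is near 0, which the induction arranges. An empty sum is 0,
  whence the last hypothesis; it holds for the neighbourhood of 0 used in the induction.\<close>

lemma poly_open:
  assumes M: "model M" and t: "t \<in> universe M" and V: "openin (top_of M) V" "V \<noteq> {}"
    and 0: "k = 0 \<Longrightarrow> fun_of M (zero_sym R) [] \<in> V"
  shows "\<exists>W. (\<forall>j<k. openin (top_of M) (W j) \<and> W j \<noteq> {}) \<and>
    (\<forall>x. (\<forall>j<k. x j \<in> W j) \<longrightarrow> poly M x t k \<in> V)"
  using V 0
proof (induction k arbitrary: V)
  case 0
  interpret domain "ring_of R M" by (rule model_domain[OF M])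
  show ?case using 0 by simp
next
  case (Suc k)
  interpret domain "ring_of R M" by (rule model_domain[OF M])
  let ?X = "top_of M"
  let ?f = "\<lambda>(u, z). fun_of M (add_sym R) [u, fun_of M (mult_sym R) [t, z]]"
  obtain v where v: "v \<in> V" using Suc.prems by blast
  have top: "topspace ?X = universe M" by (rule topspace_top[OF M])
  have vU: "v \<in> universe M" using v openin_subset[OF Suc.prems(1)] top by auto
  have add: "continuous_map (prod_topology ?X ?X) ?X (\<lambda>(x, y). fun_of M (add_sym R) [x, y])"
    and mult: "continuous_map (prod_topology ?X ?X) ?X (\<lambda>(x, y). fun_of M (mult_sym R) [x, y])"
    using model_facts(4)[OF M] by (simp_all add: topological_domain_def)
  have "continuous_map (prod_topology ?X ?X) ?X ((\<lambda>(x, y). fun_of M (mult_sym R) [x, y]) \<circ> (\<lambda>q. (t, snd q)))"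
    by (rule continuous_map_compose[OF _ mult])
      (simp add: continuous_map_pairedI continuous_map_snd top t)
  then have "continuous_map (prod_topology ?X ?X) ?X ((\<lambda>(x, y). fun_of M (add_sym R) [x, y]) \<circ>
      (\<lambda>q. (fst q, ((\<lambda>(x, y). fun_of M (mult_sym R) [x, y]) \<circ> (\<lambda>q. (t, snd q))) q)))"
    by (intro continuous_map_compose[OF _ add] continuous_map_pairedI continuous_map_fst)
  then have cont: "continuous_map (prod_topology ?X ?X) ?X ?f"
    by (rule continuous_map_eq) auto
  let ?Z = "{q \<in> topspace (prod_topology ?X ?X). ?f q \<in> V}"
  have oZ: "openin (prod_topology ?X ?X) ?Z"
    by (rule openin_continuous_map_preimage[OF cont Suc.prems(1)])
  have vZ: "(v, \<zero>\<^bsub>ring_of R M\<^esub>) \<in> ?Z"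
    using v vU t zero_closed r_null[of t] r_zero[of v] by (auto simp: top)
  from oZ[unfolded openin_prod_topology_alt, rule_format, OF vZ]
  obtain U W where UW: "openin ?X U" "openin ?X W" "v \<in> U" "\<zero>\<^bsub>ring_of R M\<^esub> \<in> W" "U \<times> W \<subseteq> ?Z"
    by (elim exE conjE)
  have "W \<noteq> {}" "fun_of M (zero_sym R) [] \<in> W" using UW(4) by auto
  from Suc.IH[OF UW(2) this] obtain W' where W': "\<forall>j<k. openin ?X (W' j) \<and> W' j \<noteq> {}"
    "\<And>x. \<forall>j<k. x j \<in> W' j \<Longrightarrow> poly M x t k \<in> W" by blast
  show ?case
  proof (intro exI[of _ "W'(k := U)"] conjI allI impI)
    fix x assume x: "\<forall>j<Suc k. x j \<in> (W'(k := U)) j"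
    have "x k \<in> U" using x[rule_format, of k] by simp
    have "\<forall>j<k. x j \<in> W' j"
    proof (intro allI impI)
      fix j assume "j < k" then show "x j \<in> W' j" using x[rule_format, of j] by simp
    qed
    then have "poly M x t k \<in> W" by (rule W'(2))
    then have "(x k, poly M x t k) \<in> ?Z" using \<open>x k \<in> U\<close> UW(5) by blast
    then show "poly M x t (Suc k) \<in> V" by simp
  qed (use W'(1) UW(1,3) in \<open>auto simp: less_Suc_eq\<close>)
qed

text \<open>The coefficients x are determined by t and the value z.  If x i were not algebraic over A, the
  formula defining z from x i would hold on an open set, hence at a second element of E, which
  gives a second vector of coefficients in E with the same value.\<close>

lemma algebraic_swap:
  fixes b :: nat
  assumes P: "pair M E" and g: "g ` {..<b} \<subseteq> E" "g ` {..<b} \<subseteq> A" and A: "A \<subseteq> universe M"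
    and t: "t \<in> A" "t \<notin> E" and x: "\<And>j. j < k \<Longrightarrow> x j \<in> E" and i: "i < k"
    and z: "poly M x t k \<in> acl L M A"
    and xi: "x ` {..<k} \<subseteq> acl L M (insert (x i) (g ` {..<b}))"
  shows "x i \<in> acl L M A"
proof (rule ccontr)
  assume xA: "x i \<notin> acl L M A"
  note M = pair_model[OF P]
  interpret pregeometry "universe M" "acl L M" by (rule acl_pregeometry[OF M])
  let ?z = "poly M x t k"
  have xU: "\<And>j. j < k \<Longrightarrow> x j \<in> universe M" using x pair_subset[OF P] by blast
  have ins: "insert u (g ` {..<b}) = (g(b := u)) ` {..<Suc b}" for u
  proof -
    have "(g(b := u)) ` {..<b} = g ` {..<b}" by (rule image_cong) auto
    then show ?thesis unfolding lessThan_Suc image_insert fun_upd_same by (simp only:)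
  qed
  have subU: "(g(b := u)) ` {..<Suc b} \<subseteq> universe M" if "u \<in> universe M" for u
    using g(2) A that unfolding ins[symmetric] by blast
  have "\<exists>\<kappa>. j < k \<longrightarrow> functional L (Suc b) \<kappa> \<and> sat M (g(b := x i, Suc b := x j)) \<kappa>" for j
    using xi unfolding ins using acl_functional[OF M subU[OF xU[OF i]], of "x j"] by blast
  then have "\<forall>j. \<exists>\<kappa>. j < k \<longrightarrow> functional L (Suc b) \<kappa> \<and> sat M (g(b := x i, Suc b := x j)) \<kappa>" by blast
  from choice[OF this] obtain \<kappa> where
    "\<forall>j. j < k \<longrightarrow> functional L (Suc b) (\<kappa> j) \<and> sat M (g(b := x i, Suc b := x j)) (\<kappa> j)" ..
  then have \<kappa>: "functional L (Suc b) (\<kappa> j)" "sat M (g(b := x i, Suc b := x j)) (\<kappa> j)" if "j < k" for j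
    using that by blast+
  \<comment> \<open>Positions of the variables: the parameters \<open>g\<close> below
    \<open>b\<close>, then \<open>t\<close> at \<open>b\<close>, the value at \<open>b + 1\<close>,
    the candidate for \<open>x i\<close> at \<open>b + 2\<close>, and from \<open>b + 3\<close> on
    the quantified coefficients.\<close>
  let ?n = "b + 3"
  let ?\<rho> = "\<lambda>j l. if l < b then l else if l = b then b + 2 else ?n + j"
  let ?poly = "Equal (poly_tm b (\<lambda>j. ?n + j) k) (Var (b + 1))"
  define Q where "Q = (\<lambda>(N :: 'u ustruct) w.
    (\<forall>j\<in>{..<k}. sat N (\<lambda>l. w (?\<rho> j l)) (\<kappa> j)) \<and> w (?n + i) = w (b + 2) \<and> sat N w ?poly)"
  have "expr L {..<?n + k} (\<lambda>(N :: 'u ustruct) w. sat N (\<lambda>l. w (?\<rho> j l)) (\<kappa> j))" if "j \<in> {..<k}" for j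
    by (rule expr_rename_sat) (use that functional_wf[OF \<kappa>(1)] in auto)
  then have 1: "expr L {..<?n + k} (\<lambda>(N :: 'u ustruct) w. \<forall>j\<in>{..<k}. sat N (\<lambda>l. w (?\<rho> j l)) (\<kappa> j))"
    by (intro expr_ball) auto
  have 2: "expr L {..<?n + k} (\<lambda>(N :: 'u ustruct) w. w (?n + i) = w (b + 2))"
    by (rule expr_eq) (use i in auto)
  have "fv ?poly \<subseteq> {..<?n + k}" using fv_poly_tm[of b "\<lambda>j. ?n + j" k] by auto
  then have "expr L {..<?n + k} (\<lambda>(N :: 'u ustruct) w. sat N w ?poly)"
    by (intro expr_sat) (simp_all add: wf_poly_tm)
  with 1 2 have "expr L {..<?n + k} Q" unfolding Q_def by (intro expr_conj)
  from expr_ex_block[OF this] obtain \<phi> where \<phi>: "wf_fm L \<phi>" "fv \<phi> \<subseteq> {..<?n}"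
    "\<And>N w. sat N w \<phi> \<longleftrightarrow> (\<exists>y\<in>tuples (universe N) k. Q N (append_tuple ?n w y))"
    unfolding expr_def by blast
  define G where "G l = (if l < b then g l else if l = b then t else ?z)" for l
  have Q: "Q M (append_tuple ?n (G(b + 2 := u)) y) \<longleftrightarrow>
    (\<forall>j<k. sat M (g(b := u, Suc b := y j)) (\<kappa> j)) \<and> y i = u \<and> poly M y t k = ?z" for u y
  proof -
    let ?w = "append_tuple ?n (G(b + 2 := u)) y"
    have "sat M (\<lambda>l. ?w (?\<rho> j l)) (\<kappa> j) = sat M (g(b := u, Suc b := y j)) (\<kappa> j)" if "j < k" for j
      by (rule sat_cong) (use functional_fv[OF \<kappa>(1)[OF that]] in \<open>auto simp: append_tuple_def G_def\<close>)
    moreover have "poly M (\<lambda>j. ?w (?n + j)) t k = poly M y t k"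
      by (rule poly_cong[OF M]) (simp add: append_tuple_def)
    moreover have "?w b = t" "?w (b + 1) = ?z" "?w (?n + i) = y i" "?w (b + 2) = u"
      by (simp_all add: append_tuple_def G_def)
    ultimately show ?thesis unfolding Q_def by (simp only: sat.simps val.simps val_poly_tm[OF M]) auto
  qed
  have zU: "?z \<in> universe M" using z cl_closed[OF A] by blast
  have GA: "G ` {..<b + 2} \<subseteq> acl L M A"
    using g(2) t(1) z cl_incr[OF A] by (auto simp: G_def)
  then have GU: "G ` {..<b + 2} \<subseteq> universe M" using cl_closed[OF A] by blast
  have fv: "fv \<phi> \<subseteq> {..b + 2}" using \<phi>(2) by (auto simp: numeral_3_eq_3 lessThan_Suc_atMost)
  have "Q M (append_tuple ?n (G(b + 2 := x i)) (restrict x {..<k}))"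
    unfolding Q using \<kappa>(2) i poly_cong[OF M, of k "restrict x {..<k}" x t] by simp
  then have true: "sat M (G(b + 2 := x i)) \<phi>"
    unfolding \<phi>(3) using restrict_tuples[of x k "universe M"] xU by blast
  have "infinite {u \<in> universe M. sat M (G(b + 2 := u)) \<phi>}"
  proof
    assume "finite {u \<in> universe M. sat M (G(b + 2 := u)) \<phi>}"
    then have "x i \<in> acl L M (G ` {..<b + 2})"
      unfolding acl_last using \<phi>(1) fv true xU[OF i] by blast
    then show False using cl_trans[OF A GA] xA by blast
  qed
  then obtain V where V: "openin (top_of M) V" "V \<noteq> {}" "V \<subseteq> {u \<in> universe M. sat M (G(b + 2 := u)) \<phi>}"
    by (rule infinite_definable_open[OF M \<phi>(1) fv GU])
  have "\<not> V \<inter> E \<subseteq> {x i}" using pair_meets[OF P V(1,2)] finite_subset by blast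
  then obtain u where u: "u \<in> V" "u \<in> E" "u \<noteq> x i" by blast
  have uU: "u \<in> universe M" using u(2) pair_subset[OF P] by blast
  have "sat M (G(b + 2 := u)) \<phi>" using u(1) V(3) by blast
  then obtain y where y: "y \<in> tuples (universe M) k" "\<forall>j<k. sat M (g(b := u, Suc b := y j)) (\<kappa> j)"
    "y i = u" "poly M y t k = ?z" unfolding \<phi>(3) Q by blast
  have uE: "(g(b := u)) ` {..<Suc b} \<subseteq> E" using g(1) u(2) unfolding ins[symmetric] by blast
  \<comment> \<open>All coefficients were assumed algebraic over \<open>g\<close> and the one
    coefficient \<open>x i\<close>; this keeps the new vector inside \<open>E\<close> when only this
    coefficient is chosen there.\<close>
  have yE: "y j \<in> E" if j: "j < k" for j
  proof -
    have "y j \<in> universe M" using y(1) j by (auto simp: tuples_def)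
    then have "y j \<in> acl L M ((g(b := u)) ` {..<Suc b})"
      unfolding acl_functional[OF M subU[OF uU]] using y(2) \<kappa>(1)[OF j] j by blast
    then show ?thesis using pair_acl_closed[OF P uE] by blast
  qed
  have "t \<in> E"
  proof (rule poly_agree[OF P _ x yE i])
    show "t \<in> universe M" using t(1) A by blast
    show "x i \<noteq> y i" using y(3) u(3) by simp
    show "poly M x t k = poly M y t k" using y(4) by simp
  qed
  then show False using t(2) by simp
qed

text \<open>The elements of \<open>E\<close> among the parameters of \<open>z\<close> are, up to
  closure, the generators of \<open>s\<close> inside \<open>E\<close> and \<open>F\<close>. The
  coefficients turn out to be algebraic over these, although they are independent over
  \<open>s\<close>; so the exchange lemma over the generators leaves room for at most
  \<open>card F\<close> of them.\<close>

lemma small_bound: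
  fixes m :: nat
  assumes g: "good M E s m J K" and t: "t \<in> s ` {..<m}" "t \<notin> E"
    and x: "\<And>j. j < k \<Longrightarrow> x j \<in> E" "\<And>j. j < k \<Longrightarrow> x j \<notin> acl L M (s ` {..<m} \<union> x ` {..<j})"
    and F: "finite F" "F \<subseteq> E" and z: "poly M x t k \<in> acl L M (s ` {..<m} \<union> F)"
  shows "k \<le> card F"
proof -
  note P = good_pair[OF g]
  note M = pair_model[OF P]
  interpret pregeometry "universe M" "acl L M" by (rule acl_pregeometry[OF M])
  let ?c = "s ` (J \<inter> {..<m})"
  have cE: "?c \<subseteq> E" using g by (auto simp: good_def)
  have EU: "E \<subseteq> universe M" by (rule pair_subset[OF P])
  have sU: "s ` {..<m} \<subseteq> universe M" using good_range[OF g] by auto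
  let ?B = "?c \<union> F"
  have BE: "?B \<subseteq> E" using cE F by blast
  have shrink: "x ` {..<k} \<subseteq> acl L M ?B" if "finite I" "I \<subseteq> {..<k}" "x ` {..<k} \<subseteq> acl L M (?B \<union> x ` I)" for I
    using that
  proof (induction I rule: finite_induct)
    case (insert i I)
    have i: "i < k" using insert.prems by auto
    let ?A = "?B \<union> x ` I"
    have AE: "?A \<subseteq> E" using BE x(1) insert.prems(1) by auto
    then have AU: "?A \<subseteq> universe M" using EU by blast
    have "finite ?A" using insert F(1) by auto
    then obtain h and b :: nat where h: "?A = h ` {..<b}" by (rule finite_enum)
    have "x i \<in> acl L M (?A \<union> s ` {..<m})"
    proof (rule algebraic_swap[OF P, of h b _ t k x i])
      show "h ` {..<b} \<subseteq> E" using AE unfolding h .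
      show "h ` {..<b} \<subseteq> ?A \<union> s ` {..<m}" unfolding h by blast
      show "?A \<union> s ` {..<m} \<subseteq> universe M" using AU sU by blast
      show "poly M x t k \<in> acl L M (?A \<union> s ` {..<m})"
        using z cl_mono[of "s ` {..<m} \<union> F" "?A \<union> s ` {..<m}"] by blast
      have "?B \<union> x ` insert i I = insert (x i) (h ` {..<b})" unfolding h[symmetric] by blast
      then show "x ` {..<k} \<subseteq> acl L M (insert (x i) (h ` {..<b}))" using insert.prems(2) by simp
    qed (use t x(1) i in auto)
    then have "x i \<in> acl L M (?A \<union> ?c)" using good_acl[OF g AE] x(1)[OF i] by blast
    moreover have "?A \<union> ?c = ?A" by blast
    ultimately have "?B \<union> x ` insert i I \<subseteq> acl L M ?A" using cl_incr[OF AU] by auto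
    then have "x ` {..<k} \<subseteq> acl L M ?A" using cl_trans[OF AU] insert.prems(2) by blast
    then show ?case using insert.IH insert.prems(1) by simp
  qed simp
  have "x ` {..<k} \<subseteq> acl L M (?B \<union> x ` {..<k})"
    using cl_incr[of "?B \<union> x ` {..<k}"] BE x(1) EU by blast
  from shrink[OF _ subset_refl this] have "x ` {..<k} \<subseteq> acl L M ?B" by simp
  moreover have "x j \<notin> acl L M (?c \<union> x ` {..<j})" if "j < k" for j
    using x(2)[OF that] cl_mono[of "?c \<union> x ` {..<j}" "s ` {..<m} \<union> x ` {..<j}"] by blast
  ultimately show ?thesis using steinitz[of ?c F x k] cE F EU by blast
qed

text \<open>Algebraic elements may be appended as dependent entries, so the parameters of a formula
  can be assumed to be entries of the tuple.\<close>

lemma good_cover: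
  assumes "good M E s m J K" "finite Y" "Y \<subseteq> acl L M (s ` {..<m})"
  shows "\<exists>s' m' J' K'. good M E s' m' J' K' \<and> Y \<subseteq> s' ` {..<m'} \<and> acl L M (s ` {..<m}) \<subseteq> acl L M (s' ` {..<m'})"
  using assms(2,3)
proof (induction Y rule: finite_induct)
  case empty
  then show ?case using assms(1) by blast
next
  case (insert y Y)
  then obtain s' m' J' K' where 1: "good M E s' m' J' K'" "Y \<subseteq> s' ` {..<m'}"
    "acl L M (s ` {..<m}) \<subseteq> acl L M (s' ` {..<m'})" by blast
  have y: "y \<in> acl L M (s' ` {..<m'})" using insert.prems 1(3) by blast
  define u where "u = s'(m' := y)"
  have u: "\<And>i. i < m' \<Longrightarrow> u i = s' i" "u m' = y" by (simp_all add: u_def)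
  have "y \<in> universe M" by (rule subsetD[OF acl_universe y])
  then have ru: "range u \<subseteq> universe M"
    unfolding u_def by (rule range_upd[OF good_range[OF 1(1)]])
  have im: "u ` {..<m'} = s' ` {..<m'}" by (rule image_cong_less[of m']) (use u in auto)
  have "good M E u (Suc m') (J' - {m'}) (K' - {m'})"
    by (rule good_add(1)[OF 1(1) ru u(1)]) (use y u(2) in auto)
  moreover have eq: "u ` {..<Suc m'} = insert y (s' ` {..<m'})" by (simp add: lessThan_Suc im u(2))
  moreover have "acl L M (s' ` {..<m'}) \<subseteq> acl L M (u ` {..<Suc m'})" unfolding eq by (rule acl_mono) blast
  moreover have "insert y Y \<subseteq> u ` {..<Suc m'}" unfolding eq using 1(2) by blast
  ultimately show ?case using 1(3) by blast
qed

text \<open>Makes a covering of a basic set by small sets part of the type of a tuple, so that it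
  persists in every pair with a tuple of this type.\<close>

lemma covering_formula:
  fixes n m :: nat
  assumes F: "finite F" "\<forall>(k, \<kappa>)\<in>F. functional L (n + k) \<kappa>"
    and r: "\<And>i. i < n \<Longrightarrow> a i < m" "\<And>i. i < p \<Longrightarrow> c i < m"
  obtains Q where "expr PL {..<m} Q"
    "\<And>(M :: 'u ustruct) E s. E \<subseteq> universe M \<Longrightarrow> Q (pair_struct M E) s \<longleftrightarrow>
      (\<forall>x\<in>basic M (\<lambda>j. s (c j)). \<exists>(k, \<kappa>)\<in>F. small_at M E n k \<kappa> (\<lambda>i. s (a i)) x)"
proof -
  define B where "B = (\<lambda>(N :: ('u, 'u option, 'u) struct) w.
    sat (reduct N) (\<lambda>j. if j < p then w (c j) else w m) \<theta>')"
  define S where "S = (\<lambda>q (N :: ('u, 'u option, 'u) struct) w.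
    sat N (\<lambda>i. w (if i < n then a i else m)) (case q of (k, \<kappa>) \<Rightarrow> small_fm n k \<kappa>))"
  define Q where "Q = (\<lambda>N w. \<forall>x\<in>universe N. B N (w(m := x)) \<longrightarrow> (\<exists>q\<in>F. S q N (w(m := x))))"
  show thesis
  proof (rule that[of Q])
    show "expr PL {..<m} Q"
      unfolding Q_def
    proof (rule expr_all_last, intro expr_imp expr_bex F(1))
      show "expr PL {..<Suc m} B" unfolding B_def
        by (rule expr_lift, rule expr_basic) (use r(2) in \<open>auto simp: less_Suc_eq\<close>)
      fix q assume "q \<in> F"
      then obtain k \<kappa> where q: "q = (k, \<kappa>)" "functional L (n + k) \<kappa>" using F(2) by (cases q) blast
      show "expr PL {..<Suc m} (S q)" unfolding S_def q(1) prod.case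
        by (rule expr_rename_sat[OF small_fm(1)[OF q(2)]]) (use r(1) in \<open>auto simp: less_Suc_eq\<close>)
    qed
    fix M :: "'u ustruct" and E and s :: "nat \<Rightarrow> 'u" assume E: "E \<subseteq> universe M"
    have B: "B (pair_struct M E) (s(m := x)) \<longleftrightarrow> sat M (\<lambda>j. if j < p then s (c j) else x) \<theta>'" for x
      unfolding B_def by (simp, rule sat_cong) (use r(2) in force)
    have S: "S (k, \<kappa>) (pair_struct M E) (s(m := x)) \<longleftrightarrow> small_at M E n k \<kappa> (\<lambda>i. s (a i)) x"
      if "(k, \<kappa>) \<in> F" for k \<kappa> x
    proof -
      have \<kappa>: "functional L (n + k) \<kappa>" using F(2) that by blast
      let ?w = "\<lambda>i. (s(m := x)) (if i < n then a i else m)"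
      have "append_tuple n ?w e = append_tuple n (\<lambda>i. s (a i)) e" for e
      proof
        fix i show "append_tuple n ?w e i = append_tuple n (\<lambda>i. s (a i)) e i"
          using r(1)[of i] by (cases "i < n") (auto simp: append_tuple_def)
      qed
      then show ?thesis unfolding S_def prod.case small_fm(3)[OF \<kappa> E] small_at_def by simp
    qed
    have "(\<exists>q\<in>F. S q (pair_struct M E) (s(m := x))) \<longleftrightarrow>
        (\<exists>(k, \<kappa>)\<in>F. small_at M E n k \<kappa> (\<lambda>i. s (a i)) x)" for x
      by (rule bex_cong[OF refl]) (auto simp: S)
    then show "Q (pair_struct M E) s \<longleftrightarrow>
      (\<forall>x\<in>basic M (\<lambda>j. s (c j)). \<exists>(k, \<kappa>)\<in>F. small_at M E n k \<kappa> (\<lambda>i. s (a i)) x)"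
      unfolding Q_def B basic_def by (auto simp only: pair_struct_simps mem_Collect_eq)
  qed
qed

text \<open>The coefficients are the \<open>k\<close> variables after the first \<open>m\<close>, so
  over a given tuple this is a condition on the entries to be added.\<close>

lemma poly_formula:
  fixes m :: nat
  assumes i: "i < m" and c: "\<And>j. j < p \<Longrightarrow> c j < m"
  obtains \<phi> where "wf_fm L \<phi>" "fv \<phi> \<subseteq> {..<m + k}"
    "\<And>M s. model M \<Longrightarrow> range s \<subseteq> universe M \<Longrightarrow>
      sat M s \<phi> \<longleftrightarrow> poly M (\<lambda>j. s (m + j)) (s i) k \<in> basic M (\<lambda>j. s (c j))"
proof -
  let ?n = "m + k"
  let ?p = "Equal (poly_tm i (\<lambda>j. m + j) k) (Var ?n) :: 'u ufm"
  define B where "B = (\<lambda>(N :: 'u ustruct) w. sat N (\<lambda>j. if j < p then w (c j) else w ?n) \<theta>')"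
  have "expr L {..<Suc ?n} B" unfolding B_def
    by (rule expr_basic) (use c in \<open>auto simp: less_Suc_eq trans_less_add1\<close>)
  moreover have "fv ?p \<subseteq> {..<Suc ?n}" using fv_poly_tm[of i "\<lambda>j. m + j" k] i by auto
  then have "expr L {..<Suc ?n} (\<lambda>(N :: 'u ustruct) w. sat N w ?p)"
    by (intro expr_sat) (simp_all add: wf_poly_tm)
  ultimately have "expr L {..<?n} (\<lambda>N w. \<exists>z\<in>universe N. sat N (w(?n := z)) ?p \<and> B N (w(?n := z)))"
    by (intro expr_ex_last expr_conj)
  then obtain \<phi> where \<phi>: "wf_fm L \<phi>" "fv \<phi> \<subseteq> {..<?n}"
    "\<And>(N :: 'u ustruct) w. sat N w \<phi> \<longleftrightarrow> (\<exists>z\<in>universe N. sat N (w(?n := z)) ?p \<and> B N (w(?n := z)))"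
    unfolding expr_def by blast
  show thesis
  proof (rule that[OF \<phi>(1,2)])
    fix M and s :: "nat \<Rightarrow> 'u" assume M: "model M" and s: "range s \<subseteq> universe M"
    have "poly M (\<lambda>j. (s(?n := z)) (m + j)) (s i) k = poly M (\<lambda>j. s (m + j)) (s i) k" for z
      by (rule poly_cong[OF M]) simp
    then have p: "sat M (s(?n := z)) ?p \<longleftrightarrow> poly M (\<lambda>j. s (m + j)) (s i) k = z" for z
      using i by (simp add: val_poly_tm[OF M])
    have B: "B M (s(?n := z)) \<longleftrightarrow> sat M (\<lambda>j. if j < p then s (c j) else z) \<theta>'" for z
      unfolding B_def
    proof (rule sat_cong)
      fix j show "(if j < p then (s(?n := z)) (c j) else (s(?n := z)) ?n) = (if j < p then s (c j) else z)"
        using c[of j] by auto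
    qed
    have "poly M (\<lambda>j. s (m + j)) (s i) k \<in> universe M"
      by (rule poly_closed[OF M]) (use s in auto)
    then show "sat M s \<phi> \<longleftrightarrow> poly M (\<lambda>j. s (m + j)) (s i) k \<in> basic M (\<lambda>j. s (c j))"
      unfolding \<phi>(3) p B basic_def by auto
  qed
qed

text \<open>In an extension, take more independent elements x of E than there are parameters from E in
  the formulas covering V, and an element t outside E; then the sum of the terms x j * t^j lies
  in V, but x is algebraic over fewer elements.\<close>

theorem pair_thick:
  assumes P: "pair M E"
  shows "thick M E"
  unfolding thick_def
proof (intro allI impI, rule ccontr)
  fix V v n and F :: "(nat \<times> 'u ufm) set"
  assume V: "openin (top_of M) V" "V \<noteq> {}" and v: "range v \<subseteq> universe M" and F: "finite F"
    and fn: "\<forall>(k, \<kappa>)\<in>F. functional L (n + k) \<kappa>"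
    and no: "\<not> (\<exists>x\<in>V. \<forall>(k, \<kappa>)\<in>F. \<not> small_at M E n k \<kappa> v x)"
  note M = pair_model[OF P]
  obtain x0 where "x0 \<in> V" using V(2) by blast
  then obtain q where q: "q ` {..<p} \<subseteq> universe M" "x0 \<in> basic M q" "basic M q \<subseteq> V"
    using V(1)[unfolded openin_top[OF M]] by blast
  obtain t where t: "t \<in> universe M" "t \<notin> E" using pair_proper[OF P] pair_subset[OF P] by blast
  \<comment> \<open>Every parameter in play becomes an entry of one good tuple: \<open>t\<close>,
    the parameters of the covering formulas, and those of a basic set inside
    \<open>V\<close>.\<close>
  let ?Y = "insert t (v ` {..<n} \<union> q ` {..<p})"
  have g0: "good M E v 0 {} {}" using P v by (simp add: good_def)
  have Y: "finite ?Y" "?Y \<subseteq> universe M" using t v q(1) by auto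
  obtain s1 m1 J1 K1 where 1: "ext M E v 0 {} {} s1 m1 J1 K1" "?Y \<subseteq> acl L M (s1 ` {..<m1})"
    using ext_finite[OF g0 Y] by blast
  obtain s m J K where g: "good M E s m J K" and sY: "?Y \<subseteq> s ` {..<m}"
    using good_cover[OF ext_good[OF 1(1)] Y(1) 1(2)] by blast
  note s = good_range[OF g]
  have "\<forall>j. \<exists>l. j < n \<longrightarrow> l < m \<and> s l = v j" using sY by (force simp: image_iff)
  from choice[OF this] obtain a where a: "\<forall>j. j < n \<longrightarrow> a j < m \<and> s (a j) = v j" ..
  have "\<forall>j. \<exists>l. j < p \<longrightarrow> l < m \<and> s l = q j" using sY by (force simp: image_iff)
  from choice[OF this] obtain c where c: "\<forall>j. j < p \<longrightarrow> c j < m \<and> s (c j) = q j" ..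
  obtain i where i: "i < m" "s i = t" using sY by (auto simp: image_iff)
  have am: "\<And>j. j < n \<Longrightarrow> a j < m" and cm: "\<And>j. j < p \<Longrightarrow> c j < m" using a c by simp_all
  have sq: "basic M (\<lambda>j. s (c j)) = basic M q" by (rule basic_cong) (simp add: c)
  \<comment> \<open>More coefficients than any covering formula has parameters from
    \<open>E\<close>; positive, so that the case of the empty sum in \<open>poly_open\<close> does
    not arise.\<close>
  obtain N where N: "\<And>k \<kappa>. (k, \<kappa>) \<in> F \<Longrightarrow> k < N" "0 < N"
  proof -
    have "finite (fst ` F)" using F by simp
    then obtain N where "\<forall>k\<in>fst ` F. k < N" unfolding finite_nat_set_iff_bounded by blast
    then have "k < Suc N" if "(k, \<kappa>) \<in> F" for k \<kappa> using that by (force simp: less_Suc_eq)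
    then show thesis using that[of "Suc N"] by simp
  qed
  obtain Q where Q: "expr PL {..<m} Q" "\<And>(M :: 'u ustruct) E s. E \<subseteq> universe M \<Longrightarrow> Q (pair_struct M E) s \<longleftrightarrow>
      (\<forall>x\<in>basic M (\<lambda>j. s (c j)). \<exists>(k, \<kappa>)\<in>F. small_at M E n k \<kappa> (\<lambda>i. s (a i)) x)"
    using covering_formula[OF F fn, where a = a and c = c and m = m] am cm by blast
  have small_a: "small_at M E n k \<kappa> (\<lambda>i. s (a i)) x = small_at M E n k \<kappa> v x" for k \<kappa> x
  proof -
    have "append_tuple n (\<lambda>i. s (a i)) e = append_tuple n v e" for e
      using a by (auto simp: append_tuple_def)
    then show ?thesis by (simp add: small_at_def)
  qed
  have QM: "Q (pair_struct M E) s"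
    unfolding Q(2)[OF pair_subset[OF P]] sq small_a using no q(3) by blast
  obtain \<phi> where \<phi>: "wf_fm L \<phi>" "fv \<phi> \<subseteq> {..<m + N}" "\<And>M s. model M \<Longrightarrow> range s \<subseteq> universe M \<Longrightarrow>
      sat M s \<phi> \<longleftrightarrow> poly M (\<lambda>j. s (m + j)) (s i) N \<in> basic M (\<lambda>j. s (c j))"
    using poly_formula[OF i(1), where c = c and k = N] cm by blast
  have box: "\<exists>W. (\<forall>j<N. openin (top_of M) (W j) \<and> W j \<noteq> {}) \<and>
    (\<forall>w. range w \<subseteq> universe M \<longrightarrow> (\<forall>j<m. w j = s j) \<longrightarrow> (\<forall>j<N. w (m + j) \<in> W j) \<longrightarrow>
      (\<forall>\<psi>\<in>\<Delta>. sat (pair_struct M E) w \<psi>))" if \<Delta>: "\<Delta> \<subseteq> {lift \<phi>}" for \<Delta>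
  proof -
    have "basic M q \<noteq> {}" "N = 0 \<Longrightarrow> fun_of M (zero_sym R) [] \<in> basic M q" using q(2) N(2) by auto
    from poly_open[OF M t(1) openin_basic[OF M q(1)] this] obtain W where
      W: "\<forall>j<N. openin (top_of M) (W j) \<and> W j \<noteq> {}"
        "\<And>x. \<forall>j<N. x j \<in> W j \<Longrightarrow> poly M x t N \<in> basic M q" by blast
    show ?thesis
    proof (intro exI[of _ W] conjI W(1) allI impI ballI)
      fix w \<psi> assume w: "range w \<subseteq> universe M" "\<forall>j<m. w j = s j" "\<forall>j<N. w (m + j) \<in> W j" and "\<psi> \<in> \<Delta>"
      have "basic M (\<lambda>j. w (c j)) = basic M q" by (rule basic_cong) (use c w(2) in simp)
      moreover have "w i = t" using w(2) i by simp
      moreover have "poly M (\<lambda>j. w (m + j)) t N \<in> basic M q" by (rule W(2)) (use w(3) in simp)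
      ultimately have "sat M w \<phi>" using \<phi>(3)[OF M w(1)] by simp
      moreover have "\<psi> = lift \<phi>" using \<Delta> \<open>\<psi> \<in> \<Delta>\<close> by blast
      ultimately show "sat (pair_struct M E) w \<psi>" by simp
    qed
  qed
  \<comment> \<open>All new entries are to lie in \<open>E\<close>, so \<open>realize\<close> is
    used without thickness, which is only being proved.\<close>
  let ?J = "J \<union> {m..<m + N}"
  show False
  proof (rule realize[OF P s, of "{lift \<phi>}" N m ?J])
    show "wf_fm PL \<psi>" if "\<psi> \<in> {lift \<phi>}" for \<psi> using that \<phi>(1) by simp
    show "thick M E" if "j < N" "m + j \<notin> ?J" for j using that by simp
  next
    fix M' E' s'
    assume P': "pair M' E'" and s': "range s' \<subseteq> universe M'"
      and eq: "eqtp PL (pair_struct M E) s (pair_struct M' E') s' m"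
      and sat: "\<And>\<psi>. \<psi> \<in> {lift \<phi>} \<Longrightarrow> sat (pair_struct M' E') s' \<psi>"
      and new: "\<And>j. j < N \<Longrightarrow> m + j \<in> ?J \<Longrightarrow> s' (m + j) \<in> E' \<and> s' (m + j) \<notin> acl L M' (s' ` {..<m + j})"
    note M' = pair_model[OF P']
    have g': "good M' E' s' m J K" by (rule good_transfer[OF g P' s' eq])
    have "s i \<in> E \<longleftrightarrow> s' i \<in> E'" using eqtp_expr[OF eq expr_P[of i]] i(1) by simp
    then have t': "s' i \<notin> E'" "s' i \<in> s' ` {..<m}" using t(2) i by auto
    let ?z = "poly M' (\<lambda>j. s' (m + j)) (s' i) N"
    have "?z \<in> basic M' (\<lambda>j. s' (c j))" using sat[of "lift \<phi>"] \<phi>(3)[OF M' s'] by simp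
    moreover have "Q (pair_struct M' E') s'" using eqtp_expr[OF eq Q(1)] QM by simp
    ultimately have "\<exists>(k, \<kappa>)\<in>F. small_at M' E' n k \<kappa> (\<lambda>i. s' (a i)) ?z"
      unfolding Q(2)[OF pair_subset[OF P']] by blast
    then obtain k \<kappa> where \<kappa>: "(k, \<kappa>) \<in> F" "small_at M' E' n k \<kappa> (\<lambda>i. s' (a i)) ?z" by blast
    then obtain e where e: "e \<in> tuples E' k" "sat M' ((append_tuple n (\<lambda>i. s' (a i)) e)(n + k := ?z)) \<kappa>"
      unfolding small_at_def by blast
    have eE: "e ` {..<k} \<subseteq> E'" by (rule tuples_image[OF e(1)])
    have im: "append_tuple n (\<lambda>i. s' (a i)) e ` {..<n + k} \<subseteq> s' ` {..<m} \<union> e ` {..<k}"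
      unfolding image_append_tuple using am by auto
    then have imU: "append_tuple n (\<lambda>i. s' (a i)) e ` {..<n + k} \<subseteq> universe M'"
      using s' eE pair_subset[OF P'] by blast
    have "?z \<in> universe M'" by (rule poly_closed[OF M']) (use s' in auto)
    then have "?z \<in> acl L M' (append_tuple n (\<lambda>i. s' (a i)) e ` {..<n + k})"
      unfolding acl_functional[OF M' imU] using e(2) fn \<kappa>(1) by blast
    then have z: "?z \<in> acl L M' (s' ` {..<m} \<union> e ` {..<k})" using acl_mono[OF im] by blast
    \<comment> \<open>The covering formula makes the value algebraic over \<open>s'\<close> and the
      \<open>k\<close> elements \<open>e\<close> of \<open>E'\<close>, so at most \<open>k\<close>
      of the coefficients can be independent.\<close>
    have "N \<le> card (e ` {..<k})"
    proof (rule small_bound[OF g' t'(2,1) _ _ _ eE z])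
      fix j assume j: "j < N"
      show "s' (m + j) \<in> E'" using new[OF j] j by simp
      have sub: "s' ` {..<m} \<union> (\<lambda>j. s' (m + j)) ` {..<j} \<subseteq> s' ` {..<m + j}" by auto
      then show "s' (m + j) \<notin> acl L M' (s' ` {..<m} \<union> (\<lambda>j. s' (m + j)) ` {..<j})"
        using new[OF j] j acl_mono[OF sub, of L M'] by auto
    qed simp
    also have "\<dots> \<le> k" using card_image_le[of "{..<k}" e] by simp
    finally show False using N(1)[OF \<kappa>(1)] by simp
  qed (use box in blast)
qed

end

section \<open>Independent points have definable neighbourhoods\<close>

lemma val_pair_struct [simp]: "val (pair_struct M E) = val M"
  using val_reduct[of "pair_struct M E"] by simp

text \<open>Frees the criterion for algebraicity from the convention that the distinguished variable
  comes last.\<close>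

lemma acl_formulaI:
  fixes v :: "nat \<Rightarrow> 'a"
  assumes \<phi>: "wf_fm L \<phi>" and v: "v ` (fv \<phi> - {i}) \<subseteq> A" and x: "x \<in> universe M" "sat M (v(i := x)) \<phi>"
    and fin: "finite {y \<in> universe M. sat M (v(i := y)) \<phi>}"
  shows "x \<in> acl L M A"
proof -
  have "finite (v ` (fv \<phi> - {i}))" by simp
  then obtain h and n :: nat where h: "v ` (fv \<phi> - {i}) = h ` {..<n}" by (rule finite_enum)
  have "\<exists>k. l \<in> fv \<phi> - {i} \<longrightarrow> k < n \<and> h k = v l" for l
  proof (cases "l \<in> fv \<phi> - {i}")
    case True
    then have "v l \<in> h ` {..<n}" unfolding h[symmetric] by blast
    then show ?thesis by auto
  qed blast
  then have "\<forall>l. \<exists>k. l \<in> fv \<phi> - {i} \<longrightarrow> k < n \<and> h k = v l" by blast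
  from choice[OF this] obtain \<rho> where \<rho>: "\<forall>l. l \<in> fv \<phi> - {i} \<longrightarrow> \<rho> l < n \<and> h (\<rho> l) = v l" ..
  let ?r = "\<lambda>l. if l = i then n else \<rho> l"
  have eq: "sat M (h(n := y)) (rename ?r \<phi>) = sat M (v(i := y)) \<phi>" for y
    unfolding sat_rename
  proof (rule sat_cong)
    fix l assume "l \<in> fv \<phi>"
    then show "(h(n := y)) (?r l) = (v(i := y)) l" using \<rho>[rule_format, of l] by (cases "l = i") auto
  qed
  have "fv (rename ?r \<phi>) \<subseteq> {..n}"
  proof (rule fv_renameI)
    fix l assume "l \<in> fv \<phi>"
    then show "?r l \<in> {..n}" using \<rho>[rule_format, of l] by (cases "l = i") auto
  qed
  moreover have "h ` {..<n} \<subseteq> A" using v unfolding h .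
  ultimately show ?thesis
    unfolding acl_last
    by (intro exI[of _ "rename ?r \<phi>"] exI[of _ n] exI[of _ h]) (use \<phi> x fin in \<open>simp only: eq wf_rename simp_thms\<close>)
qed

context geometric
begin

lemma topspace_power: "model M \<Longrightarrow> topspace (power_top (top_of M) {..<n}) = tuples (universe M) n"
  by (simp add: power_top_def tuples_def topspace_top)

text \<open>If the projection of the cell omitted coordinate \<open>i\<close>, its injectivity would
  make \<open>w i\<close> the only value completing the other coordinates to a point of the cell,
  hence algebraic over them and \<open>A\<close>. So the projection is the identity, and its open
  image is the cell.\<close>

lemma cell_open:
  assumes M: "model M" and C: "definable_set L M A r C" "cell_shaped (top_of M) r C" and w: "w \<in> C"
    and ind: "\<And>i. i < r \<Longrightarrow> w i \<notin> acl L M (A \<union> w ` ({..<r} - {i}))"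
  shows "openin (power_top (top_of M) {..<r}) C"
proof -
  obtain \<phi> k b where b: "b \<in> tuples A k" "wf_fm L \<phi>" "fv \<phi> \<subseteq> {..<r + k}"
    and Cdef: "C = {x \<in> tuples (universe M) r. sat M (append_tuple r x b) \<phi>}"
    using C(1) unfolding definable_set_def by blast
  have CT: "C \<subseteq> tuples (universe M) r" unfolding Cdef by blast
  obtain I where I: "I \<subseteq> {..<r}" "openin (power_top (top_of M) I) ((\<lambda>x. restrict x I) ` C)"
    "homeomorphic_map (subtopology (power_top (top_of M) {..<r}) C)
       (subtopology (power_top (top_of M) I) ((\<lambda>x. restrict x I) ` C)) (\<lambda>x. restrict x I)"
    using C(2) unfolding cell_shaped_def Let_def by blast
  have "topspace (subtopology (power_top (top_of M) {..<r}) C) = C"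
    using CT by (auto simp: topspace_power[OF M])
  with homeomorphic_imp_injective_map[OF I(3)] have inj: "inj_on (\<lambda>x. restrict x I) C" by simp
  have "i \<in> I" if i: "i < r" for i
  proof (rule ccontr)
    assume "i \<notin> I"
    have app: "(append_tuple r w b)(i := u) = append_tuple r (w(i := u)) b" for u
      using i by (auto simp: append_tuple_def)
    have "u = w i" if u: "u \<in> universe M" "sat M (append_tuple r (w(i := u)) b) \<phi>" for u
    proof -
      have "w(i := u) \<in> tuples (universe M) r"
        using w CT u(1) i by (auto simp: tuples_def PiE_iff extensional_def)
      then have wC: "w(i := u) \<in> C" using u(2) unfolding Cdef by blast
      have "restrict (w(i := u)) I = restrict w I" using \<open>i \<notin> I\<close> by (auto simp: restrict_def)
      from inj_onD[OF inj this wC w] have "(w(i := u)) i = w i" by (rule fun_cong)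
      then show ?thesis by simp
    qed
    then have "{u \<in> universe M. sat M ((append_tuple r w b)(i := u)) \<phi>} \<subseteq> {w i}"
      unfolding app by blast
    then have fin: "finite {u \<in> universe M. sat M ((append_tuple r w b)(i := u)) \<phi>}" using finite_subset by blast
    have "w i \<in> acl L M (A \<union> w ` ({..<r} - {i}))"
    proof (rule acl_formulaI[OF b(2) _ _ _ fin])
      show "append_tuple r w b ` (fv \<phi> - {i}) \<subseteq> A \<union> w ` ({..<r} - {i})"
      proof (rule image_subsetI)
        fix l assume l: "l \<in> fv \<phi> - {i}"
        then have "l < r + k" using b(3) by auto
        then show "append_tuple r w b l \<in> A \<union> w ` ({..<r} - {i})"
          using l tuples_image[OF b(1)] by (cases "l < r") (auto simp: append_tuple_def)
      qed
      show "w i \<in> universe M" using w CT i by (auto simp: tuples_def PiE_iff)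
      show "sat M ((append_tuple r w b)(i := w i)) \<phi>" using w unfolding app Cdef by simp
    qed
    then show False using ind[OF i] by simp
  qed
  then have "I = {..<r}" using I(1) by auto
  moreover have "restrict x {..<r} = x" if "x \<in> C" for x
    using that CT by (auto simp: tuples_def PiE_restrict)
  ultimately have "(\<lambda>x. restrict x I) ` C = C" by simp
  then show ?thesis using I(2) \<open>I = {..<r}\<close> by simp
qed

text \<open>The formulas \<open>\<kappa> j\<close> define a function on the set of tuples where they
  all have values and \<open>\<psi>\<close> holds. The last \<open>r\<close> entries of
  \<open>s\<close> are independent over the parameters of this function, so their cell is open by
  \<open>cell_open\<close>; the box comes from continuity on it.\<close>

lemma neighbourhood:
  assumes M: "model M" and s: "range s \<subseteq> universe M"
    and gen: "\<And>i. i < r \<Longrightarrow> s (m + i) \<notin> acl L M (s ` {..<m + i})"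
    and \<psi>: "wf_fm L \<psi>" "fv \<psi> \<subseteq> {..<m + r}" "sat M s \<psi>"
    and \<kappa>: "\<And>j. j < n \<Longrightarrow> functional L (m + r) (\<kappa> j)" "\<And>j. j < n \<Longrightarrow> sat M (s(m + r := y j)) (\<kappa> j)"
    and U: "openin (power_top (top_of M) {..<n}) U" "y \<in> U"
  shows "\<exists>V. (\<forall>i<r. openin (top_of M) (V i) \<and> V i \<noteq> {}) \<and>
    (\<forall>v. range v \<subseteq> universe M \<longrightarrow> (\<forall>i<m. v i = s i) \<longrightarrow> (\<forall>i<r. v (m + i) \<in> V i) \<longrightarrow>
      sat M v \<psi> \<and> (\<exists>y'\<in>U. \<forall>j<n. sat M (v(m + r := y' j)) (\<kappa> j)))"
proof -
  interpret pregeometry "universe M" "acl L M" by (rule acl_pregeometry[OF M])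
  let ?A = "s ` {..<m}" and ?X = "power_top (top_of M) {..<r}"
  let ?T = "tuples (universe M)"
  define val where "val w = append_tuple m s w" for w :: "nat \<Rightarrow> 'u"
  define G where "G w y' \<longleftrightarrow> sat M (val w) \<psi> \<and> (\<forall>j\<in>{..<n}. sat M ((val w)(m + r := y' j)) (\<kappa> j))" for w y'
  have unique: "y1 = y2" if y12: "y1 \<in> ?T n" "y2 \<in> ?T n" "G w y1" "G w y2" for w y1 y2
  proof (rule tuples_ext[OF y12(1,2)])
    fix j assume j: "j < n"
    then have "y1 j \<in> universe M" "y2 j \<in> universe M" using y12 by (auto simp: tuples_def)
    then show "y1 j = y2 j" using functional_unique[OF \<kappa>(1)[OF j], of M "val w"] y12 j by (auto simp: G_def)
  qed
  define D where "D = {w \<in> ?T r. \<exists>y'\<in>?T n. G w y'}"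
  have "\<forall>w. \<exists>y'. w \<in> D \<longrightarrow> y' \<in> ?T n \<and> G w y'" by (auto simp: D_def)
  from choice[OF this] obtain F where "\<forall>w. w \<in> D \<longrightarrow> F w \<in> ?T n \<and> G w (F w)" ..
  then have F: "F w \<in> ?T n" "G w (F w)" if "w \<in> D" for w using that by blast+
  \<comment> \<open>The definition of the graph needs the argument at the positions below
    \<open>r\<close>, the value at the next \<open>n\<close>, and the parameters, the first
    \<open>m\<close> entries of \<open>s\<close>, at the end.\<close>
  let ?r\<psi> = "\<lambda>i. if i < m then r + n + i else i - m"
  let ?r\<kappa> = "\<lambda>j i. if i < m then r + n + i else if i < m + r then i - m else r + j"
  define Q where "Q = (\<lambda>(N :: 'u ustruct) v. sat N (\<lambda>i. v (?r\<psi> i)) \<psi> \<and>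
    (\<forall>j\<in>{..<n}. sat N (\<lambda>i. v (?r\<kappa> j i)) (\<kappa> j)))"
  have 1: "expr L {..<r + n + m} (\<lambda>(N :: 'u ustruct) v. sat N (\<lambda>i. v (?r\<psi> i)) \<psi>)"
    by (rule expr_rename_sat[OF \<psi>(1)]) (use \<psi>(2) in auto)
  have "expr L {..<r + n + m} (\<lambda>(N :: 'u ustruct) v. sat N (\<lambda>i. v (?r\<kappa> j i)) (\<kappa> j))" if "j \<in> {..<n}" for j
    by (rule expr_rename_sat) (use that functional_wf[OF \<kappa>(1)] in auto)
  then have "expr L {..<r + n + m} Q"
    unfolding Q_def by (intro expr_conj 1 expr_ball) auto
  then obtain \<phi> where \<phi>: "wf_fm L \<phi>" "fv \<phi> \<subseteq> {..<r + n + m}" "\<And>(N :: 'u ustruct) v. sat N v \<phi> = Q N v"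
    unfolding expr_def by blast
  have Qeq: "Q M (append_tuple (r + n) (append_tuple r w y') (restrict s {..<m})) \<longleftrightarrow> G w y'" for w y'
  proof -
    let ?v = "append_tuple (r + n) (append_tuple r w y') (restrict s {..<m})"
    have "sat M (\<lambda>i. ?v (?r\<psi> i)) \<psi> = sat M (val w) \<psi>"
    proof (rule sat_cong)
      fix i assume "i \<in> fv \<psi>"
      then have "i < m + r" using \<psi>(2) by auto
      then show "?v (?r\<psi> i) = val w i" by (auto simp: append_tuple_def val_def)
    qed
    moreover have "sat M (\<lambda>i. ?v (?r\<kappa> j i)) (\<kappa> j) = sat M ((val w)(m + r := y' j)) (\<kappa> j)" if j: "j < n" for j
    proof (rule sat_cong)
      fix i assume "i \<in> fv (\<kappa> j)"
      then have "i \<le> m + r" using functional_fv[OF \<kappa>(1)[OF j]] by auto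
      then show "?v (?r\<kappa> j i) = ((val w)(m + r := y' j)) i"
        using j by (auto simp: append_tuple_def val_def)
    qed
    ultimately show ?thesis by (auto simp: Q_def G_def)
  qed
  have tup: "append_tuple r w y' \<in> ?T (r + n)" if "w \<in> ?T r" "y' \<in> ?T n" for w y'
    using that by (fastforce simp: tuples_def append_tuple_def PiE_iff extensional_def)
  have "(\<lambda>w. append_tuple r w (F w)) ` D =
    {x \<in> ?T (r + n). sat M (append_tuple (r + n) x (restrict s {..<m})) \<phi>}"
  proof (intro equalityI subsetI)
    fix x assume "x \<in> (\<lambda>w. append_tuple r w (F w)) ` D"
    then obtain w where w: "w \<in> D" "x = append_tuple r w (F w)" by blast
    then show "x \<in> {x \<in> ?T (r + n). sat M (append_tuple (r + n) x (restrict s {..<m})) \<phi>}"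
      using tup[of w "F w"] F[of w] Qeq[of w "F w"] \<phi>(3) by (simp add: D_def)
  next
    fix x assume "x \<in> {x \<in> ?T (r + n). sat M (append_tuple (r + n) x (restrict s {..<m})) \<phi>}"
    then have x: "x \<in> ?T (r + n)" "Q M (append_tuple (r + n) x (restrict s {..<m}))" using \<phi>(3) by auto
    define w where "w = restrict x {..<r}"
    define y' where "y' = restrict (\<lambda>j. x (r + j)) {..<n}"
    have xU: "x i \<in> universe M" if "i < r + n" for i
      using PiE_mem[OF x(1)[unfolded tuples_def], of i] that by simp
    have wy: "w \<in> ?T r" "y' \<in> ?T n"
      unfolding w_def y'_def by (rule restrict_tuples, intro image_subsetI xU, simp)+
    have eq: "append_tuple r w y' = x"
    proof (rule tuples_ext[OF tup[OF wy] x(1)])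
      fix i assume "i < r + n"
      then show "append_tuple r w y' i = x i" by (auto simp: append_tuple_def w_def y'_def)
    qed
    then have "G w y'" using x(2) Qeq[of w y'] by simp
    then have "w \<in> D" using wy by (auto simp: D_def)
    moreover have "F w = y'" using unique[OF F(1)[OF \<open>w \<in> D\<close>] wy(2) F(2)[OF \<open>w \<in> D\<close>] \<open>G w y'\<close>] .
    ultimately show "x \<in> (\<lambda>w. append_tuple r w (F w)) ` D" using eq by (intro image_eqI[of _ _ w]) auto
  qed
  moreover have "restrict s {..<m} \<in> tuples ?A m" by (rule restrict_tuples) simp
  ultimately have "definable_set L M ?A (r + n) ((\<lambda>w. append_tuple r w (F w)) ` D)"
    unfolding definable_set_def using \<phi>(1,2)
    by (intro exI[of _ \<phi>] exI[of _ m] bexI[of _ "restrict s {..<m}"]) simp_all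
  then have "definable_map L M ?A r n D F"
    unfolding definable_map_def using F(1) by (auto simp: D_def)
  moreover have "?A \<subseteq> universe M" using s by auto
  ultimately obtain \<C> where \<C>: "partition_on D \<C>" "\<forall>C\<in>\<C>. definable_set L M ?A r C \<and>
      cell_shaped (top_of M) r C \<and> continuous_map (subtopology ?X C) (power_top (top_of M) {..<n}) F"
    using model_facts(3)[OF M] unfolding cell_decomposition_def by blast
  define w0 where "w0 = restrict (\<lambda>i. s (m + i)) {..<r}"
  have w0: "w0 \<in> ?T r" unfolding w0_def by (rule restrict_tuples) (use s in auto)
  have yT: "y \<in> ?T n" using U openin_subset[OF U(1)] topspace_power[OF M] by blast
  have val0: "i < m + r \<Longrightarrow> val w0 i = s i" for i by (auto simp: val_def w0_def append_tuple_def)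
  have "sat M (val w0) \<psi> = sat M s \<psi>" by (rule sat_cong) (use \<psi>(2) val0 in auto)
  moreover have "sat M ((val w0)(m + r := y j)) (\<kappa> j) = sat M (s(m + r := y j)) (\<kappa> j)" if j: "j < n" for j
  proof (rule sat_cong)
    fix i assume "i \<in> fv (\<kappa> j)"
    then have "i \<le> m + r" using functional_fv[OF \<kappa>(1)[OF j]] by auto
    then show "((val w0)(m + r := y j)) i = (s(m + r := y j)) i" using val0 by auto
  qed
  ultimately have Gy: "G w0 y" using \<psi>(3) \<kappa>(2) by (simp add: G_def)
  then have w0D: "w0 \<in> D" using w0 yT by (auto simp: D_def)
  have Fy: "F w0 = y" by (rule unique[OF F(1)[OF w0D] yT F(2)[OF w0D] Gy])
  obtain C where C: "C \<in> \<C>" "w0 \<in> C" "C \<subseteq> D" using \<C>(1) w0D by (auto simp: partition_on_def)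
  have seq: "\<forall>j<r. w0 j \<notin> acl L M (?A \<union> w0 ` {..<j})"
  proof (intro allI impI)
    fix j assume j: "j < r"
    have sub: "?A \<union> w0 ` {..<j} \<subseteq> s ` {..<m + j}" using j by (auto simp: w0_def)
    show "w0 j \<notin> acl L M (?A \<union> w0 ` {..<j})"
      using gen[OF j] acl_mono[OF sub, of L M] j by (auto simp: w0_def)
  qed
  have "openin ?X C"
  proof (rule cell_open[OF M _ _ C(2)])
    show "w0 i \<notin> acl L M (?A \<union> w0 ` ({..<r} - {i}))" if "i < r" for i
      by (rule sequence_independent[OF _ _ seq that]) (use s w0 tuples_image[OF w0] in auto)
  qed (use \<C>(2) C(1) in auto)
  have cont: "continuous_map (subtopology ?X C) (power_top (top_of M) {..<n}) F" using \<C>(2) C(1) by blast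
  let ?Z = "{w \<in> topspace (subtopology ?X C). F w \<in> U}"
  have "openin (subtopology ?X C) ?Z" by (rule openin_continuous_map_preimage[OF cont U(1)])
  then have oZ: "openin ?X ?Z" using openin_open_subtopology[OF \<open>openin ?X C\<close>] by blast
  have Z: "w \<in> ?Z \<longleftrightarrow> w \<in> C \<and> F w \<in> U" for w
    using C(3) by (auto simp: topspace_power[OF M] D_def)
  have w0Z: "w0 \<in> ?Z" unfolding Z using C(2) Fy U(2) by simp
  from bspec[OF oZ[unfolded power_top_def openin_product_topology_alt, folded power_top_def] w0Z]
  obtain V where V': "\<forall>i\<in>{..<r}. openin (top_of M) (V i)" "w0 \<in> PiE {..<r} V" "PiE {..<r} V \<subseteq> ?Z"
    by (elim exE conjE)
  then have V: "\<And>i. i < r \<Longrightarrow> openin (top_of M) (V i)" "w0 \<in> PiE {..<r} V" "PiE {..<r} V \<subseteq> ?Z" by simp_all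
  show ?thesis
  proof (intro exI[of _ V] conjI allI impI)
    fix i assume i: "i < r"
    then show "openin (top_of M) (V i)" "V i \<noteq> {}" using V(1,2) by (auto simp: PiE_iff)
  next
    fix v assume v: "range v \<subseteq> universe M" "\<forall>i<m. v i = s i" "\<forall>i<r. v (m + i) \<in> V i"
    define w where "w = restrict (\<lambda>i. v (m + i)) {..<r}"
    have "w \<in> PiE {..<r} V" using v(3) by (auto simp: w_def)
    then have w: "w \<in> C" "F w \<in> U" using V(3) Z by blast+
    then have G: "G w (F w)" using F(2) C(3) by blast
    have vw: "i < m + r \<Longrightarrow> val w i = v i" for i using v(2) by (auto simp: val_def w_def append_tuple_def)
    have "sat M (val w) \<psi> = sat M v \<psi>" by (rule sat_cong) (use \<psi>(2) vw in auto)
    then show "sat M v \<psi>" using G by (simp add: G_def)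
    have "sat M ((val w)(m + r := F w j)) (\<kappa> j) = sat M (v(m + r := F w j)) (\<kappa> j)" if j: "j < n" for j
    proof (rule sat_cong)
      fix i assume "i \<in> fv (\<kappa> j)"
      then have "i \<le> m + r" using functional_fv[OF \<kappa>(1)[OF j]] by auto
      then show "((val w)(m + r := F w j)) i = (v(m + r := F w j)) i" using vw by auto
    qed
    then show "\<exists>y'\<in>U. \<forall>j<n. sat M (v(m + r := y' j)) (\<kappa> j)" using G w(2) by (auto simp: G_def)
  qed
qed

end

section \<open>Back and forth\<close>

context geometric
begin

lemma conj_formula:
  assumes "finite C" "\<And>\<phi>. \<phi> \<in> C \<Longrightarrow> wf_fm L \<phi> \<and> fv \<phi> \<subseteq> V"
  obtains \<psi> :: "'u ufm" where "wf_fm L \<psi>" "fv \<psi> \<subseteq> V" "\<And>(N :: 'u ustruct) v. sat N v \<psi> \<longleftrightarrow> (\<forall>\<phi>\<in>C. sat N v \<phi>)"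
proof -
  have "expr L V (\<lambda>(N :: 'u ustruct) v. \<forall>\<phi>\<in>C. sat N v \<phi>)"
    by (rule expr_ball[OF assms(1)]) (use assms(2) expr_sat in blast)
  then show thesis using that unfolding expr_def by blast
qed

lemma eqtp_sub:
  assumes "\<And>\<phi>. wf_fm L \<phi> \<Longrightarrow> fv \<phi> \<subseteq> {..<m} \<Longrightarrow> sat M s \<phi> \<Longrightarrow> sat N t \<phi>"
  shows "eqtp L M s N t m"
proof (rule eqtpI)
  fix Q assume Q: "expr L {..<m} Q" "Q M s"
  then obtain \<phi> where "wf_fm L \<phi>" "fv \<phi> \<subseteq> {..<m}" "\<And>M v. sat M v \<phi> = Q M v" unfolding expr_def by blast
  then show "Q N t" using assms[of \<phi>] Q(2) by simp
qed

text \<open>An existential formula moves a finite part of the type of the further entries from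
  \<open>s1\<close> to \<open>s2\<close>. Nothing is said about the position of the new entries
  relative to \<open>E3\<close>; this is repaired by moving them.\<close>

lemma type_extension:
  assumes s1: "range s1 \<subseteq> universe M1" and P2: "pair M2 E2" and s2: "range s2 \<subseteq> universe M2"
    and eq: "eqtp L M1 s1 M2 s2 m"
  obtains M3 E3 s3 where "pair M3 E3" "range s3 \<subseteq> universe M3"
    "eqtp PL (pair_struct M2 E2) s2 (pair_struct M3 E3) s3 m" "eqtp L M1 s1 M3 s3 (m + n)"
proof -
  let ?T = "{\<phi>. wf_fm L \<phi> \<and> fv \<phi> \<subseteq> {..<m + n} \<and> sat M1 s1 \<phi>}"
  have wf: "wf_fm PL \<phi>" if "\<phi> \<in> lift ` ?T" for \<phi> using that by auto
  have fin: "\<exists>v. range v \<subseteq> universe M2 \<and> (\<forall>i<m. v i = s2 i) \<and> (\<forall>\<phi>\<in>\<Delta>. sat (pair_struct M2 E2) v \<phi>)"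
    if \<Delta>: "finite \<Delta>" "\<Delta> \<subseteq> lift ` ?T" for \<Delta>
  proof -
    obtain C where C: "C \<subseteq> ?T" "finite C" "\<Delta> = lift ` C" using finite_subset_image[OF \<Delta>] by blast
    obtain \<psi> where \<psi>: "wf_fm L \<psi>" "fv \<psi> \<subseteq> {..<m + n}" "\<And>(N :: 'u ustruct) v. sat N v \<psi> \<longleftrightarrow> (\<forall>\<phi>\<in>C. sat N v \<phi>)"
      by (rule conj_formula[OF C(2), of "{..<m + n}"]) (use C(1) in blast)+
    have e: "expr L {..<m} (\<lambda>N v. \<exists>b\<in>tuples (universe N) n. sat N (append_tuple m v b) \<psi>)"
      by (rule expr_ex_block, rule expr_sat[OF \<psi>(1,2)])
    let ?b = "restrict (\<lambda>i. s1 (m + i)) {..<n}"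
    have "?b \<in> tuples (universe M1) n" by (rule restrict_tuples) (use s1 in auto)
    moreover have "sat M1 (append_tuple m s1 ?b) \<psi> = sat M1 s1 \<psi>"
      by (rule sat_cong) (use \<psi>(2) in \<open>auto simp: append_tuple_def\<close>)
    moreover have "sat M1 s1 \<psi>" using \<psi>(3) C(1) by blast
    ultimately have "\<exists>b\<in>tuples (universe M1) n. sat M1 (append_tuple m s1 b) \<psi>" by blast
    with eqtp_expr[OF eq e] obtain b where b: "b \<in> tuples (universe M2) n" "sat M2 (append_tuple m s2 b) \<psi>"
      by blast
    \<comment> \<open>Beyond its length, the tuple \<open>b\<close> has the value
      \<open>undefined\<close>, which may lie outside the universe.\<close>
    let ?v = "\<lambda>i. if i < m + n then append_tuple m s2 b i else s2 i"
    have "sat M2 ?v \<psi> = sat M2 (append_tuple m s2 b) \<psi>"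
      by (rule sat_cong) (use \<psi>(2) in auto)
    then have "\<forall>\<phi>\<in>\<Delta>. sat (pair_struct M2 E2) ?v \<phi>" using b(2) \<psi>(3) C(3) by auto
    moreover have "range ?v \<subseteq> universe M2"
      using s2 tuples_image[OF b(1)] by (auto simp: append_tuple_def image_subset_iff)
    moreover have "\<forall>i<m. ?v i = s2 i" by (simp add: append_tuple_def)
    ultimately show ?thesis by blast
  qed
  show thesis
  proof (rule pair_extension[OF P2 s2 wf fin])
    fix M3 E3 s3 assume P3: "pair M3 E3" and s3: "range s3 \<subseteq> universe M3"
      and e: "eqtp PL (pair_struct M2 E2) s2 (pair_struct M3 E3) s3 m"
      and sat: "\<And>\<phi>. \<phi> \<in> lift ` ?T \<Longrightarrow> sat (pair_struct M3 E3) s3 \<phi>"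
    have "eqtp L M1 s1 M3 s3 (m + n)"
    proof (rule eqtp_sub)
      fix \<phi> assume "wf_fm L \<phi>" "fv \<phi> \<subseteq> {..<m + n}" "sat M1 s1 \<phi>"
      then show "sat M3 s3 \<phi>" using sat[of "lift \<phi>"] by simp
    qed
    then show thesis by (rule that[OF P3 s3 e])
  qed
qed

lemma good_disjoint: "good M E s m J K \<Longrightarrow> i < m \<Longrightarrow> i \<in> J \<Longrightarrow> i \<notin> K"
proof
  assume g: "good M E s m J K" and i: "i < m" "i \<in> J" "i \<in> K"
  have "E \<union> s ` {..<i} \<subseteq> universe M" using pair_subset[OF good_pair[OF g]] good_range[OF g] by auto
  from acl_incr[OF this, of L] show False using g i by (auto simp: good_def)
qed

text \<open>The entries of \<open>s2\<close> from \<open>m\<close> on have the right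
  \<open>L\<close>-type, but may lie wrongly with respect to \<open>E2\<close>. As each formula of
  their type holds on a box, they can be replaced by generators of the kinds that \<open>J\<close>
  and \<open>K\<close> prescribe. The formula \<open>\<omega>\<close> of the pair language is kept
  along the way.\<close>

lemma realize_generators:
  assumes g1: "good M1 E1 s1 (m + r) J K"
    and gen: "\<And>i. i < r \<Longrightarrow> m + i \<in> J \<union> K"
    and g2: "good M2 E2 s2 m J K" and eq: "eqtp L M1 s1 M2 s2 (m + r)" and \<omega>: "wf_fm PL \<omega>"
    and box: "\<And>\<psi>. wf_fm L \<psi> \<Longrightarrow> fv \<psi> \<subseteq> {..<m + r} \<Longrightarrow> sat M2 s2 \<psi> \<Longrightarrow>
      \<exists>V. (\<forall>i<r. openin (top_of M2) (V i) \<and> V i \<noteq> {}) \<and>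
        (\<forall>v. range v \<subseteq> universe M2 \<longrightarrow> (\<forall>i<m. v i = s2 i) \<longrightarrow> (\<forall>i<r. v (m + i) \<in> V i) \<longrightarrow>
          sat M2 v \<psi> \<and> sat (pair_struct M2 E2) v \<omega>)"
  obtains M3 E3 s3 where "good M3 E3 s3 (m + r) J K"
    "eqtp PL (pair_struct M2 E2) s2 (pair_struct M3 E3) s3 m"
    "eqtp L M1 s1 M3 s3 (m + r)" "sat (pair_struct M3 E3) s3 \<omega>"
proof -
  note P2 = good_pair[OF g2] and s2 = good_range[OF g2]
  let ?T = "{\<phi>. wf_fm L \<phi> \<and> fv \<phi> \<subseteq> {..<m + r} \<and> sat M2 s2 \<phi>}"
  have wf: "wf_fm PL \<phi>" if "\<phi> \<in> insert \<omega> (lift ` ?T)" for \<phi> using that \<omega> by auto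
  have fin: "\<exists>V. (\<forall>i<r. openin (top_of M2) (V i) \<and> V i \<noteq> {}) \<and>
      (\<forall>v. range v \<subseteq> universe M2 \<longrightarrow> (\<forall>i<m. v i = s2 i) \<longrightarrow> (\<forall>i<r. v (m + i) \<in> V i) \<longrightarrow>
        (\<forall>\<phi>\<in>\<Delta>. sat (pair_struct M2 E2) v \<phi>))"
    if \<Delta>: "finite \<Delta>" "\<Delta> \<subseteq> insert \<omega> (lift ` ?T)" for \<Delta>
  proof -
    have sub: "finite (\<Delta> - {\<omega>})" "\<Delta> - {\<omega>} \<subseteq> lift ` ?T" using \<Delta> by auto
    obtain C where C: "C \<subseteq> ?T" "finite C" "\<Delta> - {\<omega>} = lift ` C" using finite_subset_image[OF sub] by blast
    obtain \<psi> where \<psi>: "wf_fm L \<psi>" "fv \<psi> \<subseteq> {..<m + r}" "\<And>(N :: 'u ustruct) v. sat N v \<psi> \<longleftrightarrow> (\<forall>\<phi>\<in>C. sat N v \<phi>)"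
      by (rule conj_formula[OF C(2), of "{..<m + r}"]) (use C(1) in blast)+
    have "sat M2 s2 \<psi>" using \<psi>(3) C(1) by blast
    from box[OF \<psi>(1,2) this] obtain V where V: "\<forall>i<r. openin (top_of M2) (V i) \<and> V i \<noteq> {}"
      "\<forall>v. range v \<subseteq> universe M2 \<longrightarrow> (\<forall>i<m. v i = s2 i) \<longrightarrow> (\<forall>i<r. v (m + i) \<in> V i) \<longrightarrow>
          sat M2 v \<psi> \<and> sat (pair_struct M2 E2) v \<omega>" by (elim exE conjE)
    show ?thesis
    proof (intro exI[of _ V] conjI V(1) allI impI ballI)
      fix v \<phi> assume "range v \<subseteq> universe M2" "\<forall>i<m. v i = s2 i" "\<forall>i<r. v (m + i) \<in> V i" "\<phi> \<in> \<Delta>"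
      then have v: "\<forall>\<phi>\<in>C. sat M2 v \<phi>" "sat (pair_struct M2 E2) v \<omega>" using V(2) \<psi>(3) by blast+
      show "sat (pair_struct M2 E2) v \<phi>"
      proof (cases "\<phi> = \<omega>")
        case False
        then have "\<phi> \<in> lift ` C" using \<open>\<phi> \<in> \<Delta>\<close> C(3) by blast
        then show ?thesis using v(1) by auto
      qed (use v in simp)
    qed
  qed
  show thesis
  proof (rule realize[OF P2 s2 wf fin pair_thick[OF P2], of _ J])
    fix M3 E3 s3
    assume P3: "pair M3 E3" and s3: "range s3 \<subseteq> universe M3"
      and e: "eqtp PL (pair_struct M2 E2) s2 (pair_struct M3 E3) s3 m"
      and sat: "\<And>\<phi>. \<phi> \<in> insert \<omega> (lift ` ?T) \<Longrightarrow> sat (pair_struct M3 E3) s3 \<phi>"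
      and inJ: "\<And>i. i < r \<Longrightarrow> m + i \<in> J \<Longrightarrow> s3 (m + i) \<in> E3 \<and> s3 (m + i) \<notin> acl L M3 (s3 ` {..<m + i})"
      and notJ: "\<And>i. i < r \<Longrightarrow> m + i \<notin> J \<Longrightarrow> s3 (m + i) \<notin> acl L M3 (E3 \<union> s3 ` {..<m + i})"
    have low: "good M3 E3 s3 m J K" by (rule good_transfer[OF g2 P3 s3 e])
    have "good M3 E3 s3 (m + r) J K"
      unfolding good_def
    proof (intro conjI P3 s3 allI impI)
      fix i assume i: "i < m + r"
      show "s3 i \<in> E3" if "i \<in> J"
        using low inJ[of "i - m"] that i by (cases "i < m") (auto simp: good_def)
      show "s3 i \<notin> acl L M3 (E3 \<union> s3 ` {..<i})" if "i \<in> K"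
      proof (cases "i < m")
        case False
        moreover have "i \<notin> J" using good_disjoint[OF g1 i] that by blast
        ultimately show ?thesis using notJ[of "i - m"] i by simp
      qed (use low that in \<open>simp add: good_def\<close>)
      show "s3 i \<in> acl L M3 (s3 ` {..<i})" if "i \<notin> J" "i \<notin> K"
      proof (cases "i < m")
        case False
        then have "i \<in> J \<union> K" using gen[of "i - m"] i by simp
        then show ?thesis using that by blast
      qed (use low that in \<open>simp add: good_def\<close>)
    qed
    moreover have "eqtp L M2 s2 M3 s3 (m + r)"
    proof (rule eqtp_sub)
      fix \<phi> assume "wf_fm L \<phi>" "fv \<phi> \<subseteq> {..<m + r}" "sat M2 s2 \<phi>"
      then show "sat M3 s3 \<phi>" using sat[of "lift \<phi>"] by simp
    qed
    then have "eqtp L M1 s1 M3 s3 (m + r)" by (rule eqtp_trans[OF eq])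
    moreover have "sat (pair_struct M3 E3) s3 \<omega>" by (rule sat) simp
    ultimately show thesis using e by (intro that)
  qed
qed

lemma generators_transfer:
  assumes "model M1" "model M2" "range s1 \<subseteq> universe M1" "range s2 \<subseteq> universe M2"
    and eq: "eqtp L M1 s1 M2 s2 m" and i: "i < m" "s1 i \<notin> acl L M1 (s1 ` {..<i})"
  shows "s2 i \<notin> acl L M2 (s2 ` {..<i})"
proof
  assume "s2 i \<in> acl L M2 (s2 ` {..<i})"
  from acl_transfer[OF assms(2,1,4,3) eqtp_sym[OF eq] _ i(1) this] show False using i by auto
qed

text \<open>New generators make \<open>x\<close> algebraic over the tuple. They are matched by
  generators of the same kinds in a new pair, and the functional formula that defines
  \<open>x\<close> yields its counterpart.\<close>

lemma forth:
  assumes g1: "good M1 E1 s1 m J K" and g2: "good M2 E2 s2 m J K" and eq: "eqtp L M1 s1 M2 s2 m"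
    and x: "x \<in> universe M1"
  shows "\<exists>M3 E3 t1 t3 n J' K'. good M1 E1 t1 n J' K' \<and> good M3 E3 t3 n J' K' \<and> eqtp L M1 t1 M3 t3 n \<and>
    m \<le> n \<and> (\<forall>i<m. t1 i = s1 i) \<and> eqtp PL (pair_struct M2 E2) s2 (pair_struct M3 E3) t3 m \<and>
    (\<exists>j<n. t1 j = x)"
proof -
  note M1 = pair_model[OF good_pair[OF g1]]
  obtain t1 m1 J' K' where e: "ext M1 E1 s1 m J K t1 m1 J' K'" and xt: "x \<in> acl L M1 (t1 ` {..<m1})"
    using ext_one[OF g1 x] by blast
  obtain r where r: "m1 = m + r" using e le_Suc_ex unfolding ext_def by blast
  have g1': "good M1 E1 t1 (m + r) J' K'" using ext_good[OF e] r by simp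
  note t1 = good_range[OF g1']
  have gen: "m + i \<in> J' \<union> K'" "t1 (m + i) \<notin> acl L M1 (t1 ` {..<m + i})" if "i < r" for i
    using e r that by (simp_all add: ext_def)
  have "eqtp L M1 t1 M2 s2 m" by (rule eqtp_cong[OF eq]) (use e in \<open>simp_all add: ext_def\<close>)
  then obtain M2' E2' s2' where P2': "pair M2' E2'" and s2': "range s2' \<subseteq> universe M2'"
    and pe: "eqtp PL (pair_struct M2 E2) s2 (pair_struct M2' E2') s2' m"
    and le: "eqtp L M1 t1 M2' s2' (m + r)"
    by (rule type_extension[OF t1 good_pair[OF g2] good_range[OF g2], of m r])
  note M2' = pair_model[OF P2']
  have g2': "good M2' E2' s2' m J' K'"
    by (rule good_cong[OF good_transfer[OF g2 P2' s2' pe] s2']) (use e in \<open>simp_all add: ext_def\<close>)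
  have gen2: "s2' (m + i) \<notin> acl L M2' (s2' ` {..<m + i})" if "i < r" for i
    by (rule generators_transfer[OF M1 M2' t1 s2' le]) (use that gen in auto)
  have box: "\<exists>V. (\<forall>i<r. openin (top_of M2') (V i) \<and> V i \<noteq> {}) \<and>
      (\<forall>v. range v \<subseteq> universe M2' \<longrightarrow> (\<forall>i<m. v i = s2' i) \<longrightarrow> (\<forall>i<r. v (m + i) \<in> V i) \<longrightarrow>
        sat M2' v \<psi> \<and> sat (pair_struct M2' E2') v (Equal (Var 0) (Var 0)))"
    if \<psi>: "wf_fm L \<psi>" "fv \<psi> \<subseteq> {..<m + r}" "sat M2' s2' \<psi>" for \<psi>
  proof -
    \<comment> \<open>With \<open>n = 0\<close> there are no function values to control, and the box
      only has to preserve \<open>\<psi>\<close>.\<close>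
    have "(\<lambda>_. undefined) \<in> topspace (power_top (top_of M2') {..<0})"
      unfolding topspace_power[OF M2'] by simp
    from neighbourhood[OF M2' s2' gen2 \<psi> _ _ openin_topspace this] show ?thesis by auto
  qed
  obtain M3 E3 s3 where g3: "good M3 E3 s3 (m + r) J' K'"
    and pe3: "eqtp PL (pair_struct M2' E2') s2' (pair_struct M3 E3) s3 m"
    and le3: "eqtp L M1 t1 M3 s3 (m + r)"
    by (rule realize_generators[OF g1' gen(1) g2' le _ box]) simp_all
  obtain x' where x': "x' \<in> acl L M3 (s3 ` {..<m + r})"
    and lx: "eqtp L M1 (t1(m + r := x)) M3 (s3(m + r := x')) (Suc (m + r))"
    using eqtp_acl[OF M1 pair_model[OF good_pair[OF g3]] t1 good_range[OF g3] le3] xt r by blast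
  have x'U: "x' \<in> universe M3" by (rule subsetD[OF acl_universe x'])
  have 1: "good M1 E1 (t1(m + r := x)) (Suc (m + r)) (J' - {m + r}) (K' - {m + r})"
    by (rule good_add(1)[OF g1' range_upd[OF t1 x]]) (use xt r in auto)
  have 3: "good M3 E3 (s3(m + r := x')) (Suc (m + r)) (J' - {m + r}) (K' - {m + r})"
    by (rule good_add(1)[OF g3 range_upd[OF good_range[OF g3] x'U]]) (use x' in auto)
  have "eqtp PL (pair_struct M2 E2) s2 (pair_struct M3 E3) (s3(m + r := x')) m"
    by (rule eqtp_cong[OF eqtp_trans[OF pe pe3]]) auto
  moreover have "\<forall>i<m. (t1(m + r := x)) i = s1 i" using e by (simp add: ext_def)
  moreover have "m \<le> Suc (m + r)" "\<exists>j<Suc (m + r). (t1(m + r := x)) j = x" by auto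
  ultimately show ?thesis using 1 3 lx by blast
qed

text \<open>The heart of the matter for atomic formulas: a value in \<open>E1\<close> is algebraic
  over the generators inside \<open>E1\<close> by \<open>good_acl\<close>. This is part of the
  \<open>L\<close>-type, and on the other side the value is algebraic over elements of
  \<open>E2\<close>, hence in \<open>E2\<close>.\<close>

lemma predicate_transfer:
  assumes g1: "good M1 E1 s1 m J K" and g2: "good M2 E2 s2 m J K" and eq: "eqtp L M1 s1 M2 s2 m"
    and t: "wf_tm L t" "fv_tm t \<subseteq> {..<m}" and E: "val M1 s1 t \<in> E1"
  shows "val M2 s2 t \<in> E2"
proof -
  note P1 = good_pair[OF g1] and P2 = good_pair[OF g2]
  note M1 = pair_model[OF P1] and M2 = pair_model[OF P2]
  note s1 = good_range[OF g1] and s2 = good_range[OF g2]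
  let ?\<phi> = "Equal t (Var m)"
  have single: "{y \<in> universe N. sat N (s(m := y)) ?\<phi>} = {val N s t}"
    if "model N" "range s \<subseteq> universe N" for N and s :: "nat \<Rightarrow> 'u"
  proof -
    have "val N s t \<in> universe N" using val_closed[OF model_struct[OF that(1)] t(1)] that(2) by auto
    moreover have "val N (s(m := y)) t = val N s t" for y by (rule val_cong) (use t(2) in auto)
    ultimately show ?thesis by auto
  qed
  have \<phi>: "wf_fm L ?\<phi>" "fv ?\<phi> \<subseteq> {..m}" using t by auto
  have eq': "eqtp L M1 (s1(m := val M1 s1 t)) M2 (s2(m := val M2 s2 t)) (Suc m)"
    by (rule eqtp_add[OF eq \<phi> single[OF M1 s1] single[OF M2 s2]])
  have v1: "val M1 s1 t \<in> universe M1" and v2: "val M2 s2 t \<in> universe M2"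
    using single[OF M1 s1] single[OF M2 s2] by blast+
  have "val M1 s1 t \<in> acl L M1 (s1 ` {..<m})"
    unfolding acl_last using \<phi> single[OF M1 s1] by (intro exI[of _ ?\<phi>] exI[of _ m] exI[of _ s1]) auto
  then have a: "val M1 s1 t \<in> acl L M1 (s1 ` (J \<inter> {..<m}))" using good_acl[OF g1, of "{}"] E by auto
  have "(s2(m := val M2 s2 t)) m \<in> acl L M2 ((s2(m := val M2 s2 t)) ` (J \<inter> {..<m}))"
  proof (rule acl_transfer[OF M1 M2 range_upd[OF s1 v1] range_upd[OF s2 v2] eq'])
    have "(s1(m := val M1 s1 t)) ` (J \<inter> {..<m}) = s1 ` (J \<inter> {..<m})" by (rule image_cong) auto
    then show "(s1(m := val M1 s1 t)) m \<in> acl L M1 ((s1(m := val M1 s1 t)) ` (J \<inter> {..<m}))" using a by simp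
  qed auto
  moreover have "(s2(m := val M2 s2 t)) ` (J \<inter> {..<m}) = s2 ` (J \<inter> {..<m})" by (rule image_cong) auto
  moreover have "s2 ` (J \<inter> {..<m}) \<subseteq> E2" using g2 by (auto simp: good_def)
  ultimately show ?thesis using pair_acl_closed[OF P2] by auto
qed

text \<open>The map \<open>r\<close> records at which entry of the tuple each free variable is
  evaluated; it is needed because a quantified element enters at a position that cannot be
  prescribed.\<close>

theorem back_and_forth:
  assumes "wf_fm PL \<phi>" "good M1 E1 s1 m J K" "good M2 E2 s2 m J K" "eqtp L M1 s1 M2 s2 m" "r ` fv \<phi> \<subseteq> {..<m}"
  shows "sat (pair_struct M1 E1) (\<lambda>i. s1 (r i)) \<phi> \<longleftrightarrow> sat (pair_struct M2 E2) (\<lambda>i. s2 (r i)) \<phi>"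
  using assms
proof (induction \<phi> arbitrary: M1 E1 s1 M2 E2 s2 m J K r)
  case (Equal t u)
  have "expr L {..<m} (\<lambda>(N :: 'u ustruct) v. sat N (\<lambda>i. v (r i)) (Equal t u))"
    by (rule expr_rename_sat) (use Equal.prems in auto)
  from eqtp_expr[OF Equal.prems(4) this] show ?case by simp
next
  case (Rel q ts)
  show ?case
  proof (cases q)
    case None
    then obtain t where t: "ts = [t]" "wf_tm L t" using Rel.prems(1) by (auto simp: length_Suc_conv)
    let ?t = "rename_tm r t"
    have "wf_tm L ?t" "fv_tm ?t \<subseteq> {..<m}" using t Rel.prems(5) by auto
    then have "val M1 s1 ?t \<in> E1 \<longleftrightarrow> val M2 s2 ?t \<in> E2"
      using predicate_transfer[OF Rel.prems(2-4)]
        predicate_transfer[OF Rel.prems(3,2) eqtp_sym[OF Rel.prems(4)]] by blast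
    then show ?thesis using None t by simp
  next
    case (Some q')
    have "expr L {..<m} (\<lambda>(N :: 'u ustruct) v. sat N (\<lambda>i. v (r i)) (Rel q' ts))"
      by (rule expr_rename_sat) (use Rel.prems Some in auto)
    from eqtp_expr[OF Rel.prems(4) this] show ?thesis using Some by simp
  qed
next
  case (Neg \<phi>)
  have "sat (pair_struct M1 E1) (\<lambda>i. s1 (r i)) \<phi> \<longleftrightarrow> sat (pair_struct M2 E2) (\<lambda>i. s2 (r i)) \<phi>"
    by (rule Neg.IH[OF _ Neg.prems(2-4)]) (use Neg.prems in auto)
  then show ?case by simp
next
  case (Conj \<phi> \<psi>)
  have "sat (pair_struct M1 E1) (\<lambda>i. s1 (r i)) \<phi> \<longleftrightarrow> sat (pair_struct M2 E2) (\<lambda>i. s2 (r i)) \<phi>"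
    by (rule Conj.IH(1)[OF _ Conj.prems(2-4)]) (use Conj.prems in auto)
  moreover have "sat (pair_struct M1 E1) (\<lambda>i. s1 (r i)) \<psi> \<longleftrightarrow> sat (pair_struct M2 E2) (\<lambda>i. s2 (r i)) \<psi>"
    by (rule Conj.IH(2)[OF _ Conj.prems(2-4)]) (use Conj.prems in auto)
  ultimately show ?case by simp
next
  case (Exists k \<phi>)
  have dir: "sat (pair_struct M2 E2) (\<lambda>i. s2 (r i)) (Exists k \<phi>)"
    if g1: "good M1 E1 s1 m J K" and g2: "good M2 E2 s2 m J K" and eq: "eqtp L M1 s1 M2 s2 m"
      and sat: "sat (pair_struct M1 E1) (\<lambda>i. s1 (r i)) (Exists k \<phi>)" for M1 E1 s1 M2 E2 s2
  proof -
    obtain x where x: "x \<in> universe M1" "sat (pair_struct M1 E1) ((\<lambda>i. s1 (r i))(k := x)) \<phi>"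
      using sat by auto
    obtain M3 E3 t1 t3 n J' K' j where h: "good M1 E1 t1 n J' K'" "good M3 E3 t3 n J' K'"
      "eqtp L M1 t1 M3 t3 n" "m \<le> n" "\<forall>i<m. t1 i = s1 i"
      "eqtp PL (pair_struct M2 E2) s2 (pair_struct M3 E3) t3 m" "j < n" "t1 j = x"
      using forth[OF g1 g2 eq x(1)] by blast
    have rm: "r i < m" if "i \<in> fv \<phi>" "i \<noteq> k" for i using Exists.prems(5) that by auto
    let ?r = "r(k := j)"
    have "sat (pair_struct M1 E1) ((\<lambda>i. s1 (r i))(k := x)) \<phi> = sat (pair_struct M1 E1) (\<lambda>i. t1 (?r i)) \<phi>"
      by (rule sat_cong) (use h rm in auto)
    moreover have "sat (pair_struct M1 E1) (\<lambda>i. t1 (?r i)) \<phi> \<longleftrightarrow> sat (pair_struct M3 E3) (\<lambda>i. t3 (?r i)) \<phi>"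
    proof (rule Exists.IH[OF _ h(1-3)])
      show "?r ` fv \<phi> \<subseteq> {..<n}"
      proof (rule image_subsetI)
        fix i assume "i \<in> fv \<phi>"
        then show "?r i \<in> {..<n}" using rm[of i] h(4,7) by (cases "i = k") auto
      qed
    qed (use Exists.prems(1) in simp)
    moreover have "sat (pair_struct M3 E3) (\<lambda>i. t3 (?r i)) \<phi> =
      sat (pair_struct M3 E3) ((\<lambda>i. t3 (r i))(k := t3 j)) \<phi>"
      by (rule sat_cong) auto
    moreover have "t3 j \<in> universe M3" using good_range[OF h(2)] by auto
    ultimately have "sat (pair_struct M3 E3) (\<lambda>i. t3 (r i)) (Exists k \<phi>)" using x(2) by auto
    \<comment> \<open>\<open>M3\<close> need not extend \<open>M2\<close>. The existential formula,
      however, only concerns the first \<open>m\<close> entries, whose types over the pair language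
      agree.\<close>
    moreover have "expr PL {..<m} (\<lambda>(N :: ('u, 'u option, 'u) struct) v. sat N (\<lambda>i. v (r i)) (Exists k \<phi>))"
      by (rule expr_rename_sat[OF Exists.prems(1,5)])
    from eqtp_expr[OF h(6) this] have "sat (pair_struct M2 E2) (\<lambda>i. s2 (r i)) (Exists k \<phi>) =
      sat (pair_struct M3 E3) (\<lambda>i. t3 (r i)) (Exists k \<phi>)" .
    ultimately show ?thesis by simp
  qed
  show ?case
    using dir[OF Exists.prems(2-4)] dir[OF Exists.prems(3,2) eqtp_sym[OF Exists.prems(4)]] by blast
qed

end

section \<open>Open sets\<close>

context geometric
begin

text \<open>Boxes of basic sets are given by finitely many parameters, so membership in the interior
  becomes a first-order condition.\<close>

lemma interior_power:
  assumes M: "model M" and y: "y \<in> tuples (universe M) n"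
  shows "y \<in> power_top (top_of M) {..<n} interior_of S \<longleftrightarrow>
    (\<exists>q. (\<forall>j<n. q j ` {..<p} \<subseteq> universe M \<and> y j \<in> basic M (q j)) \<and>
      (\<forall>z\<in>tuples (universe M) n. (\<forall>j<n. z j \<in> basic M (q j)) \<longrightarrow> z \<in> S))" (is "?l \<longleftrightarrow> ?r")
proof
  let ?X = "power_top (top_of M) {..<n}"
  have yj: "y j \<in> universe M" if "j < n" for j using y that by (auto simp: tuples_def)
  {
    assume ?l
    then obtain W where W: "openin ?X W" "y \<in> W" "W \<subseteq> S" by (auto simp: interior_of_def)
    from bspec[OF W(1)[unfolded power_top_def openin_product_topology_alt] W(2)]
    obtain V where V: "\<forall>i\<in>{..<n}. openin (top_of M) (V i)" "y \<in> PiE {..<n} V" "PiE {..<n} V \<subseteq> W"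
      by (elim exE conjE)
    have "\<exists>q. j < n \<longrightarrow> q ` {..<p} \<subseteq> universe M \<and> y j \<in> basic M q \<and> basic M q \<subseteq> V j" for j
      using V(1,2) openin_top[OF M, of "V j"] by (cases "j < n") (auto simp: PiE_iff)
    then have "\<forall>j. \<exists>q. j < n \<longrightarrow> q ` {..<p} \<subseteq> universe M \<and> y j \<in> basic M q \<and> basic M q \<subseteq> V j" by blast
    from choice[OF this] obtain q where
      q: "\<forall>j. j < n \<longrightarrow> q j ` {..<p} \<subseteq> universe M \<and> y j \<in> basic M (q j) \<and> basic M (q j) \<subseteq> V j" ..
    have "z \<in> S" if z: "z \<in> tuples (universe M) n" "\<forall>j<n. z j \<in> basic M (q j)" for z
    proof -
      have "z j \<in> V j" if "j < n" for j using z(2) q that by blast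
      then have "z \<in> PiE {..<n} V" using z(1) by (simp add: tuples_def PiE_iff)
      then show ?thesis using V(3) W(3) by blast
    qed
    then show ?r using q by (intro exI[of _ q]) blast
  }
  assume ?r
  then obtain q where q: "\<forall>j<n. q j ` {..<p} \<subseteq> universe M \<and> y j \<in> basic M (q j)"
    "\<forall>z\<in>tuples (universe M) n. (\<forall>j<n. z j \<in> basic M (q j)) \<longrightarrow> z \<in> S" by blast
  let ?W = "PiE {..<n} (\<lambda>j. basic M (q j))"
  have "openin ?X ?W" unfolding power_top_def
    using q(1) openin_basic[OF M] by (simp add: openin_PiE_gen)
  moreover have "y \<in> ?W" using q(1) y by (auto simp: tuples_def PiE_iff)
  moreover have "?W \<subseteq> S"
  proof
    fix z assume z: "z \<in> ?W"
    then have "z \<in> tuples (universe M) n" by (auto simp: tuples_def PiE_iff basic_def)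
    moreover have "\<forall>j<n. z j \<in> basic M (q j)" using z by (auto simp: PiE_iff)
    ultimately show "z \<in> S" using q(2) by blast
  qed
  ultimately show ?l by (auto simp: interior_of_def)
qed

lemma interior_formula:
  assumes \<phi>: "wf_fm PL \<phi>" "fv \<phi> \<subseteq> {..<m + n}"
  obtains \<iota> where "wf_fm PL \<iota>" "fv \<iota> \<subseteq> {..<m + n}"
    "\<And>M E s y. pair M E \<Longrightarrow> y \<in> tuples (universe M) n \<Longrightarrow>
      sat (pair_struct M E) (append_tuple m s y) \<iota> \<longleftrightarrow>
      y \<in> power_top (top_of M) {..<n} interior_of
        {z \<in> tuples (universe M) n. sat (pair_struct M E) (append_tuple m s z) \<phi>}"
proof -
  \<comment> \<open>Positions: \<open>s\<close> and \<open>y\<close> below \<open>?a\<close>, then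
    the parameters of the box, with entry \<open>l\<close> of factor \<open>j\<close> at offset
    \<open>j * p + l\<close>, and the competing point \<open>z\<close> from \<open>?b\<close>
    on.\<close>
  let ?a = "m + n" and ?b = "m + n + n * p"
  define B where "B = (\<lambda>(N :: ('u, 'u option, 'u) struct) j x w.
    sat (reduct N) (\<lambda>l. if l < p then w (?a + (j * p + l)) else w x) \<theta>')"
  have lt: "j * p + l < n * p" if "j < n" "l < p" for j l
  proof -
    have "j * p + l < Suc j * p" using that(2) by simp
    also have "\<dots> \<le> n * p" using that(1) by (intro mult_le_mono1) simp
    finally show ?thesis .
  qed
  have B: "expr PL {..<c} (\<lambda>N. B N j x)" if "j < n" "x < c" "?b \<le> c" for j x c
    unfolding B_def
  proof (rule expr_lift, rule expr_basic)
    show "(\<lambda>l. ?a + (j * p + l)) ` {..<p} \<subseteq> {..<c}" using lt[OF that(1)] that(3) by fastforce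
  qed (use that in simp)
  define Z where "Z = (\<lambda>(N :: ('u, 'u option, 'u) struct) w. (\<forall>j\<in>{..<n}. B N j (?b + j) w) \<longrightarrow>
    sat N (\<lambda>i. w (if i < m then i else ?b + (i - m))) \<phi>)"
  have Z: "expr PL {..<?b + n} Z" unfolding Z_def
    by (intro expr_imp expr_ball expr_rename_sat[OF \<phi>(1)] B) (use \<phi>(2) in auto)
  define Q where "Q = (\<lambda>(N :: ('u, 'u option, 'u) struct) w. (\<forall>j\<in>{..<n}. B N j (m + j) w) \<and>
    (\<forall>z\<in>tuples (universe N) n. Z N (append_tuple ?b w z)))"
  have "expr PL {..<?b} Q" unfolding Q_def
    by (intro expr_conj expr_ball expr_all_block[OF Z] B) auto
  from expr_ex_block[OF this] obtain \<iota> where \<iota>: "wf_fm PL \<iota>" "fv \<iota> \<subseteq> {..<?a}"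
    "\<And>(N :: ('u, 'u option, 'u) struct) w. sat N w \<iota> \<longleftrightarrow> (\<exists>q\<in>tuples (universe N) (n * p). Q N (append_tuple ?a w q))"
    unfolding expr_def by blast
  show thesis
  proof (rule that[OF \<iota>(1,2)])
    fix M E and s y :: "nat \<Rightarrow> 'u"
    assume P: "pair M E" and y: "y \<in> tuples (universe M) n"
    note M = pair_model[OF P]
    let ?P = "pair_struct M E"
    let ?w = "\<lambda>q. append_tuple ?a (append_tuple m s y) q"
    have yj: "y j \<in> universe M" if "j < n" for j using y that by (auto simp: tuples_def)
    have B1: "B ?P j (m + j) (?w q) \<longleftrightarrow> y j \<in> basic M (\<lambda>l. q (j * p + l))" if "j < n" for j q
    proof -
      have "(\<lambda>l. if l < p then ?w q (?a + (j * p + l)) else ?w q (m + j)) =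
          (\<lambda>l. if l < p then q (j * p + l) else y j)"
        using that by (auto simp: append_tuple_def)
      then show ?thesis unfolding B_def basic_def using yj[OF that] by simp
    qed
    have B2: "B ?P j (?b + j) (append_tuple ?b (?w q) z) \<longleftrightarrow> z j \<in> basic M (\<lambda>l. q (j * p + l))"
      if "j < n" "z \<in> tuples (universe M) n" for j q z
    proof -
      have "(\<lambda>l. if l < p then append_tuple ?b (?w q) z (?a + (j * p + l)) else append_tuple ?b (?w q) z (?b + j)) =
          (\<lambda>l. if l < p then q (j * p + l) else z j)"
        using that(1) lt[OF that(1)] by (auto simp: append_tuple_def)
      moreover have "z j \<in> universe M" using that by (auto simp: tuples_def)
      ultimately show ?thesis unfolding B_def basic_def by simp
    qed
    have S: "sat ?P (\<lambda>i. append_tuple ?b (?w q) z (if i < m then i else ?b + (i - m))) \<phi> =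
        sat ?P (append_tuple m s z) \<phi>" for q z
      by (rule sat_cong) (use \<phi>(2) in \<open>auto simp: append_tuple_def\<close>)
    have Q: "Q ?P (?w q) \<longleftrightarrow> (\<forall>j<n. y j \<in> basic M (\<lambda>l. q (j * p + l))) \<and>
      (\<forall>z\<in>tuples (universe M) n. (\<forall>j<n. z j \<in> basic M (\<lambda>l. q (j * p + l))) \<longrightarrow>
        z \<in> {z \<in> tuples (universe M) n. sat ?P (append_tuple m s z) \<phi>})" for q
      unfolding Q_def Z_def S using B1 B2 by auto
    show "sat ?P (append_tuple m s y) \<iota> \<longleftrightarrow> y \<in> power_top (top_of M) {..<n} interior_of
        {z \<in> tuples (universe M) n. sat ?P (append_tuple m s z) \<phi>}"
      unfolding \<iota>(3) Q interior_power[OF M y]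
    proof
      assume "\<exists>q\<in>tuples (universe ?P) (n * p). (\<forall>j<n. y j \<in> basic M (\<lambda>l. q (j * p + l))) \<and>
        (\<forall>z\<in>tuples (universe M) n. (\<forall>j<n. z j \<in> basic M (\<lambda>l. q (j * p + l))) \<longrightarrow>
          z \<in> {z \<in> tuples (universe M) n. sat ?P (append_tuple m s z) \<phi>})"
      then obtain q where q: "q \<in> tuples (universe M) (n * p)" "\<forall>j<n. y j \<in> basic M (\<lambda>l. q (j * p + l))"
        "\<forall>z\<in>tuples (universe M) n. (\<forall>j<n. z j \<in> basic M (\<lambda>l. q (j * p + l))) \<longrightarrow>
          z \<in> {z \<in> tuples (universe M) n. sat ?P (append_tuple m s z) \<phi>}" by auto
      have "(\<lambda>l. q (j * p + l)) ` {..<p} \<subseteq> universe M" if "j < n" for j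
        using tuples_image[OF q(1)] lt[OF that] by auto
      then show "\<exists>q. (\<forall>j<n. q j ` {..<p} \<subseteq> universe M \<and> y j \<in> basic M (q j)) \<and>
        (\<forall>z\<in>tuples (universe M) n. (\<forall>j<n. z j \<in> basic M (q j)) \<longrightarrow>
          z \<in> {z \<in> tuples (universe M) n. sat ?P (append_tuple m s z) \<phi>})"
        using q(2,3) by (intro exI[of _ "\<lambda>j l. q (j * p + l)"]) simp
    next
      assume "\<exists>q. (\<forall>j<n. q j ` {..<p} \<subseteq> universe M \<and> y j \<in> basic M (q j)) \<and>
        (\<forall>z\<in>tuples (universe M) n. (\<forall>j<n. z j \<in> basic M (q j)) \<longrightarrow>
          z \<in> {z \<in> tuples (universe M) n. sat ?P (append_tuple m s z) \<phi>})"
      then obtain q where q: "\<forall>j<n. q j ` {..<p} \<subseteq> universe M \<and> y j \<in> basic M (q j)"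
        "\<forall>z\<in>tuples (universe M) n. (\<forall>j<n. z j \<in> basic M (q j)) \<longrightarrow>
          z \<in> {z \<in> tuples (universe M) n. sat ?P (append_tuple m s z) \<phi>}" by blast
      \<comment> \<open>Division with remainder by \<open>p\<close> recovers the factor and the
        entry from the offset.\<close>
      define q' where "q' = restrict (\<lambda>i. q (i div p) (i mod p)) {..<n * p}"
      have q'_eq: "q' (j * p + l) = q j l" if "j < n" "l < p" for j l
        using lt[OF that] that(2) by (simp add: q'_def)
      have "q' \<in> tuples (universe M) (n * p)"
        unfolding q'_def
      proof (rule restrict_tuples, rule image_subsetI)
        fix i assume "i \<in> {..<n * p}"
        then have i: "i < n * p" by simp
        then have "0 < p" by (cases p) auto
        then have "i div p < n" "i mod p < p" using i by (simp_all add: less_mult_imp_div_less)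
        then show "q (i div p) (i mod p) \<in> universe M" using q(1) by auto
      qed
      moreover have "basic M (\<lambda>l. q' (j * p + l)) = basic M (q j)" if "j < n" for j
        by (rule basic_cong) (use q'_eq that in simp)
      ultimately show "\<exists>q\<in>tuples (universe ?P) (n * p). (\<forall>j<n. y j \<in> basic M (\<lambda>l. q (j * p + l))) \<and>
        (\<forall>z\<in>tuples (universe M) n. (\<forall>j<n. z j \<in> basic M (\<lambda>l. q (j * p + l))) \<longrightarrow>
          z \<in> {z \<in> tuples (universe M) n. sat ?P (append_tuple m s z) \<phi>})"
        using q by (intro bexI[of _ q']) auto
    qed
  qed
qed

text \<open>Openness of the set defined over \<open>s\<close> is thus part of the type of
  \<open>s\<close>, and passes to every pair with a tuple of this type.\<close>

lemma open_formula:
  assumes \<phi>: "wf_fm PL \<phi>" "fv \<phi> \<subseteq> {..<m + n}"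
  obtains \<omega> where "wf_fm PL \<omega>" "fv \<omega> \<subseteq> {..<m}"
    "\<And>M E s. pair M E \<Longrightarrow> sat (pair_struct M E) s \<omega> \<longleftrightarrow> openin (power_top (top_of M) {..<n})
      {z \<in> tuples (universe M) n. sat (pair_struct M E) (append_tuple m s z) \<phi>}"
proof -
  obtain \<iota> where \<iota>: "wf_fm PL \<iota>" "fv \<iota> \<subseteq> {..<m + n}"
    "\<And>M E s y. pair M E \<Longrightarrow> y \<in> tuples (universe M) n \<Longrightarrow>
      sat (pair_struct M E) (append_tuple m s y) \<iota> \<longleftrightarrow>
      y \<in> power_top (top_of M) {..<n} interior_of
        {z \<in> tuples (universe M) n. sat (pair_struct M E) (append_tuple m s z) \<phi>}"
    by (rule interior_formula[OF \<phi>]) blast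
  have "expr PL {..<m} (\<lambda>(N :: ('u, 'u option, 'u) struct) v. \<forall>y\<in>tuples (universe N) n.
      sat N (append_tuple m v y) \<phi> \<longrightarrow> sat N (append_tuple m v y) \<iota>)"
    by (rule expr_all_block) (intro expr_imp expr_sat \<phi> \<iota>)
  then obtain \<omega> where \<omega>: "wf_fm PL \<omega>" "fv \<omega> \<subseteq> {..<m}" "\<And>(N :: ('u, 'u option, 'u) struct) v. sat N v \<omega> \<longleftrightarrow>
    (\<forall>y\<in>tuples (universe N) n. sat N (append_tuple m v y) \<phi> \<longrightarrow> sat N (append_tuple m v y) \<iota>)"
    unfolding expr_def by blast
  show thesis
  proof (rule that[OF \<omega>(1,2)])
    fix M E and s :: "nat \<Rightarrow> 'u" assume P: "pair M E"
    let ?S = "{z \<in> tuples (universe M) n. sat (pair_struct M E) (append_tuple m s z) \<phi>}"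
    have "sat (pair_struct M E) s \<omega> \<longleftrightarrow> ?S \<subseteq> power_top (top_of M) {..<n} interior_of ?S"
      unfolding \<omega>(3) using \<iota>(3)[OF P] by auto
    also have "\<dots> \<longleftrightarrow> openin (power_top (top_of M) {..<n}) ?S"
      unfolding interior_of_eq[symmetric] using interior_of_subset[of "power_top (top_of M) {..<n}" ?S] by auto
    finally show "sat (pair_struct M E) s \<omega> \<longleftrightarrow> openin (power_top (top_of M) {..<n}) ?S" .
  qed
qed

text \<open>Write y = F(w, s) in the first pair, with w independent over s.  A point of the second pair
  with the same type is of the form F(w', s'), where F is continuous at w'; so w' can be moved,
  without leaving the open set, to a point to which back and forth applies.\<close>

lemma open_invariance:
  assumes g1: "good M1 E1 s1 m J K" and g2: "good M2 E2 s2 m J K"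
    and \<phi>: "wf_fm PL \<phi>" "fv \<phi> \<subseteq> {..<m + n}"
    and eq: "eqtp L M1 s1 M2 s2 (m + n)"
    and op: "openin (power_top (top_of M2) {..<n})
      {z \<in> tuples (universe M2) n. sat (pair_struct M2 E2) (append_tuple m s2 z) \<phi>}"
    and sat2: "sat (pair_struct M2 E2) s2 \<phi>"
  shows "sat (pair_struct M1 E1) s1 \<phi>"
proof -
  note M1 = pair_model[OF good_pair[OF g1]] and s1 = good_range[OF g1]
  let ?Y = "(\<lambda>j. s1 (m + j)) ` {..<n}"
  have Y: "finite ?Y" "?Y \<subseteq> universe M1" using s1 by auto
  obtain t1 m1 J' K' where e: "ext M1 E1 s1 m J K t1 m1 J' K'" and Yt: "?Y \<subseteq> acl L M1 (t1 ` {..<m1})"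
    using ext_finite[OF g1 Y] by blast
  obtain r where r: "m1 = m + r" using e le_Suc_ex unfolding ext_def by blast
  have g1': "good M1 E1 t1 (m + r) J' K'" using ext_good[OF e] r by simp
  note t1 = good_range[OF g1']
  have t1s: "i < m \<Longrightarrow> t1 i = s1 i" for i using e by (simp add: ext_def)
  have gen: "m + i \<in> J' \<union> K'" "t1 (m + i) \<notin> acl L M1 (t1 ` {..<m + i})" if "i < r" for i
    using e r that by (simp_all add: ext_def)
  have t1U: "t1 ` {..<m + r} \<subseteq> universe M1" using t1 by auto
  have "\<exists>\<kappa>. j < n \<longrightarrow> functional L (m + r) \<kappa> \<and> sat M1 (t1(m + r := s1 (m + j))) \<kappa>" for j
    using Yt acl_functional[OF M1 t1U, of "s1 (m + j)"] unfolding r by blast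
  then have "\<forall>j. \<exists>\<kappa>. j < n \<longrightarrow> functional L (m + r) \<kappa> \<and> sat M1 (t1(m + r := s1 (m + j))) \<kappa>" by blast
  from choice[OF this] obtain \<kappa> where
    "\<forall>j. j < n \<longrightarrow> functional L (m + r) (\<kappa> j) \<and> sat M1 (t1(m + r := s1 (m + j))) (\<kappa> j)" ..
  then have \<kappa>: "functional L (m + r) (\<kappa> j)" "sat M1 (t1(m + r := s1 (m + j))) (\<kappa> j)" if "j < n" for j
    using that by blast+
  have \<kappa>fv: "i \<le> m + r" if "j < n" "i \<in> fv (\<kappa> j)" for i j using functional_fv[OF \<kappa>(1)] that by force
  \<comment> \<open>Both the point and the generators over which it is algebraic occupy positions
    from \<open>m\<close> on. In \<open>c1\<close> the generators are put after the point, so that a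
    single type extension copies both.\<close>
  define c1 where "c1 i = (if i < m + n then s1 i else t1 (i - n))" for i
  have c1: "range c1 \<subseteq> universe M1" using s1 t1 by (auto simp: c1_def)
  have "eqtp L M1 c1 M2 s2 (m + n)" by (rule eqtp_cong[OF eq]) (simp_all add: c1_def)
  then obtain M' E' c' where P': "pair M' E'" and c': "range c' \<subseteq> universe M'"
    and pe: "eqtp PL (pair_struct M2 E2) s2 (pair_struct M' E') c' (m + n)"
    and le: "eqtp L M1 c1 M' c' (m + n + r)"
    by (rule type_extension[OF c1 good_pair[OF g2] good_range[OF g2], of "m + n" r])
  note M' = pair_model[OF P']
  define s' where "s' i = (if i < m then c' i else c' (n + i))" for i
  have s': "range s' \<subseteq> universe M'" using c' by (auto simp: s'_def)
  have le': "eqtp L M1 t1 M' s' (m + r)"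
    by (rule eqtp_rename[OF le, of _ "\<lambda>i. if i < m then i else n + i"]) (auto simp: c1_def s'_def t1s)
  have pe': "eqtp PL (pair_struct M2 E2) s2 (pair_struct M' E') s' m"
    by (rule eqtp_cong[OF eqtp_mono[OF pe]]) (auto simp: s'_def)
  have g': "good M' E' s' m J' K'"
    by (rule good_cong[OF good_transfer[OF g2 P' s' pe'] s']) (use e in \<open>simp_all add: ext_def\<close>)
  define y' where "y' = restrict (\<lambda>j. c' (m + j)) {..<n}"
  have y': "y' \<in> tuples (universe M') n" unfolding y'_def by (rule restrict_tuples) (use c' in auto)
  have \<kappa>': "sat M' (s'(m + r := y' j)) (\<kappa> j)" if j: "j < n" for j
  proof -
    let ?r = "\<lambda>i. if i < m then i else if i < m + r then n + i else m + j"
    have "expr L {..<m + n + r} (\<lambda>(N :: 'u ustruct) v. sat N (\<lambda>i. v (?r i)) (\<kappa> j))"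
      by (rule expr_rename_sat[OF functional_wf[OF \<kappa>(1)[OF j]]]) (use j in auto)
    from eqtp_expr[OF le this] have "sat M1 (\<lambda>i. c1 (?r i)) (\<kappa> j) = sat M' (\<lambda>i. c' (?r i)) (\<kappa> j)" .
    moreover have "sat M1 (\<lambda>i. c1 (?r i)) (\<kappa> j) = sat M1 (t1(m + r := s1 (m + j))) (\<kappa> j)"
    proof (rule sat_cong)
      fix i assume "i \<in> fv (\<kappa> j)"
      then show "c1 (?r i) = (t1(m + r := s1 (m + j))) i"
        using \<kappa>fv[OF j, of i] j t1s[of i] by (auto simp: c1_def)
    qed
    moreover have "sat M' (\<lambda>i. c' (?r i)) (\<kappa> j) = sat M' (s'(m + r := y' j)) (\<kappa> j)"
    proof (rule sat_cong)
      fix i assume "i \<in> fv (\<kappa> j)"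
      then show "c' (?r i) = (s'(m + r := y' j)) i"
        using \<kappa>fv[OF j, of i] j by (auto simp: s'_def y'_def)
    qed
    ultimately show ?thesis using \<kappa>(2)[OF j] by simp
  qed
  let ?U = "{z \<in> tuples (universe M') n. sat (pair_struct M' E') (append_tuple m s' z) \<phi>}"
  obtain \<omega> where \<omega>: "wf_fm PL \<omega>" "fv \<omega> \<subseteq> {..<m}"
    "\<And>M E s. pair M E \<Longrightarrow> sat (pair_struct M E) s \<omega> \<longleftrightarrow> openin (power_top (top_of M) {..<n})
      {z \<in> tuples (universe M) n. sat (pair_struct M E) (append_tuple m s z) \<phi>}"
    by (rule open_formula[OF \<phi>]) blast
  have U: "openin (power_top (top_of M') {..<n}) ?U"
    using op pe' \<omega>(1,2) unfolding \<omega>(3)[OF good_pair[OF g2], symmetric] \<omega>(3)[OF P', symmetric] eqtp_def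
    by blast
  have "sat (pair_struct M' E') c' \<phi>" using sat2 pe \<phi> unfolding eqtp_def by blast
  moreover have "sat (pair_struct M' E') (append_tuple m s' y') \<phi> = sat (pair_struct M' E') c' \<phi>"
    by (rule sat_cong) (use \<phi>(2) in \<open>auto simp: append_tuple_def s'_def y'_def\<close>)
  ultimately have y'U: "y' \<in> ?U" using y' by simp
  \<comment> \<open>The formula \<open>\<eta>\<close> obtained from \<open>Q\<close> speaks of the
    parameters and generators only: the point computed from them by the formulas
    \<open>\<kappa> j\<close> satisfies \<open>\<phi>\<close>. It holds on the whole box, as the
    point does not leave the open set there, and so it can be imposed on the moved
    generators.\<close>
  define Q where "Q = (\<lambda>(N :: ('u, 'u option, 'u) struct) w.
    (\<forall>j\<in>{..<n}. sat (reduct N) (\<lambda>i. w (if i < m + r then i else m + r + j)) (\<kappa> j)) \<and>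
    sat N (\<lambda>i. w (if i < m then i else r + i)) \<phi>)"
  have "expr PL {..<m + r + n} Q"
    unfolding Q_def
  proof (intro expr_conj expr_ball expr_rename_sat[OF \<phi>(1)])
    show "expr PL {..<m + r + n} (\<lambda>N w. sat (reduct N) (\<lambda>i. w (if i < m + r then i else m + r + j)) (\<kappa> j))"
      if "j \<in> {..<n}" for j
      by (rule expr_lift, rule expr_rename_sat) (use that functional_wf[OF \<kappa>(1)] in auto)
  qed (use \<phi>(2) in auto)
  from expr_ex_block[OF this] obtain \<eta> where \<eta>: "wf_fm PL \<eta>" "fv \<eta> \<subseteq> {..<m + r}"
    "\<And>(N :: ('u, 'u option, 'u) struct) w. sat N w \<eta> \<longleftrightarrow> (\<exists>y\<in>tuples (universe N) n. Q N (append_tuple (m + r) w y))"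
    unfolding expr_def by blast
  have Q: "Q (pair_struct N F) (append_tuple (m + r) w y) \<longleftrightarrow>
    (\<forall>j<n. sat N (w(m + r := y j)) (\<kappa> j)) \<and> sat (pair_struct N F) (append_tuple m w y) \<phi>" for N F w y
  proof -
    have "sat N (\<lambda>i. append_tuple (m + r) w y (if i < m + r then i else m + r + j)) (\<kappa> j) =
        sat N (w(m + r := y j)) (\<kappa> j)" if j: "j < n" for j
    proof (rule sat_cong)
      fix i assume "i \<in> fv (\<kappa> j)"
      then show "append_tuple (m + r) w y (if i < m + r then i else m + r + j) = (w(m + r := y j)) i"
        using \<kappa>fv[OF j, of i] by (auto simp: append_tuple_def)
    qed
    moreover have "sat (pair_struct N F) (\<lambda>i. append_tuple (m + r) w y (if i < m then i else r + i)) \<phi> =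
        sat (pair_struct N F) (append_tuple m w y) \<phi>"
      by (rule sat_cong) (auto simp: append_tuple_def intro: arg_cong[of _ _ y])
    ultimately show ?thesis unfolding Q_def by auto
  qed
  have box: "\<exists>V. (\<forall>i<r. openin (top_of M') (V i) \<and> V i \<noteq> {}) \<and>
      (\<forall>v. range v \<subseteq> universe M' \<longrightarrow> (\<forall>i<m. v i = s' i) \<longrightarrow> (\<forall>i<r. v (m + i) \<in> V i) \<longrightarrow>
        sat M' v \<psi> \<and> sat (pair_struct M' E') v \<eta>)"
    if \<psi>: "wf_fm L \<psi>" "fv \<psi> \<subseteq> {..<m + r}" "sat M' s' \<psi>" for \<psi>
  proof -
    have gen': "s' (m + i) \<notin> acl L M' (s' ` {..<m + i})" if "i < r" for i
      by (rule generators_transfer[OF M1 M' t1 s' le']) (use that gen in auto)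
    have "\<exists>V. (\<forall>i<r. openin (top_of M') (V i) \<and> V i \<noteq> {}) \<and>
        (\<forall>v. range v \<subseteq> universe M' \<longrightarrow> (\<forall>i<m. v i = s' i) \<longrightarrow> (\<forall>i<r. v (m + i) \<in> V i) \<longrightarrow>
          sat M' v \<psi> \<and> (\<exists>y\<in>?U. \<forall>j<n. sat M' (v(m + r := y j)) (\<kappa> j)))"
      by (rule neighbourhood[OF M' s' gen' \<psi> \<kappa>(1) \<kappa>' U y'U])
    then obtain V where
      V: "\<forall>i<r. openin (top_of M') (V i) \<and> V i \<noteq> {}"
        "\<forall>v. range v \<subseteq> universe M' \<longrightarrow> (\<forall>i<m. v i = s' i) \<longrightarrow> (\<forall>i<r. v (m + i) \<in> V i) \<longrightarrow>
          sat M' v \<psi> \<and> (\<exists>y\<in>?U. \<forall>j<n. sat M' (v(m + r := y j)) (\<kappa> j))"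
      by (elim exE conjE)
    show ?thesis
    proof (intro exI[of _ V] conjI V(1) allI impI)
      fix v assume v: "range v \<subseteq> universe M'" "\<forall>i<m. v i = s' i" "\<forall>i<r. v (m + i) \<in> V i"
      then show "sat M' v \<psi>" using V(2) by blast
      obtain y where y: "y \<in> ?U" "\<forall>j<n. sat M' (v(m + r := y j)) (\<kappa> j)" using V(2) v by blast
      have "append_tuple m v y = append_tuple m s' y" using v(2) by (auto simp: append_tuple_def)
      then have "Q (pair_struct M' E') (append_tuple (m + r) v y)" unfolding Q using y by simp
      then show "sat (pair_struct M' E') v \<eta>" unfolding \<eta>(3) using y(1) by auto
    qed
  qed
  obtain M3 E3 s3 where g3: "good M3 E3 s3 (m + r) J' K'" and le3: "eqtp L M1 t1 M3 s3 (m + r)"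
    and \<eta>3: "sat (pair_struct M3 E3) s3 \<eta>"
    by (rule realize_generators[OF g1' gen(1) g' le' \<eta>(1) box])
  \<comment> \<open>Back in the first pair, functionality forces the point provided by
    \<open>\<eta>\<close> to be the original one.\<close>
  have "sat (pair_struct M1 E1) t1 \<eta>"
    using back_and_forth[OF \<eta>(1) g1' g3 le3, of "\<lambda>i. i"] \<eta>(2) \<eta>3 by simp
  then obtain y where y: "y \<in> tuples (universe M1) n" "\<forall>j<n. sat M1 (t1(m + r := y j)) (\<kappa> j)"
    "sat (pair_struct M1 E1) (append_tuple m t1 y) \<phi>" unfolding \<eta>(3) Q by auto
  have ys: "y j = s1 (m + j)" if j: "j < n" for j
    by (rule functional_unique[OF \<kappa>(1)[OF j] y(2)[rule_format, OF j] \<kappa>(2)[OF j]])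
      (use y(1) j s1 in \<open>auto simp: tuples_def\<close>)
  have "sat (pair_struct M1 E1) (append_tuple m t1 y) \<phi> = sat (pair_struct M1 E1) s1 \<phi>"
  proof (rule sat_cong)
    fix i assume "i \<in> fv \<phi>"
    then have "i < m + n" using \<phi>(2) by auto
    then show "append_tuple m t1 y i = s1 i" using t1s[of i] ys[of "i - m"] by (auto simp: append_tuple_def)
  qed
  then show ?thesis using y(3) by simp
qed

end

section \<open>Special sets\<close>

context geometric
begin

lemma good_add_fresh:
  assumes g: "good M E s m J K" and x: "x \<in> universe M"
    and cases: "x \<in> E \<or> x \<notin> acl L M (E \<union> s ` {..<m}) \<or> x \<in> acl L M (s ` {..<m})"
  shows "\<exists>t J' K'. good M E t (Suc m) J' K' \<and> t ` {..<Suc m} = insert x (s ` {..<m})"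
proof -
  define t where "t = s(m := x)"
  have t: "\<And>i. i < m \<Longrightarrow> t i = s i" "t m = x" by (simp_all add: t_def)
  have rt: "range t \<subseteq> universe M" unfolding t_def by (rule range_upd[OF good_range[OF g] x])
  have "t ` {..<m} = s ` {..<m}" by (rule image_cong_less[of m]) (use t in auto)
  then have im: "t ` {..<Suc m} = insert x (s ` {..<m})" by (simp add: lessThan_Suc t(2))
  have "\<exists>J' K'. good M E t (Suc m) J' K'"
    using cases good_add[OF g rt t(1)] unfolding t(2) by blast
  then show ?thesis using im by blast
qed

text \<open>The order in which the elements are appended is not controlled, so the condition on
  \<open>x\<close> is required over every set of other elements that may precede it.\<close>

lemma good_add_finite:
  fixes m :: nat
  assumes g: "good M E s m J K" and X: "finite X" "X \<subseteq> universe M"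
    and step: "\<And>x Y. x \<in> X \<Longrightarrow> Y \<subseteq> X - {x} \<Longrightarrow> x \<in> E \<or>
      x \<notin> acl L M (E \<union> (s ` {..<m} \<union> Y)) \<or> x \<in> acl L M (s ` {..<m} \<union> Y)"
  shows "\<exists>t n J' K'. good M E t n J' K' \<and> t ` {..<n} = s ` {..<m} \<union> X"
proof -
  have "\<exists>t n J' K'. good M E t n J' K' \<and> t ` {..<n} = s ` {..<m} \<union> Y" if "finite Y" "Y \<subseteq> X" for Y
    using that
  proof (induction Y rule: finite_induct)
    case empty
    then show ?case using g by auto
  next
    case (insert x Y)
    then obtain t n J' K' where t: "good M E t n J' K'" "t ` {..<n} = s ` {..<m} \<union> Y" by auto
    have x: "x \<in> universe M" "x \<in> X" "Y \<subseteq> X - {x}" using insert X(2) by auto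
    from good_add_fresh[OF t(1) x(1), unfolded t(2), OF step[OF x(2,3)]]
    obtain t' J'' K'' where t': "good M E t' (Suc n) J'' K''" "t' ` {..<Suc n} = insert x (s ` {..<m} \<union> Y)"
      by blast
    then have "t' ` {..<Suc n} = s ` {..<m} \<union> insert x Y" by simp
    then show ?case using t'(1) by blast
  qed
  then show ?thesis using X(1) by blast
qed

lemma acl_finite_subset:
  assumes "finite F" "F \<subseteq> acl L M X"
  shows "\<exists>G. finite G \<and> G \<subseteq> X \<and> F \<subseteq> acl L M G"
  using assms
proof (induction F rule: finite_induct)
  case (insert x F)
  then obtain G where G: "finite G" "G \<subseteq> X" "F \<subseteq> acl L M G" by auto
  obtain H where H: "finite H" "H \<subseteq> X" "x \<in> acl L M H"
    using acl_finitary[of x L M X] insert.prems by auto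
  have "insert x F \<subseteq> acl L M (G \<union> H)"
    using G(3) H(3) acl_mono[of G "G \<union> H" L M] acl_mono[of H "G \<union> H" L M] by auto
  then show ?case using G H by (intro exI[of _ "G \<union> H"]) simp
qed auto

text \<open>A basis \<open>I\<close> of \<open>F\<close> over \<open>E \<inter> A\<close> contains a
  basis over \<open>E\<close>. As both dimensions agree, it is all of \<open>I\<close>, so
  \<open>I\<close> is independent over \<open>E\<close> and supplies the generators outside
  \<open>E\<close>.\<close>

lemma special_good:
  assumes P: "pair M E" and A: "special L M E A" and F: "finite F" "F \<subseteq> A"
  shows "\<exists>s m J K. good M E s m J K \<and> s ` {..<m} \<subseteq> A \<and> F \<subseteq> s ` {..<m}"
proof -
  interpret pregeometry "universe M" "acl L M" by (rule acl_pregeometry[OF pair_model[OF P]])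
  have AU: "A \<subseteq> universe M" and EU: "E \<subseteq> universe M" using A pair_subset[OF P] by (auto simp: special_def)
  have FU: "F \<subseteq> universe M" using F AU by blast
  obtain as where as: "set as = F" using finite_list[OF F(1)] by blast
  let ?B = "E \<inter> A"
  let ?dim = "\<lambda>B d. \<exists>I. acl_basis L M F B I \<and> card I = d"
  have spanF: "F \<subseteq> acl L M (B \<union> F)" if "B \<subseteq> universe M" for B
    using cl_incr[of "B \<union> F"] that FU by blast
  have basis: "\<exists>J. J \<subseteq> I \<and> acl_basis L M F B J" if BI: "B \<subseteq> universe M" "I \<subseteq> F" "F \<subseteq> acl L M (B \<union> I)" for B I
  proof -
    have fI: "finite I" and sub: "B \<union> I \<subseteq> universe M" using BI F(1) FU finite_subset by auto
    show ?thesis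
    proof (rule basis_in_spanning[OF fI sub BI(3)])
      fix J assume J: "J \<subseteq> I" "F \<subseteq> acl L M (B \<union> J)" "\<And>a. a \<in> J \<Longrightarrow> a \<notin> acl L M (B \<union> (J - {a}))"
      have "acl_basis L M F B J" unfolding acl_basis_def using J BI(2) by auto
      with J(1) show ?thesis by (intro exI[of _ J]) simp
    qed
  qed
  have BU: "?B \<subseteq> universe M" using EU by blast
  have "\<exists>d. ?dim ?B d" using basis[OF BU subset_refl spanF[OF BU]] by blast
  then have "?dim ?B (acl_dim L M as ?B)" unfolding acl_dim_def as by (rule LeastI_ex)
  then obtain I where I: "acl_basis L M F ?B I" "card I = acl_dim L M as ?B" by blast
  have IF: "I \<subseteq> F" and span: "F \<subseteq> acl L M (?B \<union> I)" using I(1) by (auto simp: acl_basis_def)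
  have fI: "finite I" using IF F(1) finite_subset by blast
  have "F \<subseteq> acl L M (E \<union> I)" using span cl_mono[of "?B \<union> I" "E \<union> I"] by blast
  from basis[OF EU IF this] obtain J where J: "J \<subseteq> I" "acl_basis L M F E J" by blast
  \<comment> \<open>Both dimensions are minima: \<open>I\<close> attains the one over
    \<open>E \<inter> A\<close>, and \<open>J\<close> is bounded below by the one over
    \<open>E\<close>.\<close>
  have "acl_dim L M as E \<le> card J" unfolding acl_dim_def as by (rule Least_le) (use J(2) in blast)
  moreover have "acl_dim L M as E = acl_dim L M as ?B" using A F(2) as by (simp add: special_def)
  ultimately have "J = I" using card_seteq[OF fI J(1)] I(2) by simp
  then have ind: "a \<notin> acl L M (E \<union> (I - {a}))" if "a \<in> I" for a using J(2) that by (simp add: acl_basis_def)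
  obtain G where G: "finite G" "G \<subseteq> ?B \<union> I" "F \<subseteq> acl L M G" using acl_finite_subset[OF F(1) span] by blast
  \<comment> \<open>The finitely many elements of \<open>E \<inter> A\<close> over which, together
    with \<open>I\<close>, all of \<open>F\<close> is algebraic. They precede \<open>I\<close> in
    the tuple, and \<open>F\<close> follows as its dependent part.\<close>
  let ?c = "G \<inter> ?B"
  have cE: "?c \<subseteq> E" by blast
  obtain d where "d \<in> universe M" using universe_nonempty[OF pair_model[OF P]] by blast
  then have g0: "good M E (\<lambda>_. d) 0 {} {}" using P by (auto simp: good_def)
  have fc: "finite ?c" using G(1) by simp
  have "\<exists>t n J' K'. good M E t n J' K' \<and> t ` {..<n} = (\<lambda>_. d) ` {..<0 :: nat} \<union> ?c"
    by (rule good_add_finite[OF g0 fc]) (use EU in auto)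
  then obtain s1 m1 J1 K1 where g1: "good M E s1 m1 J1 K1" "s1 ` {..<m1} = ?c" by auto
  have "\<exists>t n J' K'. good M E t n J' K' \<and> t ` {..<n} = s1 ` {..<m1} \<union> I"
  proof (rule good_add_finite[OF g1(1) fI])
    show "I \<subseteq> universe M" using IF FU by blast
    fix x Y assume x: "x \<in> I" "Y \<subseteq> I - {x}"
    have sub: "E \<union> (s1 ` {..<m1} \<union> Y) \<subseteq> E \<union> (I - {x})" using x(2) unfolding g1(2) by blast
    have "x \<notin> acl L M (E \<union> (s1 ` {..<m1} \<union> Y))" using ind[OF x(1)] cl_mono[OF sub] by blast
    then show "x \<in> E \<or> x \<notin> acl L M (E \<union> (s1 ` {..<m1} \<union> Y)) \<or> x \<in> acl L M (s1 ` {..<m1} \<union> Y)" by blast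
  qed
  then obtain s2 m2 J2 K2 where g2: "good M E s2 m2 J2 K2" "s2 ` {..<m2} = ?c \<union> I"
    unfolding g1(2) by blast
  have "\<exists>t n J' K'. good M E t n J' K' \<and> t ` {..<n} = s2 ` {..<m2} \<union> F"
  proof (rule good_add_finite[OF g2(1) F(1) FU])
    fix x Y assume x: "x \<in> F"
    have "G \<subseteq> s2 ` {..<m2} \<union> Y" using G(2) unfolding g2(2) by blast
    then have "x \<in> acl L M (s2 ` {..<m2} \<union> Y)" using cl_mono G(3) x by blast
    then show "x \<in> E \<or> x \<notin> acl L M (E \<union> (s2 ` {..<m2} \<union> Y)) \<or> x \<in> acl L M (s2 ` {..<m2} \<union> Y)" by blast
  qed
  then obtain s m J K where "good M E s m J K" "s ` {..<m} = (?c \<union> I) \<union> F" unfolding g2(2) by blast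
  moreover have "(?c \<union> I) \<union> F \<subseteq> A" using IF F(2) by blast
  ultimately show ?thesis by (intro exI[of _ s] exI[of _ m] exI[of _ J] exI[of _ K]) simp
qed

section \<open>Open definable sets\<close>

lemma pair_extension_ex:
  assumes "pair M E" "range s \<subseteq> universe M" "\<And>\<phi>. \<phi> \<in> \<Sigma> \<Longrightarrow> wf_fm PL \<phi>"
    "\<And>\<Delta>. finite \<Delta> \<Longrightarrow> \<Delta> \<subseteq> \<Sigma> \<Longrightarrow> \<exists>v. range v \<subseteq> universe M \<and> (\<forall>i<m. v i = s i) \<and>
      (\<forall>\<phi>\<in>\<Delta>. sat (pair_struct M E) v \<phi>)"
  shows "\<exists>M' E' s'. pair M' E' \<and> range s' \<subseteq> universe M' \<and>
    eqtp PL (pair_struct M E) s (pair_struct M' E') s' m \<and> (\<forall>\<phi>\<in>\<Sigma>. sat (pair_struct M' E') s' \<phi>)"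
proof (rule pair_extension[OF assms])
  fix M' E' s' assume "pair M' E'" "range s' \<subseteq> universe M'"
    "eqtp PL (pair_struct M E) s (pair_struct M' E') s' m"
    "\<And>\<phi>. \<phi> \<in> \<Sigma> \<Longrightarrow> sat (pair_struct M' E') s' \<phi>"
  then show ?thesis by (intro exI[of _ M'] exI[of _ E'] exI[of _ s']) simp
qed

text \<open>A separation argument. If no \<open>L\<close>-formula over \<open>s\<close> defines
  \<open>X\<close>, compactness yields two points of the same \<open>L\<close>-type over copies of
  \<open>s\<close>, one satisfying \<open>\<phi>\<close> and the other not, which contradicts
  \<open>open_invariance\<close>.\<close>

theorem open_definable:
  assumes P: "pair M E" and A: "special L M E A" and op: "openin (power_top (top_of M) {..<n}) X"
    and X: "definable_set PL (pair_struct M E) A n X"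
  shows "definable_set L M A n X"
proof -
  let ?P = "pair_struct M E"
  note M = pair_model[OF P]
  obtain \<phi>0 k b where b: "b \<in> tuples A k" "wf_fm PL \<phi>0" "fv \<phi>0 \<subseteq> {..<n + k}"
    and X0: "X = {x \<in> tuples (universe M) n. sat ?P (append_tuple n x b) \<phi>0}"
    using X by (auto simp: definable_set_def)
  obtain s m J K where g: "good M E s m J K" and sA: "s ` {..<m} \<subseteq> A" and bs: "b ` {..<k} \<subseteq> s ` {..<m}"
    using special_good[OF P A _ tuples_image[OF b(1)]] by auto
  note s = good_range[OF g]
  have "\<exists>l. j < k \<longrightarrow> l < m \<and> b j = s l" for j using bs by (cases "j < k") auto
  then have "\<forall>j. \<exists>l. j < k \<longrightarrow> l < m \<and> b j = s l" by blast
  from choice[OF this] obtain \<rho> where \<rho>: "\<forall>j. j < k \<longrightarrow> \<rho> j < m \<and> b j = s (\<rho> j)" ..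
  define \<phi> where "\<phi> = rename (\<lambda>i. if i < n then m + i else \<rho> (i - n)) \<phi>0"
  have \<phi>: "wf_fm PL \<phi>" "fv \<phi> \<subseteq> {..<m + n}"
  proof -
    show "wf_fm PL \<phi>" unfolding \<phi>_def using b(2) by simp
    show "fv \<phi> \<subseteq> {..<m + n}" unfolding \<phi>_def
    proof (rule fv_renameI)
      fix i assume "i \<in> fv \<phi>0"
      then have "i < n + k" using b(3) by auto
      then have "i < n \<or> \<rho> (i - n) < m" using \<rho>[rule_format, of "i - n"] by fastforce
      then show "(if i < n then m + i else \<rho> (i - n)) \<in> {..<m + n}" by auto
    qed
  qed
  have "sat ?P (append_tuple m s x) \<phi> = sat ?P (append_tuple n x b) \<phi>0" for x
    unfolding \<phi>_def sat_rename
  proof (rule sat_cong)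
    fix i assume "i \<in> fv \<phi>0"
    then have "i < n + k" using b(3) by auto
    then have "i < n \<or> \<rho> (i - n) < m \<and> b (i - n) = s (\<rho> (i - n))"
      using \<rho>[rule_format, of "i - n"] by fastforce
    then show "append_tuple m s x (if i < n then m + i else \<rho> (i - n)) = append_tuple n x b i"
      by (auto simp: append_tuple_def)
  qed
  then have X\<phi>: "X = {x \<in> tuples (universe M) n. sat ?P (append_tuple m s x) \<phi>}" using X0 by simp
  obtain \<omega> where \<omega>: "wf_fm PL \<omega>" "fv \<omega> \<subseteq> {..<m}"
    "\<And>M E s. pair M E \<Longrightarrow> sat (pair_struct M E) s \<omega> \<longleftrightarrow> openin (power_top (top_of M) {..<n})
      {z \<in> tuples (universe M) n. sat (pair_struct M E) (append_tuple m s z) \<phi>}"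
    by (rule open_formula[OF \<phi>]) blast
  have \<omega>s: "sat ?P s \<omega>" using \<omega>(3)[OF P] op X\<phi> by simp
  \<comment> \<open>Beyond \<open>m + n\<close>, the default value of a tuple is replaced by entries
    of \<open>s\<close>, so that the assignment stays inside the universe.\<close>
  define val where "val x i = (if i < m + n then append_tuple m s x i else s i)" for x i
  have val: "range (val x) \<subseteq> universe M" "\<forall>i<m. val x i = s i" if "x \<in> tuples (universe M) n" for x
    using s that by (auto simp: val_def append_tuple_def tuples_def image_subset_iff)
  have val_sat: "sat N (val x) \<psi> = sat N (append_tuple m s x) \<psi>" if "fv \<psi> \<subseteq> {..<m + n}"
    for N :: "('u, 'v, 'u) struct" and x \<psi>
    by (rule sat_cong) (use that in \<open>auto simp: val_def\<close>)
  \<comment> \<open>The \<open>L\<close>-consequences of \<open>\<phi>\<close> over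
    \<open>s\<close>. A point satisfying all of them has an \<open>L\<close>-type that is finitely
    satisfiable together with \<open>\<phi>\<close>, as otherwise the negation of a formula true at
    it would belong to \<open>C\<close>.\<close>
  define C where "C = {\<psi>. wf_fm L \<psi> \<and> fv \<psi> \<subseteq> {..<m + n} \<and>
    (\<forall>x\<in>tuples (universe M) n. sat ?P (val x) \<phi> \<longrightarrow> sat M (val x) \<psi>)}"
  have "\<exists>\<psi>. wf_fm L \<psi> \<and> fv \<psi> \<subseteq> {..<m + n} \<and> (\<forall>x\<in>tuples (universe M) n. sat ?P (val x) \<phi> \<longleftrightarrow> sat M (val x) \<psi>)"
  proof (rule ccontr)
    assume no: "\<not> ?thesis"
    have wf1: "wf_fm PL \<psi>" if "\<psi> \<in> insert (Neg \<phi>) (lift ` C)" for \<psi> using that \<phi>(1) by (auto simp: C_def)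
    have fin1: "\<exists>v. range v \<subseteq> universe M \<and> (\<forall>i<m. v i = s i) \<and> (\<forall>\<psi>\<in>\<Delta>. sat ?P v \<psi>)"
      if \<Delta>: "finite \<Delta>" "\<Delta> \<subseteq> insert (Neg \<phi>) (lift ` C)" for \<Delta>
    proof -
      have sub: "finite (\<Delta> - {Neg \<phi>})" "\<Delta> - {Neg \<phi>} \<subseteq> lift ` C" using \<Delta> by auto
      obtain D where D: "D \<subseteq> C" "finite D" "\<Delta> - {Neg \<phi>} = lift ` D" using finite_subset_image[OF sub] by blast
      obtain \<psi> where \<psi>: "wf_fm L \<psi>" "fv \<psi> \<subseteq> {..<m + n}" "\<And>(N :: 'u ustruct) v. sat N v \<psi> \<longleftrightarrow> (\<forall>\<phi>\<in>D. sat N v \<phi>)"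
        by (rule conj_formula[OF D(2), of "{..<m + n}"]) (use D(1) in \<open>auto simp: C_def\<close>)
      obtain x where x: "x \<in> tuples (universe M) n" "\<not> (sat ?P (val x) \<phi> \<longleftrightarrow> sat M (val x) \<psi>)"
        using no \<psi>(1,2) by blast
      moreover have "sat ?P (val x) \<phi> \<longrightarrow> sat M (val x) \<psi>"
        unfolding \<psi>(3) using D(1) x(1) by (auto simp: C_def)
      ultimately have sx: "\<not> sat ?P (val x) \<phi>" "\<forall>\<phi>\<in>D. sat M (val x) \<phi>" using \<psi>(3) by blast+
      have "\<forall>\<psi>\<in>\<Delta>. sat ?P (val x) \<psi>"
      proof
        fix \<psi> assume "\<psi> \<in> \<Delta>"
        then have "\<psi> = Neg \<phi> \<or> \<psi> \<in> lift ` D" using D(3) by blast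
        then show "sat ?P (val x) \<psi>" using sx by auto
      qed
      then show ?thesis using val[OF x(1)] by blast
    qed
    have "\<exists>M' E' s'. pair M' E' \<and> range s' \<subseteq> universe M' \<and>
        eqtp PL ?P s (pair_struct M' E') s' m \<and> (\<forall>\<psi>\<in>insert (Neg \<phi>) (lift ` C). sat (pair_struct M' E') s' \<psi>)"
      by (rule pair_extension_ex[OF P s wf1 fin1])
    then obtain M2 E2 s2 where P2: "pair M2 E2" and s2: "range s2 \<subseteq> universe M2"
      and e2: "eqtp PL ?P s (pair_struct M2 E2) s2 m"
      and sat2: "\<forall>\<psi>\<in>insert (Neg \<phi>) (lift ` C). sat (pair_struct M2 E2) s2 \<psi>"
      by (elim exE conjE)
    let ?T = "{\<psi>. wf_fm L \<psi> \<and> fv \<psi> \<subseteq> {..<m + n} \<and> sat M2 s2 \<psi>}"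
    have wf2: "wf_fm PL \<psi>" if "\<psi> \<in> insert \<phi> (lift ` ?T)" for \<psi> using that \<phi>(1) by auto
    have fin2: "\<exists>v. range v \<subseteq> universe M \<and> (\<forall>i<m. v i = s i) \<and> (\<forall>\<psi>\<in>\<Delta>. sat ?P v \<psi>)"
      if \<Delta>: "finite \<Delta>" "\<Delta> \<subseteq> insert \<phi> (lift ` ?T)" for \<Delta>
    proof -
      have sub: "finite (\<Delta> - {\<phi>})" "\<Delta> - {\<phi>} \<subseteq> lift ` ?T" using \<Delta> by auto
      obtain D where D: "D \<subseteq> ?T" "finite D" "\<Delta> - {\<phi>} = lift ` D" using finite_subset_image[OF sub] by blast
      obtain \<psi> where \<psi>: "wf_fm L \<psi>" "fv \<psi> \<subseteq> {..<m + n}" "\<And>(N :: 'u ustruct) v. sat N v \<psi> \<longleftrightarrow> (\<forall>\<phi>\<in>D. sat N v \<phi>)"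
        by (rule conj_formula[OF D(2), of "{..<m + n}"]) (use D(1) in auto)
      have "\<exists>x\<in>tuples (universe M) n. sat ?P (val x) \<phi> \<and> sat M (val x) \<psi>"
      proof (rule ccontr)
        assume "\<not> ?thesis"
        then have "Neg \<psi> \<in> C" using \<psi>(1,2) by (auto simp: C_def)
        then have "sat (pair_struct M2 E2) s2 (lift (Neg \<psi>))" using sat2 by blast
        then have "\<not> sat M2 s2 \<psi>" by simp
        then show False using \<psi>(3) D(1) by auto
      qed
      then obtain x where x: "x \<in> tuples (universe M) n" "sat ?P (val x) \<phi>" "\<forall>\<phi>\<in>D. sat M (val x) \<phi>"
        using \<psi>(3) by blast
      have "\<forall>\<psi>\<in>\<Delta>. sat ?P (val x) \<psi>"
      proof
        fix \<psi> assume "\<psi> \<in> \<Delta>"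
        then have "\<psi> = \<phi> \<or> \<psi> \<in> lift ` D" using D(3) by blast
        then show "sat ?P (val x) \<psi>" using x(2,3) by auto
      qed
      then show ?thesis using val[OF x(1)] by blast
    qed
    have "\<exists>M' E' s'. pair M' E' \<and> range s' \<subseteq> universe M' \<and>
        eqtp PL ?P s (pair_struct M' E') s' m \<and> (\<forall>\<psi>\<in>insert \<phi> (lift ` ?T). sat (pair_struct M' E') s' \<psi>)"
      by (rule pair_extension_ex[OF P s wf2 fin2])
    then obtain M1 E1 s1 where P1: "pair M1 E1" and s1: "range s1 \<subseteq> universe M1"
      and e1: "eqtp PL ?P s (pair_struct M1 E1) s1 m"
      and sat1: "\<forall>\<psi>\<in>insert \<phi> (lift ` ?T). sat (pair_struct M1 E1) s1 \<psi>"
      by (elim exE conjE)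
    have "eqtp L M2 s2 M1 s1 (m + n)"
    proof (rule eqtp_sub)
      fix \<psi> assume "wf_fm L \<psi>" "fv \<psi> \<subseteq> {..<m + n}" "sat M2 s2 \<psi>"
      then have "sat (pair_struct M1 E1) s1 (lift \<psi>)" using sat1 by blast
      then show "sat M1 s1 \<psi>" by simp
    qed
    moreover have "sat (pair_struct M1 E1) s1 \<omega>" using e1 \<omega>(1,2) \<omega>s by (simp add: eqtp_def)
    then have "openin (power_top (top_of M1) {..<n})
      {z \<in> tuples (universe M1) n. sat (pair_struct M1 E1) (append_tuple m s1 z) \<phi>}"
      unfolding \<omega>(3)[OF P1] .
    moreover have "sat (pair_struct M1 E1) s1 \<phi>" using sat1 by blast
    \<comment> \<open>The point of the second pair is known to satisfy \<open>\<phi>\<close> once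
      the open set is considered in the pair of \<open>M1\<close>, so \<open>M1\<close> plays the
      part of the pair in which points are moved.\<close>
    ultimately have "sat (pair_struct M2 E2) s2 \<phi>"
      using open_invariance[OF good_transfer[OF g P2 s2 e2] good_transfer[OF g P1 s1 e1] \<phi>] by blast
    moreover have "sat (pair_struct M2 E2) s2 (Neg \<phi>)" using sat2 by blast
    ultimately show False by simp
  qed
  then obtain \<psi> where \<psi>: "wf_fm L \<psi>" "fv \<psi> \<subseteq> {..<m + n}"
    "\<And>x. x \<in> tuples (universe M) n \<Longrightarrow> sat ?P (val x) \<phi> \<longleftrightarrow> sat M (val x) \<psi>" by blast
  let ?\<psi> = "rename (\<lambda>i. if i < m then n + i else i - m) \<psi>"
  have "sat M (append_tuple n x (restrict s {..<m})) ?\<psi> = sat M (append_tuple m s x) \<psi>" for x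
    unfolding sat_rename by (rule sat_cong) (use \<psi>(2) in \<open>auto simp: append_tuple_def\<close>)
  then have "X = {x \<in> tuples (universe M) n. sat M (append_tuple n x (restrict s {..<m})) ?\<psi>}"
    unfolding X\<phi> using \<psi>(3) val_sat[OF \<phi>(2)] val_sat[OF \<psi>(2)] by blast
  moreover have "fv ?\<psi> \<subseteq> {..<n + m}" by (rule fv_renameI) (use \<psi>(2) in auto)
  ultimately show ?thesis
    unfolding definable_set_def using \<psi>(1) restrict_tuples[OF sA]
    by (intro exI[of _ ?\<psi>] exI[of _ m] bexI[of _ "restrict s {..<m}"]) simp_all
qed

section \<open>Complements, interiors and closures of definable sets\<close>

lemma definable_set_complement:
  assumes "definable_set L' N A n X"
  shows "definable_set L' N A n (tuples (universe N) n - X)"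
proof -
  obtain \<phi> k b where b: "b \<in> tuples A k" "wf_fm L' \<phi>" "fv \<phi> \<subseteq> {..<n + k}"
    and X: "X = {x \<in> tuples (universe N) n. sat N (append_tuple n x b) \<phi>}"
    using assms unfolding definable_set_def by blast
  have "tuples (universe N) n - X = {x \<in> tuples (universe N) n. sat N (append_tuple n x b) (Neg \<phi>)}"
    unfolding X by auto
  then show ?thesis
    unfolding definable_set_def using b by (intro exI[of _ "Neg \<phi>"] exI[of _ k] bexI[of _ b]) auto
qed

lemma definable_set_interior:
  assumes P: "pair M E" and X: "definable_set PL (pair_struct M E) A n X"
  shows "definable_set PL (pair_struct M E) A n (power_top (top_of M) {..<n} interior_of X)"
proof -
  let ?P = "pair_struct M E"
  obtain \<phi>0 k b where b: "b \<in> tuples A k" "wf_fm PL \<phi>0" "fv \<phi>0 \<subseteq> {..<n + k}"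
    and X0: "X = {x \<in> tuples (universe M) n. sat ?P (append_tuple n x b) \<phi>0}"
    using X by (auto simp: definable_set_def)
  let ?r = "\<lambda>i. if i < n then k + i else i - n" and ?r' = "\<lambda>i. if i < k then n + i else i - k"
  let ?\<phi> = "rename ?r \<phi>0"
  have \<phi>: "wf_fm PL ?\<phi>" "fv ?\<phi> \<subseteq> {..<k + n}"
    using b(2) by simp (rule fv_renameI, use b(3) in auto)
  have "sat ?P (append_tuple k b x) ?\<phi> = sat ?P (append_tuple n x b) \<phi>0" for x
    unfolding sat_rename by (rule sat_cong) (use b(3) in \<open>auto simp: append_tuple_def\<close>)
  then have X\<phi>: "X = {x \<in> tuples (universe M) n. sat ?P (append_tuple k b x) ?\<phi>}" using X0 by simp
  obtain \<iota> where \<iota>: "wf_fm PL \<iota>" "fv \<iota> \<subseteq> {..<k + n}"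
    "\<And>M E s y. pair M E \<Longrightarrow> y \<in> tuples (universe M) n \<Longrightarrow>
      sat (pair_struct M E) (append_tuple k s y) \<iota> \<longleftrightarrow>
      y \<in> power_top (top_of M) {..<n} interior_of
        {z \<in> tuples (universe M) n. sat (pair_struct M E) (append_tuple k s z) ?\<phi>}"
    by (rule interior_formula[OF \<phi>]) blast
  have "sat ?P (append_tuple n x b) (rename ?r' \<iota>) = sat ?P (append_tuple k b x) \<iota>" for x
    unfolding sat_rename by (rule sat_cong) (use \<iota>(2) in \<open>auto simp: append_tuple_def\<close>)
  moreover have "power_top (top_of M) {..<n} interior_of X \<subseteq> tuples (universe M) n"
    using interior_of_subset_topspace[of "power_top (top_of M) {..<n}" X] topspace_power[OF pair_model[OF P]] by simp
  ultimately have "power_top (top_of M) {..<n} interior_of X =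
      {x \<in> tuples (universe ?P) n. sat ?P (append_tuple n x b) (rename ?r' \<iota>)}"
    using \<iota>(3)[OF P, of _ b] X\<phi> by auto
  moreover have "fv (rename ?r' \<iota>) \<subseteq> {..<n + k}" by (rule fv_renameI) (use \<iota>(2) in auto)
  ultimately show ?thesis
    unfolding definable_set_def using b(1) \<iota>(1)
    by (intro exI[of _ "rename ?r' \<iota>"] exI[of _ k] bexI[of _ b]) simp_all
qed

theorem closure_definable:
  assumes P: "pair M E" and A: "special L M E A" and X: "definable_set PL (pair_struct M E) A n X"
  shows "definable_set L M A n (power_top (top_of M) {..<n} closure_of X)"
proof -
  let ?X = "power_top (top_of M) {..<n}" and ?T = "tuples (universe M) n"
  have "definable_set PL (pair_struct M E) A n (?T - X)"
    using definable_set_complement[OF X] by simp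
  from open_definable[OF P A openin_interior_of definable_set_interior[OF P this]]
  have "definable_set L M A n (?X interior_of (?T - X))" .
  from definable_set_complement[OF this] show ?thesis
    using closure_of_interior_of[of ?X X] topspace_power[OF pair_model[OF P]] by simp
qed

end

theorem theorem1p20:
  fixes L :: "'u ulang" and R :: "'u ring_symbols" and T :: "'u ufm set"
    and \<theta> :: "'u ufm" and p :: nat
    and M :: "'u ustruct" and E A :: "'u set"
  assumes "geometric_theory L R T \<theta> p"
    and "tame_for_pairs L T \<theta> p"
    and "dense_pair L T \<theta> p M E"
    and "special L M E A"
  shows "(\<forall>n X. openin (power_top (def_top M \<theta> p) {..<n}) X \<and>
             definable_set (pair_lang L) (pair_struct M E) A n X \<longrightarrow>
             definable_set L M A n X) \<and>
         (\<forall>n X. definable_set (pair_lang L) (pair_struct M E) A n X \<longrightarrow>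
             definable_set L M A n (power_top (def_top M \<theta> p) {..<n} closure_of X))"
proof -
  interpret geometric L R T \<theta> p by unfold_locales (rule assms(1))
  show ?thesis using open_definable[OF assms(3,4)] closure_definable[OF assms(3,4)] by blast
qed

end
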